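(* Let $\mu\in(0,1)$ and consider asymptotics in $(m,n)$ with $m\to\infty$ and $n/m\to\mu$; set $N=m-n$. For all $\alpha\in (1/2,1)$ and for all $y \geqslant 0$, $$\frac{1}{N^{2\alpha-1}} \log \mathbb{P}(d_{m,n} - \mathbb{E}[d_{m,n}] \leqslant - N^{\alpha} y) \xrightarrow[m\to \infty]{} - \frac{y^2}{2\sigma^2(\mu)} ,$$ where $$\sigma^2(\mu) := \frac{6\mu^2 - 6\mu^3 + 4\mu^4 - \mu^5}{12(1-\mu)^5} .$$
   Context: Hashing with linear probing (parking on a circle): for integers $1\leqslant m$ and $0 \leqslant n \leqslant m$, there are $m$ parking spaces numbered $1,\dots,m$ and arranged cyclically ($m$ is followed by $1$). $n$ cars arrive sequentially; their addresses are independent and uniformly distributed on $\{1,\dots,m\}$. A car with address $h$ parks at the first unoccupied space in the cyclic order $h, h+1,\dots,m,1,2,\dots,h-1$. The displacement of a car is the number of spaces it moves from its address to the space where it parks (it is $0$ if its address is unoccupied). The total displacement $d_{m,n}$ is the sum of the displacements of the $n$ cars. *)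

theory Defs
  imports "HOL-Probability.Probability"
begin

text \<open>Spaces are the numbers \<open>1, \<dots>, m\<close>; \<open>cyclic_space m h j\<close> is the space reached from \<open>h\<close>
  after \<open>j\<close> cyclic steps, where \<open>m\<close> is followed by \<open>1\<close>. It is meant for \<open>h \<ge> 1\<close>, as the
  subtraction on \<^typ>\<open>nat\<close> truncates.\<close>

definition cyclic_space :: "nat \<Rightarrow> nat \<Rightarrow> nat \<Rightarrow> nat" where
  "cyclic_space m h j = (h - 1 + j) mod m + 1"

text \<open>The \<open>LEAST\<close> below is meaningful only while some space of \<open>{1..m}\<close> lies outside the
  occupied set \<open>A\<close>, which is the case for each arriving car when there are at most \<open>m\<close> cars.\<close>

definition displacement :: "nat \<Rightarrow> nat set \<Rightarrow> nat \<Rightarrow> nat" where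
  "displacement m A h = (LEAST j. cyclic_space m h j \<notin> A)"

definition parking_space :: "nat \<Rightarrow> nat set \<Rightarrow> nat \<Rightarrow> nat" where
  "parking_space m A h = cyclic_space m h (displacement m A h)"

fun total_displacement_from :: "nat \<Rightarrow> nat set \<Rightarrow> nat list \<Rightarrow> nat" where
  "total_displacement_from m A [] = 0"
| "total_displacement_from m A (h # hs) =
     displacement m A h + total_displacement_from m (insert (parking_space m A h) A) hs"

definition total_displacement :: "nat \<Rightarrow> nat list \<Rightarrow> nat" where
  "total_displacement m hs = total_displacement_from m {} hs"

text \<open>The list of the \<open>n\<close> addresses in order of arrival: \<open>n\<close> independent uniform draws from
  \<open>{1..m}\<close>.\<close>

definition addresses :: "nat \<Rightarrow> nat \<Rightarrow> nat list pmf" where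
  "addresses m n = replicate_pmf n (pmf_of_set {1..m})"

definition expected_displacement :: "nat \<Rightarrow> nat \<Rightarrow> real" where
  "expected_displacement m n =
     measure_pmf.expectation (addresses m n) (\<lambda>hs. real (total_displacement m hs))"

definition sigma2 :: "real \<Rightarrow> real" where
  "sigma2 \<mu> = (6 * \<mu>^2 - 6 * \<mu>^3 + 4 * \<mu>^4 - \<mu>^5) / (12 * (1 - \<mu>)^5)"

end

theory Submission
  imports Defs "HOL-Real_Asymp.Real_Asymp"
begin

text \<open>Cut the circle at the \<open>N = m - n\<close> empty spaces. This gives \<open>N\<close> blocks, and up to rotation the
  law of \<open>d\<^sub>m\<^sub>n\<close> is that of the total displacement of \<open>N\<close> independent blocks, conditioned on holding
  \<open>n\<close> cars. Hence \<open>E (q ^ d\<^sub>m\<^sub>n)\<close> is the ratio of the coefficients of \<open>z ^ n\<close> in \<open>F\<^sub>q ^ N\<close> and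
  \<open>F\<^sub>1 ^ N\<close>, where the last car of a block yields the equation
  \<open>F\<^sub>q' = F\<^sub>q (F\<^sub>q - q F\<^sub>q(q z)) / (1 - q)\<close>. Differentiating it at \<open>q = 1\<close> gives the first two moments
  of the displacement of a block in closed form in terms of the tree function.

  With \<open>q = exp (- s N powr (\<alpha> - 1))\<close> and \<open>z\<close> within \<open>N powr (\<alpha> - 1)\<close> of the saddle point,
  \<open>F\<^sub>q(z) ^ N z ^ (- n)\<close> has the right exponential order. It bounds the coefficient from above. For
  the lower bound no local limit theorem is needed: all but a small proportion of the blocks are tilted
  so that by Chernoff's bound they hold nearly the right number of cars, and the remaining blocks
  absorb the difference, where Jensen's inequality bounds the cost of their displacement by its mean.
  This is the limit of the logarithmic moment generating function for nonpositive tilts of the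
  displacement, and the argument of Gartner and Ellis yields the lower tail.\<close>

text \<open>Only q at most 1 is usable: k cars with the same address have displacement k (k - 1) /
  2, so for q > 1 the block series in z has radius of convergence 0. For the lower tail nonnegative
  multiples of E d - d suffice, as y is nonnegative.

  The scale of q is forced. With speed R = N powr (2 \<alpha> - 1) the exponent s R (E d - d) / N
  powr \<alpha> is s eps (E d - d) for eps = N powr (\<alpha> - 1). As N eps^2 = R, the rate comes
  from second-order terms in eps. First-order terms have size N eps, which is much larger than R, so
  they have to cancel exactly. This is the reason for closed forms of the moments and for a mean
  known up to a bounded error.

  Size and displacement of a block are correlated, and conditioning on the total size removes the
  part of the displacement that the size explains. Accordingly \<open>sigma2 \<mu>\<close> is the
  variance of the displacement of a block minus the squared covariance with its size divided by the
  variance of the size.\<close>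

unbundle no vec_syntax and fps_syntax

subsection \<open>Generating functions of a block of occupied spaces\<close>

definition q_int :: "nat \<Rightarrow> real poly" where
  "q_int i = (\<Sum>l\<le>i. monom 1 l)"

text \<open>The coefficient of \<open>q ^ d\<close> in \<open>block_poly k\<close> is \<open>1 / k!\<close> times the number of address lists of
  total displacement \<open>d\<close> that fill \<open>k\<close> consecutive spaces and leave the next one empty. In the
  recursion the last car joins runs of lengths \<open>i\<close> and \<open>k - i\<close>.\<close>

fun block_poly :: "nat \<Rightarrow> real poly" where
  "block_poly 0 = 1"
| "block_poly (Suc k) =
     smult (1 / (real k + 1)) (\<Sum>i\<le>k. block_poly i * block_poly (k - i) * q_int i)"

definition block_fps :: "real poly fps" where
  "block_fps = Abs_fps block_poly"

definition eval_coeffs :: "real \<Rightarrow> real poly fps \<Rightarrow> real fps" where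
  "eval_coeffs q F = Abs_fps (\<lambda>k. poly (F $ k) q)"

definition fps_pderiv :: "real poly fps \<Rightarrow> real poly fps" where
  "fps_pderiv F = Abs_fps (\<lambda>k. pderiv (F $ k))"

abbreviation block_gf :: "real \<Rightarrow> real fps" where
  "block_gf q \<equiv> eval_coeffs q block_fps"

lemma eval_coeffs_mult: "eval_coeffs q (F * G) = eval_coeffs q F * eval_coeffs q G"
  by (rule fps_ext) (simp add: eval_coeffs_def fps_mult_nth poly_sum)

lemma eval_coeffs_add: "eval_coeffs q (F + G) = eval_coeffs q F + eval_coeffs q G"
  by (rule fps_ext) (simp add: eval_coeffs_def)

lemma eval_coeffs_1 [simp]: "eval_coeffs q 1 = 1"
  by (rule fps_ext) (simp add: eval_coeffs_def)

lemma eval_coeffs_power: "eval_coeffs q (F ^ N) = eval_coeffs q F ^ N"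
  by (induction N) (simp_all add: eval_coeffs_mult)

lemma eval_coeffs_deriv: "eval_coeffs q (fps_deriv F) = fps_deriv (eval_coeffs q F)"
  by (rule fps_ext) (simp add: eval_coeffs_def poly_of_nat del: of_nat_Suc)

lemma pderiv_sum: "pderiv (\<Sum>i\<in>I. f i) = (\<Sum>i\<in>I. pderiv (f i))"
  by (induction I rule: infinite_finite_induct) (simp_all add: pderiv_add)

lemma fps_pderiv_mult: "fps_pderiv (F * G) = fps_pderiv F * G + F * fps_pderiv G"
proof (rule fps_ext)
  fix n
  have "pderiv (\<Sum>i=0..n. F $ i * G $ (n - i))
     = (\<Sum>i=0..n. pderiv (F $ i) * G $ (n - i) + F $ i * pderiv (G $ (n - i)))"
    unfolding pderiv_sum by (intro sum.cong refl) (simp add: pderiv_mult algebra_simps)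
  then show "fps_pderiv (F * G) $ n = (fps_pderiv F * G + F * fps_pderiv G) $ n"
    by (simp add: fps_pderiv_def fps_mult_nth sum.distrib)
qed

lemma fps_pderiv_add: "fps_pderiv (F + G) = fps_pderiv F + fps_pderiv G"
  by (rule fps_ext) (simp add: fps_pderiv_def pderiv_add)

lemma fps_pderiv_1 [simp]: "fps_pderiv 1 = 0"
  by (rule fps_ext) (simp add: fps_pderiv_def)

lemma fps_pderiv_deriv: "fps_pderiv (fps_deriv F) = fps_deriv (fps_pderiv F)"
proof (rule fps_ext)
  fix n
  have "pderiv (of_nat (Suc n) * F $ Suc n) = of_nat (Suc n) * pderiv (F $ Suc n)"
    by (simp add: of_nat_poly pderiv_smult del: of_nat_Suc)
  then show "fps_pderiv (fps_deriv F) $ n = fps_deriv (fps_pderiv F) $ n"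
    by (simp add: fps_pderiv_def del: of_nat_Suc)
qed

lemma fps_pderiv_power_eval:
  "eval_coeffs q (fps_pderiv (F ^ N)) =
     of_nat N * eval_coeffs q F ^ (N - 1) * eval_coeffs q (fps_pderiv F)"
proof (induction N)
  case 0
  then show ?case by (simp add: eval_coeffs_def fps_zero_def)
next
  case (Suc N)
  have *: "eval_coeffs q F * (of_nat N * eval_coeffs q F ^ (N - 1)) =
      of_nat N * eval_coeffs q F ^ N"
    by (cases N) (simp_all add: mult_ac)
  have "eval_coeffs q (fps_pderiv (F ^ Suc N)) =
      eval_coeffs q (fps_pderiv F) * eval_coeffs q F ^ N +
      eval_coeffs q F * (of_nat N * eval_coeffs q F ^ (N - 1)) * eval_coeffs q (fps_pderiv F)"
    by (simp add: Suc fps_pderiv_mult eval_coeffs_mult eval_coeffs_add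
        eval_coeffs_power mult.assoc)
  then show ?case unfolding * by (simp add: algebra_simps)
qed

text \<open>This is the series (F_q(z) - q F_q(q z)) / (1 - q), with the division by 1 - q carried
  out in \<open>q_int\<close>, so that q = 1 may be inserted.\<close>

definition block_rate :: "real poly fps" where
  "block_rate = Abs_fps (\<lambda>i. block_poly i * q_int i)"

lemma block_fps_deriv: "fps_deriv block_fps = block_fps * block_rate"
proof (rule fps_ext)
  fix k
  have "fps_deriv block_fps $ k = of_nat (Suc k) * block_poly (Suc k)"
    by (simp add: block_fps_def del: of_nat_Suc block_poly.simps)
  also have "of_nat (Suc k) * block_poly (Suc k)
      = (\<Sum>i\<le>k. block_poly i * block_poly (k - i) * q_int i)"
    by (simp add: of_nat_poly del: of_nat_Suc) (simp add: add.commute)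
  also have "\<dots> = (block_rate * block_fps) $ k"
    unfolding fps_mult_nth block_rate_def block_fps_def atLeast0AtMost
    by (intro sum.cong refl) (simp add: mult_ac)
  also have "block_rate * block_fps = block_fps * block_rate"
    by (rule mult.commute)
  finally show "fps_deriv block_fps $ k = (block_fps * block_rate) $ k" .
qed

section \<open>Derivatives of the block series at q = 1\<close>

definition fps_A :: "real fps" where "fps_A = eval_coeffs 1 block_fps"
definition fps_B :: "real fps" where "fps_B = eval_coeffs 1 (fps_pderiv block_fps)"
definition fps_C :: "real fps" where "fps_C = eval_coeffs 1 (fps_pderiv (fps_pderiv block_fps))"

definition euler :: "real fps \<Rightarrow> real fps" where "euler f = fps_X * fps_deriv f"

lemma euler_nth: "euler f $ k = real k * f $ k"
  by (cases k) (simp_all add: euler_def)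

lemma euler_add: "euler (f + g) = euler f + euler g"
  by (simp add: euler_def algebra_simps)

lemma euler_mult: "euler (f * g) = euler f * g + f * euler g"
  by (simp add: euler_def algebra_simps)

lemma euler_diff: "euler (f - g) = euler f - euler g"
  by (simp add: euler_def algebra_simps)

lemma q_int_eval:
  "poly (q_int i) 1 = real i + 1"
  "poly (pderiv (q_int i)) 1 = real i * (real i + 1) / 2"
  "poly (pderiv (pderiv (q_int i))) 1 = (real i + 1) * real i * (real i - 1) / 3"
proof -
  have *: "q_int (Suc i) = q_int i + monom 1 (Suc i)" for i
    by (simp add: q_int_def)
  have 0: "q_int 0 = 1" by (simp add: q_int_def)
  show "poly (q_int i) 1 = real i + 1"
    by (induction i) (simp_all add: * 0 poly_monom)
  show "poly (pderiv (q_int i)) 1 = real i * (real i + 1) / 2"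
    by (induction i) (simp_all add: * 0 poly_monom pderiv_add pderiv_monom field_simps)
  show "poly (pderiv (pderiv (q_int i))) 1 = (real i + 1) * real i * (real i - 1) / 3"
    by (induction i) (simp_all add: * 0 poly_monom pderiv_add pderiv_monom field_simps)
qed

text \<open>At q = 1 the factors coming from \<open>q_int\<close> are polynomials in the index, and
  multiplying coefficients by the index is the operator \<open>euler\<close>. The same holds for the
  next two lemmas.\<close>

lemma block_rate_eval0: "eval_coeffs 1 block_rate = fps_A + euler fps_A"
  by (rule fps_ext)
    (simp add: eval_coeffs_def block_rate_def fps_A_def block_fps_def euler_nth q_int_eval
      algebra_simps)

lemma block_rate_eval1:
  "eval_coeffs 1 (fps_pderiv block_rate) =
     fps_B + euler fps_B + fps_const (1/2) * euler (fps_A + euler fps_A)"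
  by (rule fps_ext)
    (simp add: eval_coeffs_def fps_pderiv_def block_rate_def fps_A_def fps_B_def block_fps_def
      euler_nth q_int_eval pderiv_mult field_simps)

lemma block_rate_eval2:
  "eval_coeffs 1 (fps_pderiv (fps_pderiv block_rate)) =
     fps_C + euler fps_C + euler (fps_B + euler fps_B) +
     fps_const (1/3) * (euler (euler (fps_A + euler fps_A)) - euler (fps_A + euler fps_A))"
  by (rule fps_ext)
    (simp add: eval_coeffs_def fps_pderiv_def block_rate_def fps_A_def fps_B_def fps_C_def
      block_fps_def euler_nth q_int_eval pderiv_mult pderiv_add field_simps)

lemma fps_A_deriv: "fps_deriv fps_A = fps_A * (fps_A + euler fps_A)"
  using arg_cong[OF block_fps_deriv, of "eval_coeffs 1"]
  by (simp add: eval_coeffs_deriv eval_coeffs_mult block_rate_eval0 fps_A_def[symmetric])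

lemma fps_B_deriv:
  "fps_deriv fps_B = fps_B * (fps_A + euler fps_A) +
     fps_A * (fps_B + euler fps_B + fps_const (1/2) * euler (fps_A + euler fps_A))"
  using arg_cong[OF block_fps_deriv, of "\<lambda>F. eval_coeffs 1 (fps_pderiv F)"]
  by (simp only: fps_pderiv_deriv fps_pderiv_mult eval_coeffs_add eval_coeffs_deriv
      eval_coeffs_mult block_rate_eval0 block_rate_eval1 fps_A_def[symmetric] fps_B_def[symmetric])

lemma fps_C_deriv:
  "fps_deriv fps_C = fps_C * (fps_A + euler fps_A) +
     fps_const 2 * fps_B * (fps_B + euler fps_B + fps_const (1/2) * euler (fps_A + euler fps_A)) +
     fps_A * (fps_C + euler fps_C + euler (fps_B + euler fps_B) +
       fps_const (1/3) * (euler (euler (fps_A + euler fps_A)) - euler (fps_A + euler fps_A)))"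
proof -
  have "fps_deriv fps_C = fps_C * (fps_A + euler fps_A) +
     fps_B * eval_coeffs 1 (fps_pderiv block_rate) +
     (fps_B * eval_coeffs 1 (fps_pderiv block_rate) +
     fps_A * eval_coeffs 1 (fps_pderiv (fps_pderiv block_rate)))"
  using arg_cong[OF block_fps_deriv, of "\<lambda>F. eval_coeffs 1 (fps_pderiv (fps_pderiv F))"]
  by (simp only: fps_pderiv_deriv fps_pderiv_mult fps_pderiv_add eval_coeffs_add
      eval_coeffs_deriv eval_coeffs_mult block_rate_eval0
      fps_A_def[symmetric] fps_B_def[symmetric] fps_C_def[symmetric])
  moreover have "fps_const 2 = (2 :: real fps)" by (simp add: numeral_fps_const)
  moreover have "2 * fps_const (1/2) = (1 :: real fps)" by (simp add: numeral_fps_const)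
  ultimately show ?thesis
    unfolding block_rate_eval1 block_rate_eval2 by algebra
qed

text \<open>On the right the coefficient of index k involves only G $ 0, ..., G $ k, because
  \<open>euler\<close> merely multiplies by the index; on the left it is (k + 1) times G $ (k + 1).
  A conjectured closed form is thus confirmed once it solves the same inhomogeneous equation as the
  series.\<close>

lemma linear_ode_unique:
  fixes G :: "real fps"
  assumes "fps_deriv G = G * (fps_A + euler fps_A) + fps_A * (G + euler G)" "G $ 0 = 0"
  shows "G = 0"
proof (rule fps_ext)
  fix k show "G $ k = 0 $ k"
  proof (induction k rule: less_induct)
    case (less k)
    show ?case
    proof (cases k)
      case (Suc k')
      have "real (Suc k') * G $ Suc k' = fps_deriv G $ k'"
        by simp
      also have "\<dots> = 0"
        unfolding assms(1) using less Suc
        by (auto simp: fps_mult_nth euler_nth intro!: sum.neutral)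
      finally show ?thesis using Suc by simp
    qed (simp add: assms)
  qed
qed

text \<open>The tree function \<open>T = z exp T\<close>; its derivatives are polynomials in \<open>fps_A\<close> and
  \<open>U = T / (1 - T)\<close>, so that the equations for \<open>fps_B\<close> and \<open>fps_C\<close> become polynomial identities.\<close>

definition fps_T :: "real fps" where "fps_T = fps_X * fps_A"
definition fps_U :: "real fps" where "fps_U = fps_T * inverse (1 - fps_T)"

lemma fps_U_eq: "fps_U * (1 - fps_T) = fps_T" and fps_U_eq2: "inverse (1 - fps_T) = 1 + fps_U"
proof -
  have *: "inverse (1 - fps_T) * (1 - fps_T) = 1"
    by (rule inverse_mult_eq_1) (simp add: fps_T_def)
  then show "fps_U * (1 - fps_T) = fps_T" by (simp add: fps_U_def mult.assoc)
  from * show "inverse (1 - fps_T) = 1 + fps_U" by (simp add: fps_U_def algebra_simps)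
qed

lemma fps_A_0: "fps_A $ 0 = 1" and fps_B_0: "fps_B $ 0 = 0" and fps_C_0: "fps_C $ 0 = 0"
  by (simp_all add: fps_A_def fps_B_def fps_C_def eval_coeffs_def fps_pderiv_def block_fps_def)

lemma fps_U_0: "fps_U $ 0 = 0"
  by (simp add: fps_U_def fps_T_def)

lemma fps_A_deriv': "fps_deriv fps_A = fps_A * fps_A * (1 + fps_U)"
proof -
  have "fps_deriv fps_A * (1 - fps_T) = fps_A * fps_A"
    using fps_A_deriv by (simp add: euler_def fps_T_def algebra_simps)
  moreover have "(1 - fps_T) * (1 + fps_U) = 1"
    using fps_U_eq by (simp add: algebra_simps)
  ultimately show ?thesis
    by (metis mult.assoc mult.right_neutral)
qed

lemma fps_T_mult: "fps_T * (1 + fps_U) = fps_U"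
  using fps_U_eq2 fps_U_def by metis

lemma fps_T_deriv: "fps_deriv fps_T = fps_A * (1 + fps_U)"
proof -
  have "fps_deriv fps_T = fps_A + fps_A * (fps_T * (1 + fps_U))"
    by (simp add: fps_T_def fps_A_deriv' algebra_simps)
  then show ?thesis unfolding fps_T_mult by (simp add: algebra_simps)
qed

lemma fps_U_deriv: "fps_deriv fps_U = fps_A * (1 + fps_U) ^ 3"
proof -
  have "fps_deriv (1 + fps_U) = fps_deriv (inverse (1 - fps_T))"
    by (simp add: fps_U_eq2)
  also have "\<dots> = - fps_deriv (1 - fps_T) * (inverse (1 - fps_T))\<^sup>2"
    by (rule fps_inverse_deriv) (simp add: fps_T_def)
  finally show ?thesis
    by (simp add: fps_U_eq2 fps_T_deriv power2_eq_square power3_eq_cube mult_ac)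
qed

lemma euler_A: "euler fps_A = fps_A * fps_U"
proof -
  have "euler fps_A = fps_A * (fps_T * (1 + fps_U))"
    by (simp add: euler_def fps_A_deriv' fps_T_def mult_ac)
  then show ?thesis by (simp add: fps_T_mult)
qed

lemma euler_U: "euler fps_U = fps_U * (1 + fps_U)\<^sup>2"
proof -
  have "euler fps_U = (fps_T * (1 + fps_U)) * (1 + fps_U)\<^sup>2"
    by (simp add: euler_def fps_U_deriv fps_T_def power2_eq_square power3_eq_cube mult_ac)
  then show ?thesis by (simp add: fps_T_mult)
qed

lemma euler_numeral [simp]: "euler (numeral k) = 0" "euler 1 = 0"
  by (simp_all add: euler_def numeral_fps_const)

lemma fps_B_closed: "2 * fps_B = fps_A * fps_U\<^sup>2"
proof -
  define G where "G = 2 * fps_B - fps_A * fps_U\<^sup>2"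
  have half: "2 * fps_const (1/2 :: real) = 1"
    by (simp add: numeral_fps_const)
  have eqB: "fps_deriv (2 * fps_B) = (2 * fps_B) * (fps_A + euler fps_A) +
     fps_A * (2 * fps_B + euler (2 * fps_B)) + fps_A * (euler (fps_A + euler fps_A))"
  proof -
    have "fps_deriv (2 * fps_B) = (2 * fps_B) * (fps_A + euler fps_A) +
     fps_A * (2 * fps_B + 2 * euler fps_B + (2 * fps_const (1/2)) * euler (fps_A + euler fps_A))"
      by (simp add: fps_B_deriv numeral_fps_const[symmetric] algebra_simps)
    then show ?thesis unfolding half by (simp add: euler_mult algebra_simps)
  qed
  have eqG: "fps_deriv (fps_A * fps_U\<^sup>2) = (fps_A * fps_U\<^sup>2) * (fps_A + euler fps_A) +
     fps_A * (fps_A * fps_U\<^sup>2 + euler (fps_A * fps_U\<^sup>2)) + fps_A * (euler (fps_A + euler fps_A))"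
    by (simp add: power2_eq_square euler_mult euler_add euler_A euler_U fps_A_deriv' fps_U_deriv) 
       algebra
  have "fps_deriv G = G * (fps_A + euler fps_A) + fps_A * (G + euler G)"
    unfolding G_def fps_deriv_sub eqB eqG euler_diff by (simp add: algebra_simps)
  then have "G = 0"
    by (rule linear_ode_unique) (simp add: G_def fps_B_0 fps_U_0 numeral_fps_const)
  then show ?thesis by (simp add: G_def)
qed

lemma fps_C_closed: "12 * fps_C = fps_A * (24 * fps_U ^ 3 + 37 * fps_U ^ 4 + 15 * fps_U ^ 5)"
  (is "_ = ?R")
proof -
  define G where "G = 12 * fps_C - ?R"
  have c: "12 * fps_const (1/2 :: real) = 6" "12 * fps_const (1/3 :: real) = 4" "fps_const (2::real) = 2"
     by (simp_all add: numeral_fps_const)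
  \<comment> \<open>The part of the equation for \<open>12 * fps_C\<close> that is free of
    \<open>fps_C\<close>. It is written through \<open>2 * fps_B\<close>, so that
    \<open>fps_B_closed\<close> can be substituted without a division.\<close>
  define S where "S = 6 * (2 * fps_B) * (2 * fps_B + euler (2 * fps_B) + euler (fps_A + euler fps_A)) +
     fps_A * (6 * euler (2 * fps_B + euler (2 * fps_B)) +
       4 * (euler (euler (fps_A + euler fps_A)) - euler (fps_A + euler fps_A)))"
  have eqC: "fps_deriv (12 * fps_C) = (12 * fps_C) * (fps_A + euler fps_A) +
     fps_A * (12 * fps_C + euler (12 * fps_C)) + S"
  proof -
    have "fps_deriv (12 * fps_C) = 12 * (fps_C * (fps_A + euler fps_A)) +
     (2 * 12 * fps_B * (fps_B + euler fps_B) + 2 * fps_B * (12 * fps_const (1/2)) * euler (fps_A + euler fps_A)) +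
     fps_A * (12 * fps_C + 12 * euler fps_C + 12 * euler (fps_B + euler fps_B) +
       (12 * fps_const (1/3)) * (euler (euler (fps_A + euler fps_A)) - euler (fps_A + euler fps_A)))"
      by (simp add: fps_C_deriv c(3) algebra_simps)
    then show ?thesis unfolding c S_def by (simp add: euler_mult euler_add algebra_simps)
  qed
  have eqG: "fps_deriv ?R = ?R * (fps_A + euler fps_A) + fps_A * (?R + euler ?R) + S"
    unfolding S_def fps_B_closed
    by (simp add: eval_nat_numeral euler_mult euler_add euler_A euler_U fps_A_deriv' fps_U_deriv) 
       algebra
  have "fps_deriv G = G * (fps_A + euler fps_A) + fps_A * (G + euler G)"
    unfolding G_def fps_deriv_sub eqC eqG euler_diff by (simp add: algebra_simps)
  then have "G = 0"
    by (rule linear_ode_unique) (simp add: G_def fps_C_0 fps_U_0 numeral_fps_const fps_power_zeroth)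
  then show ?thesis by (simp add: G_def)
qed


section \<open>Coefficients of powers of \<open>fps_A\<close> and bounds for the mean
  displacement\<close>

text \<open>Absorbing \<open>euler fps_A\<close> into \<open>euler (fps_A ^ Suc N)\<close> trades
  one unit of the index for one more power. Iterating down to index 0 takes the place of Lagrange
  inversion.\<close>

lemma fps_A_power_rec:
  assumes "0 < N"
  shows "real (Suc N) * real (Suc n) * (fps_A ^ N) $ Suc n =
         real N * real (Suc N + n) * (fps_A ^ Suc N) $ n"
proof -
  obtain M where N: "N = Suc M" using assms by (cases N) auto
  have "of_nat (Suc N) * fps_deriv (fps_A ^ N) =
      of_nat (Suc N) * (of_nat N * fps_A ^ M * (fps_A * (fps_A + euler fps_A)))"
    unfolding fps_deriv_power' fps_A_deriv[symmetric] by (simp add: N mult_ac)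
  also have "\<dots> = of_nat N * (of_nat (Suc N) * fps_A ^ Suc N) +
      of_nat N * (of_nat (Suc N) * fps_A ^ N * euler fps_A)"
    by (simp add: N algebra_simps)
  also have "of_nat (Suc N) * fps_A ^ N * euler fps_A = euler (fps_A ^ Suc N)"
    unfolding euler_def fps_deriv_power' by (simp add: mult_ac)
  finally have "(of_nat (Suc N) * fps_deriv (fps_A ^ N)) $ n =
      (of_nat N * (of_nat (Suc N) * fps_A ^ Suc N) + of_nat N * euler (fps_A ^ Suc N)) $ n"
    by simp
  then show ?thesis
    by (simp add: fps_of_nat[symmetric] euler_nth algebra_simps del: of_nat_Suc fps_of_nat power_Suc)
      (simp add: algebra_simps)
qed

text \<open>Lagrange's formula N (N + n) ^ (n - 1) / n! for powers of exp T. The factor N + n on the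
  left avoids the exponent n - 1, which would truncate at n = 0.\<close>

lemma fps_A_power_nth:
  assumes "0 < N"
  shows "real (N + n) * (fps_A ^ N) $ n = real N * real (N + n) ^ n / fact n"
  using assms
proof (induction n arbitrary: N)
  case 0
  then show ?case by (simp add: fps_A_0 fps_power_zeroth)
next
  case (Suc n)
  have "real (Suc N) * (real (Suc n) * (fps_A ^ N) $ Suc n) = 
      real N * (real (Suc N + n) * (fps_A ^ Suc N) $ n)"
    using fps_A_power_rec[OF Suc.prems, of n] by (simp only: mult.assoc)
  also have "\<dots> = real (Suc N) * (real N * real (N + Suc n) ^ n / fact n)"
    by (subst Suc.IH) (simp_all add: mult_ac del: of_nat_Suc)
  finally have "real (Suc n) * (fps_A ^ N) $ Suc n = real N * real (N + Suc n) ^ n / fact n"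
    by (subst (asm) mult_cancel_left) (simp del: of_nat_Suc)
  then have "(fps_A ^ N) $ Suc n = real N * real (N + Suc n) ^ n / fact (Suc n)"
    by (simp add: field_simps del: of_nat_Suc of_nat_add)
  then show ?case by simp
qed

lemma fps_A_power_pos:
  assumes "0 < N"
  shows "0 < (fps_A ^ N) $ n"
proof -
  have "0 < real (N + n) * (fps_A ^ N) $ n"
    unfolding fps_A_power_nth[OF assms] using assms by simp
  then show ?thesis using assms by (simp add: zero_less_mult_iff)
qed

text \<open>The mean of the total displacement with \<open>N\<close> empty spaces and \<open>n\<close> cars, see
  \<open>expected_displacement_eq\<close>.\<close>

definition mean_disp :: "nat \<Rightarrow> nat \<Rightarrow> real" where
  "mean_disp N n = (of_nat N * fps_A ^ (N - 1) * fps_B) $ n / (fps_A ^ N) $ n"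

lemma fps_of_nat_mult_nth: "(of_nat c * f) $ n = real c * f $ n" for f :: "real fps"
  unfolding fps_of_nat[symmetric] by simp

lemma mean_disp_eq:
  assumes "0 < N"
  shows "mean_disp N n = real N * (fps_A ^ N * fps_U\<^sup>2) $ n / (2 * (fps_A ^ N) $ n)"
proof -
  obtain M where N: "N = Suc M" using assms by (cases N) auto
  have "2 * (of_nat N * fps_A ^ (N - 1) * fps_B) = of_nat N * (fps_A ^ N * fps_U\<^sup>2)"
  proof -
    have "2 * (of_nat N * fps_A ^ (N - 1) * fps_B) = of_nat N * (fps_A ^ M * (2 * fps_B))"
      by (simp add: N mult_ac)
    then show ?thesis unfolding fps_B_closed by (simp add: N mult_ac)
  qed
  then have "(2 * (of_nat N * fps_A ^ (N - 1) * fps_B)) $ n = (of_nat N * (fps_A ^ N * fps_U\<^sup>2)) $ n"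
    by (rule arg_cong)
  then have "2 * (of_nat N * fps_A ^ (N - 1) * fps_B) $ n = real N * (fps_A ^ N * fps_U\<^sup>2) $ n"
    by (simp only: numeral_fps_const mult.assoc fps_of_nat_mult_nth fps_mult_left_const_nth)
  then have eq: "(of_nat N * fps_A ^ (N - 1) * fps_B) $ n = real N * (fps_A ^ N * fps_U\<^sup>2) $ n / 2"
    by linarith
  show ?thesis unfolding mean_disp_def eq by simp
qed

lemma mean_disp_0 [simp]: "mean_disp N 0 = 0"
  by (simp add: mean_disp_def fps_B_0)

text \<open>From U = T + T U follows U^2 = z A (U^2 + U), and \<open>fps_A ^ Suc N * fps_U\<close>
  is a multiple of an \<open>euler\<close> derivative. The number N + n of spaces is the same on
  both sides, so the mean can be estimated by induction on the number of cars with the circle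
  fixed.\<close>

lemma mean_disp_Suc:
  assumes "0 < N"
  shows "mean_disp N (Suc n) =
    real (Suc n) / real (N + Suc n) * (mean_disp (Suc N) n + real n / 2)"
proof -
  have "euler (fps_A ^ Suc N) = of_nat (Suc N) * fps_A ^ N * euler fps_A"
    unfolding euler_def fps_deriv_power' by (simp add: mult_ac)
  then have "euler (fps_A ^ Suc N) = of_nat (Suc N) * fps_A ^ Suc N * fps_U"
    by (simp add: euler_A mult_ac)
  then have "of_nat (Suc N) * (fps_A ^ N * fps_U\<^sup>2) =
      fps_X * (of_nat (Suc N) * (fps_A ^ Suc N * fps_U\<^sup>2) + euler (fps_A ^ Suc N))"
  proof -
    assume *: "euler (fps_A ^ Suc N) = of_nat (Suc N) * fps_A ^ Suc N * fps_U"
    have "fps_U = fps_T + fps_T * fps_U"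
      using fps_U_eq by (simp add: algebra_simps)
    then have "fps_U * fps_U = (fps_T + fps_T * fps_U) * fps_U"
      by simp
    then have **: "fps_U\<^sup>2 = fps_X * fps_A * (fps_U\<^sup>2 + fps_U)"
      by (simp add: fps_T_def power2_eq_square algebra_simps)
    have "of_nat (Suc N) * (fps_A ^ N * fps_U\<^sup>2) =
        of_nat (Suc N) * (fps_A ^ N * (fps_X * fps_A * (fps_U\<^sup>2 + fps_U)))"
      by (rule arg_cong[OF **])
    also have "\<dots> = fps_X * (of_nat (Suc N) * (fps_A ^ Suc N * fps_U\<^sup>2) +
        of_nat (Suc N) * fps_A ^ Suc N * fps_U)"
      by (simp add: algebra_simps)
    finally show ?thesis unfolding * .
  qed
  then have "(of_nat (Suc N) * (fps_A ^ N * fps_U\<^sup>2)) $ Suc n =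
      (fps_X * (of_nat (Suc N) * (fps_A ^ Suc N * fps_U\<^sup>2) + euler (fps_A ^ Suc N))) $ Suc n"
    by simp
  then have 1: "real (Suc N) * (fps_A ^ N * fps_U\<^sup>2) $ Suc n =
      real (Suc N) * (fps_A ^ Suc N * fps_U\<^sup>2) $ n + real n * (fps_A ^ Suc N) $ n"
    by (simp only: fps_of_nat[symmetric] fps_mult_left_const_nth fps_X_mult_nth euler_nth fps_add_nth) simp
  define p where "p = (fps_A ^ Suc N) $ n"
  define p' where "p' = (fps_A ^ N) $ Suc n"
  define e where "e = (fps_A ^ Suc N * fps_U\<^sup>2) $ n"
  define e' where "e' = (fps_A ^ N * fps_U\<^sup>2) $ Suc n"
  have p: "0 < p" "0 < p'" using assms by (auto simp: p_def p'_def intro: fps_A_power_pos simp del: power_Suc)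
  have 2: "real (Suc N) * real (Suc n) * p' = real N * real (Suc N + n) * p"
    unfolding p_def p'_def by (rule fps_A_power_rec[OF assms])
  have 3: "e' = e + real n * p / real (Suc N)"
    using 1 unfolding p_def e_def e'_def by (simp add: field_simps del: of_nat_Suc power_Suc)
  have 4: "p' = real N * real (Suc N + n) * p / (real (Suc N) * real (Suc n))"
    using 2 by (simp add: field_simps del: of_nat_Suc of_nat_add)
  have "mean_disp N (Suc n) = real N * e' / (2 * p')"
    by (simp add: mean_disp_eq[OF assms] e'_def p'_def)
  also have "\<dots> = real (Suc n) / real (N + Suc n) * (real (Suc N) * e / (2 * p) + real n / 2)"
    unfolding 3 4 using p assms
    by (simp add: divide_simps del: of_nat_Suc of_nat_add)
  also have "real (Suc N) * e / (2 * p) = mean_disp (Suc N) n"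
    by (simp add: mean_disp_eq e_def p_def)
  finally show ?thesis .
qed

lemma mean_disp_upper:
  assumes "0 < N"
  shows "mean_disp N n \<le> real n * (real n - 1) / (2 * (real N + 1))"
  using assms
proof (induction n arbitrary: N)
  case (Suc n)
  have "mean_disp N (Suc n) \<le> real (Suc n) / real (N + Suc n) *
      (real n * (real n - 1) / (2 * (real (Suc N) + 1)) + real n / 2)"
    unfolding mean_disp_Suc[OF Suc.prems]
    by (intro mult_left_mono add_right_mono Suc.IH) auto
  also have "\<dots> = real (Suc n) * real n / (2 * (real N + 2))"
    by (simp add: divide_simps) (simp add: algebra_simps)
  also have "\<dots> \<le> real (Suc n) * real n / (2 * (real N + 1))"
    by (intro divide_left_mono) auto
  finally show ?case by simp
qed simp

text \<open>With \<open>mean_disp_upper\<close> this gives the mean as n^2 / (2 N) up to an error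
  that stays bounded while \<open>N0\<close> is a fixed proportion of m. Since N grows as n
  decreases, the induction carries a common lower bound \<open>N0\<close>.\<close>

lemma mean_disp_lower:
  assumes "0 < N0" "N0 \<le> N" "N + n = m"
  shows "(real n)\<^sup>2 / (2 * real N) - real m ^ 3 / (2 * real N0 ^ 3) \<le> mean_disp N n"
  using assms(2,3)
proof (induction n arbitrary: N)
  case (Suc n)
  have N: "0 < N" using Suc.prems assms by simp
  \<comment> \<open>One step of the recursion multiplies the error by (n + 1) / m = 1 - N / m.
    \<open>K\<close> is chosen such that K N0 / m equals m^2 / (2 N0^2), which bounds the error
    newly made in the step.\<close>
  define K where "K = real m ^ 3 / (2 * real N0 ^ 3)"
  have K0: "0 \<le> K" by (simp add: K_def)
  have m: "real m = real N + real n + 1" using Suc.prems by auto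
  have m0: "0 < real m" unfolding m by simp
  have "(real n)\<^sup>2 / (2 * real (Suc N)) - K \<le> mean_disp (Suc N) n"
    unfolding K_def by (rule Suc.IH) (use Suc.prems in auto)
  then have "real (Suc n) / real m * ((real n)\<^sup>2 / (2 * real (Suc N)) - K + real n / 2) \<le>
      mean_disp N (Suc n)"
    unfolding mean_disp_Suc[OF N] Suc.prems(2) by (intro mult_left_mono add_right_mono) auto
  also have "real (Suc n) / real m * ((real n)\<^sup>2 / (2 * real (Suc N)) - K + real n / 2)
     = real (Suc n) * real n / (2 * real (Suc N)) - K + K * real N / real m"
    using m0 by (simp add: divide_simps) (simp add: m algebra_simps power2_eq_square)
  finally have 1: "real (Suc n) * real n / (2 * real (Suc N)) - K + K * real N / real m
      \<le> mean_disp N (Suc n)" .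
  have "(real (Suc n))\<^sup>2 / (2 * real N) - real (Suc n) * real n / (2 * real (Suc N))
     = real (Suc n) * real m / (2 * (real N * real (Suc N)))"
    using N by (simp add: divide_simps) (simp add: m algebra_simps power2_eq_square)
  also have "\<dots> \<le> real m * real m / (2 * (real N0 * real N0))"
    using Suc.prems assms by (intro frac_le mult_mono mult_pos_pos) auto
  also have "\<dots> = K * real N0 / real m"
    using m0 assms unfolding K_def by (simp add: field_simps power3_eq_cube)
  also have "\<dots> \<le> K * real N / real m"
    using K0 Suc.prems by (intro divide_right_mono mult_left_mono) auto
  finally show ?case using 1 by (simp add: K_def)
qed simp

subsection \<open>Final occupied sets\<close>

fun run :: "nat set \<Rightarrow> nat \<Rightarrow> nat" where
  "run A 0 = 0"
| "run A (Suc p) = (if p \<in> A then Suc (run A p) else 0)"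

lemma run_subset: "{p - run A p..<p} \<subseteq> A"
proof (induction p)
  case (Suc p)
  then show ?case by (auto simp: less_Suc_eq)
qed simp

lemma run_less: "0 \<notin> A \<Longrightarrow> 0 < p \<Longrightarrow> run A p < p"
proof (induction p)
  case (Suc p)
  then show ?case by (cases "p = 0") auto
qed simp

lemma run_stop: "run A p < p \<Longrightarrow> p - run A p - 1 \<notin> A"
  by (induction p) (auto split: if_splits)

lemma run_unique:
  assumes "{s..<p} \<subseteq> A" "s \<le> p" "0 < s" "s - 1 \<notin> A"
  shows "run A p = p - s"
  using assms(2,1)
proof (induction p rule: dec_induct)
  case base
  then show ?case using assms(3,4) by (cases s) auto
next
  case (step p)
  then have "{s..<p} \<subseteq> A" "p \<in> A" by auto
  with step show ?case by auto
qed

text \<open>Each block is attributed to the empty space that ends it; the space \<open>0\<close> counts as empty.\<close>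

definition set_weight :: "real \<Rightarrow> nat set \<Rightarrow> nat \<Rightarrow> real" where
  "set_weight q A M = (\<Prod>p\<in>{1..M} - A. poly (block_poly (run A p)) q)"

lemma run_cong: "A \<inter> {..<p} = B \<inter> {..<p} \<Longrightarrow> run A p = run B p"
proof (induction p)
  case (Suc p)
  have "A \<inter> {..<p} = B \<inter> {..<p}" "p \<in> A \<longleftrightarrow> p \<in> B"
    using Suc.prems by (auto simp: set_eq_iff less_Suc_eq)
  then show ?case using Suc.IH by simp
qed simp

lemma set_weight_cong: "A \<inter> {..M} = B \<inter> {..M} \<Longrightarrow> set_weight q A M = set_weight q B M"
  unfolding set_weight_def
proof (rule prod.cong)
  assume "A \<inter> {..M} = B \<inter> {..M}"
  then have *: "x \<in> A \<longleftrightarrow> x \<in> B" if "x \<le> M" for x using that by blast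
  then show "{1..M} - A = {1..M} - B" by auto
  fix p assume "p \<in> {1..M} - B"
  then have "A \<inter> {..<p} = B \<inter> {..<p}"
    using * by auto
  then have "run A p = run B p" by (rule run_cong)
  then show "poly (block_poly (run A p)) q = poly (block_poly (run B p)) q" by simp
qed

lemma set_weight_split:
  assumes "{s..<M} \<subseteq> A" "0 < s" "s \<le> M" "s - 1 \<notin> A" "M \<notin> A"
  shows "set_weight q A M = set_weight q A (s - 1) * poly (block_poly (M - s)) q"
proof -
  have "{1..M} - A = insert M ({1..s - 1} - A)"
  proof (intro set_eqI iffI)
    fix p assume "p \<in> {1..M} - A"
    then show "p \<in> insert M ({1..s - 1} - A)"
      using assms(1) by (cases "p < s"; cases "p = M") (auto simp: subset_iff)
  qed (use assms in auto)
  moreover have "M \<notin> {1..s - 1} - A" using assms by auto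
  moreover have "run A M = M - s" using run_unique assms by blast
  ultimately show ?thesis
    unfolding set_weight_def by (simp add: mult.commute)
qed

lemma block_poly_rec:
  "(\<Sum>i<k. poly (block_poly i) q * poly (block_poly (k - 1 - i)) q * poly (q_int i) q) =
     real k * poly (block_poly k) q"
proof (cases k)
  case (Suc j)
  then show ?thesis
    by (simp add: poly_sum lessThan_Suc_atMost add.commute)
qed simp

text \<open>A Leibniz rule: taking the last car out of space \<open>a\<close> affects only the block
  of \<open>a\<close>, and within a block of k cars the sum over \<open>a\<close> is the recursion
  of \<open>block_poly\<close>, which gives the factor k. Over all blocks these factors add up to
  the number of cars. The induction splits off the block that ends at M.\<close>

lemma sum_remove_one:
  assumes "0 \<notin> A" "0 < M" "M \<notin> A"
  shows "(\<Sum>a\<in>A \<inter> {..<M}. set_weight q (A - {a}) M * poly (q_int (run (A - {a}) a)) q) =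
     real (card (A \<inter> {..<M})) * set_weight q A M"
  using assms
proof (induction M rule: less_induct)
  case (less M)
  define k where "k = run A M"
  define s where "s = M - k"
  have kM: "k < M" unfolding k_def using less.prems by (intro run_less)
  have s: "0 < s" "s \<le> M" "M - s = k" using kM by (auto simp: s_def)
  have sA: "{s..<M} \<subseteq> A" unfolding s_def k_def by (rule run_subset)
  have sn: "s - 1 \<notin> A" unfolding s_def k_def using run_stop[of A M] kM by (simp add: k_def)
  have wA: "set_weight q A M = set_weight q A (s - 1) * poly (block_poly k) q"
    using set_weight_split[OF sA s(1,2) sn less.prems(3)] s(3) by simp
  have split: "A \<inter> {..<M} = (A \<inter> {..<s - 1}) \<union> {s..<M}"
  proof (intro set_eqI iffI)
    fix x assume x: "x \<in> A \<inter> {..<M}"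
    then have "x \<noteq> s - 1" using sn by auto
    then show "x \<in> (A \<inter> {..<s - 1}) \<union> {s..<M}" using x by (cases "x < s") auto
  qed (use sA s in auto)
  have disj: "(A \<inter> {..<s - 1}) \<inter> {s..<M} = {}" by auto
  have lo: "set_weight q (A - {a}) M * poly (q_int (run (A - {a}) a)) q =
      set_weight q (A - {a}) (s - 1) * poly (q_int (run (A - {a}) a)) q * poly (block_poly k) q"
    if a: "a \<in> A \<inter> {..<s - 1}" for a
  proof -
    have "set_weight q (A - {a}) M = set_weight q (A - {a}) (s - 1) * poly (block_poly (M - s)) q"
      by (rule set_weight_split) (use sA s sn less.prems a in auto)
    then show ?thesis using s(3) by simp
  qed
  \<comment> \<open>The removal of \<open>a\<close> splits the last block into runs of lengths a - s
    and k - 1 - (a - s), the two factors of the recursion.\<close>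
  have hi: "set_weight q (A - {a}) M * poly (q_int (run (A - {a}) a)) q =
     set_weight q A (s - 1) * (poly (block_poly (a - s)) q * poly (block_poly (k - 1 - (a - s))) q *
       poly (q_int (a - s)) q)"
    if a: "a \<in> {s..<M}" for a
  proof -
    have "set_weight q (A - {a}) M = set_weight q (A - {a}) (Suc a - 1) * poly (block_poly (M - Suc a)) q"
      by (rule set_weight_split) (use sA s sn less.prems a in auto)
    also have "set_weight q (A - {a}) (Suc a - 1) =
        set_weight q (A - {a}) (s - 1) * poly (block_poly (a - s)) q"
      unfolding diff_Suc_1 by (rule set_weight_split) (use sA s sn less.prems a in auto)
    also have "set_weight q (A - {a}) (s - 1) = set_weight q A (s - 1)"
      by (rule set_weight_cong) (use a s in auto)
    also have "M - Suc a = k - 1 - (a - s)" using a s by auto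
    finally have 1: "set_weight q (A - {a}) M = set_weight q A (s - 1) * poly (block_poly (a - s)) q *
        poly (block_poly (k - 1 - (a - s))) q" .
    have "run (A - {a}) a = a - s"
      by (rule run_unique) (use sA s sn a in auto)
    then show ?thesis unfolding 1 by (simp add: mult_ac)
  qed
  have low: "(\<Sum>a\<in>A \<inter> {..<s - 1}. set_weight q (A - {a}) (s - 1) * poly (q_int (run (A - {a}) a)) q)
     = real (card (A \<inter> {..<s - 1})) * set_weight q A (s - 1)"
  proof (cases "s - 1 = 0")
    case False
    then show ?thesis using less.prems s sn by (intro less.IH) auto
  qed simp
  have "(\<Sum>a\<in>{s..<M}. set_weight q (A - {a}) M * poly (q_int (run (A - {a}) a)) q) =
     set_weight q A (s - 1) * (\<Sum>a\<in>{s..<M}. (poly (block_poly (a - s)) q *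
        poly (block_poly (k - 1 - (a - s))) q * poly (q_int (a - s)) q))"
    unfolding sum_distrib_left by (intro sum.cong refl hi)
  also have "(\<Sum>a\<in>{s..<M}. (poly (block_poly (a - s)) q *
        poly (block_poly (k - 1 - (a - s))) q * poly (q_int (a - s)) q)) =
      (\<Sum>i<k. poly (block_poly i) q * poly (block_poly (k - 1 - i)) q * poly (q_int i) q)"
    by (rule sum.reindex_bij_witness[of _ "\<lambda>i. i + s" "\<lambda>a. a - s"]) (use s in auto)
  finally have high: "(\<Sum>a\<in>{s..<M}. set_weight q (A - {a}) M * poly (q_int (run (A - {a}) a)) q) =
     real k * set_weight q A M"
    unfolding block_poly_rec wA by simp
  have "(\<Sum>a\<in>A \<inter> {..<M}. set_weight q (A - {a}) M * poly (q_int (run (A - {a}) a)) q) =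
     (\<Sum>a\<in>A \<inter> {..<s - 1}. set_weight q (A - {a}) M * poly (q_int (run (A - {a}) a)) q) +
     (\<Sum>a\<in>{s..<M}. set_weight q (A - {a}) M * poly (q_int (run (A - {a}) a)) q)"
    unfolding split by (rule sum.union_disjoint) (use disj in auto)
  also have "(\<Sum>a\<in>A \<inter> {..<s - 1}. set_weight q (A - {a}) M * poly (q_int (run (A - {a}) a)) q) =
      (\<Sum>a\<in>A \<inter> {..<s - 1}. set_weight q (A - {a}) (s - 1) * poly (q_int (run (A - {a}) a)) q) *
      poly (block_poly k) q"
    unfolding sum_distrib_right by (intro sum.cong refl lo)
  also have "\<dots> = real (card (A \<inter> {..<s - 1})) * set_weight q A M"
    unfolding low wA by simp
  finally have "(\<Sum>a\<in>A \<inter> {..<M}. set_weight q (A - {a}) M * poly (q_int (run (A - {a}) a)) q) =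
     real (card (A \<inter> {..<s - 1}) + k) * set_weight q A M"
    unfolding high by (simp add: algebra_simps)
  also have "card (A \<inter> {..<s - 1}) + k = card (A \<inter> {..<M})"
    unfolding split by (subst card_Un_disjoint) (use disj s in auto)
  finally show ?case .
qed

section \<open>The parking process and its final set\<close>

fun occupied_from :: "nat \<Rightarrow> nat set \<Rightarrow> nat list \<Rightarrow> nat set" where
  "occupied_from m A [] = A"
| "occupied_from m A (h # hs) = occupied_from m (insert (parking_space m A h) A) hs"

lemma occupied_from_append:
  "occupied_from m A (hs @ hs') = occupied_from m (occupied_from m A hs) hs'"
  by (induction hs arbitrary: A) auto

lemma total_displacement_from_append:
  "total_displacement_from m A (hs @ hs') =
     total_displacement_from m A hs + total_displacement_from m (occupied_from m A hs) hs'"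
  by (induction hs arbitrary: A) auto

abbreviation occupied :: "nat \<Rightarrow> nat list \<Rightarrow> nat set" where
  "occupied m hs \<equiv> occupied_from m {} hs"

lemma occupied_snoc:
  "occupied m (hs @ [h]) = insert (parking_space m (occupied m hs) h) (occupied m hs)"
  by (simp add: occupied_from_append)

lemma total_displacement_snoc:
  "total_displacement m (hs @ [h]) = total_displacement m hs + displacement m (occupied m hs) h"
  by (simp add: total_displacement_def total_displacement_from_append)

definition hash_lists :: "nat \<Rightarrow> nat \<Rightarrow> nat list set" where
  "hash_lists m n = {hs. set hs \<subseteq> {1..m} \<and> length hs = n}"

lemma finite_hash_lists [simp]: "finite (hash_lists m n)"
  unfolding hash_lists_def by (rule finite_lists_length_eq) simp

lemma hash_lists_0 [simp]: "hash_lists m 0 = {[]}"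
  by (auto simp: hash_lists_def)

lemma hash_lists_Suc:
  "hash_lists m (Suc n) = (\<lambda>(hs, h). hs @ [h]) ` (hash_lists m n \<times> {1..m})"
proof (intro equalityI subsetI)
  fix xs assume "xs \<in> hash_lists m (Suc n)"
  then show "xs \<in> (\<lambda>(hs, h). hs @ [h]) ` (hash_lists m n \<times> {1..m})"
    by (cases xs rule: rev_cases) (auto simp: hash_lists_def image_iff)
qed (auto simp: hash_lists_def)

lemma sum_hash_lists_Suc:
  "(\<Sum>hs\<in>hash_lists m (Suc n). f hs) = (\<Sum>hs\<in>hash_lists m n. \<Sum>h\<in>{1..m}. f (hs @ [h]))"
proof -
  have "inj_on (\<lambda>(hs, h). hs @ [h]) (hash_lists m n \<times> {1..m})"
    by (auto simp: inj_on_def)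
  then show ?thesis
    unfolding hash_lists_Suc by (simp add: sum.reindex sum.cartesian_product case_prod_unfold)
qed

lemma parking_space_range:
  assumes "0 < m"
  shows "parking_space m A h \<in> {1..m}"
  using assms by (auto simp: parking_space_def cyclic_space_def Suc_le_eq)

lemma occupied_subset: "0 < m \<Longrightarrow> occupied m hs \<subseteq> {1..m}"
proof (induction hs rule: rev_induct)
  case (snoc h hs)
  then show ?case using parking_space_range[of m "occupied m hs" h]
    by (simp add: occupied_snoc)
qed simp

text \<open>While space \<open>m\<close> is empty the circle behaves like a line.\<close>

lemma linear_parking:
  assumes "B \<subseteq> {1..<m}" "h \<in> {1..m}"
  shows "parking_space m B h = h + displacement m B h"
    "h + displacement m B h \<le> m" "h + displacement m B h \<notin> B"
    "\<And>j. j < displacement m B h \<Longrightarrow> h + j \<in> B"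
proof -
  have c: "cyclic_space m h j = h + j" if "h + j \<le> m" for j
    using that assms by (auto simp: cyclic_space_def)
  have "cyclic_space m h (m - h) \<notin> B"
    using assms by (subst c) auto
  then have "displacement m B h \<le> m - h" and 1: "cyclic_space m h (displacement m B h) \<notin> B"
    unfolding displacement_def
    using LeastI[of "\<lambda>j. cyclic_space m h j \<notin> B"] by (auto intro: Least_le)
  then show 2: "h + displacement m B h \<le> m" using assms by auto
  from 1 show "h + displacement m B h \<notin> B" by (simp add: c 2)
  show "parking_space m B h = h + displacement m B h"
    by (simp add: parking_space_def c 2)
  show "h + j \<in> B" if "j < displacement m B h" for j
    using not_less_Least[OF that[unfolded displacement_def]] c[of j] 2 that by auto
qed

lemma linear_parking_iff:
  assumes "B \<subseteq> {1..<m}" "h \<in> {1..m}" "a \<notin> B"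
  shows "parking_space m B h = a \<longleftrightarrow> a \<le> m \<and> h \<le> a \<and> {h..<a} \<subseteq> B"
proof
  assume "parking_space m B h = a"
  then show "a \<le> m \<and> h \<le> a \<and> {h..<a} \<subseteq> B"
    using linear_parking[OF assms(1,2)]
    by (auto simp: subset_iff) (metis le_add_diff_inverse add_less_cancel_left)
next
  assume a: "a \<le> m \<and> h \<le> a \<and> {h..<a} \<subseteq> B"
  note l = linear_parking[OF assms(1,2)]
  have "\<not> h + displacement m B h < a"
  proof
    assume "h + displacement m B h < a"
    then have "h + displacement m B h \<in> {h..<a}" by simp
    then show False using a l(3) by blast
  qed
  moreover have "\<not> a - h < displacement m B h" using l(4)[of "a - h"] a assms(3) by auto
  ultimately show "parking_space m B h = a" using l(1) a by auto
qed

text \<open>Exactly the addresses in the run before \<open>a\<close> and \<open>a\<close> itself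
  lead to \<open>a\<close>, with displacements 0, ..., \<open>run B a\<close>. This is the origin of
  \<open>q_int\<close>.\<close>

lemma sum_parking_at:
  assumes "B \<subseteq> {1..<m}" "a \<in> {1..<m}" "a \<notin> B"
  shows "(\<Sum>h | h \<in> {1..m} \<and> parking_space m B h = a. q ^ displacement m B h) =
     poly (q_int (run B a)) q"
proof -
  have 0: "0 \<notin> B" using assms by auto
  have r: "run B a < a" using assms 0 by (intro run_less) auto
  have *: "{h. h \<in> {1..m} \<and> parking_space m B h = a} = {a - run B a..a}"
  proof (intro equalityI subsetI)
    fix h assume "h \<in> {h. h \<in> {1..m} \<and> parking_space m B h = a}"
    then have h: "h \<in> {1..m}" "h \<le> a" "{h..<a} \<subseteq> B"
      using linear_parking_iff[OF assms(1) _ assms(3), of h] by auto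
    have "\<not> h < a - run B a"
    proof
      assume "h < a - run B a"
      then have "a - run B a - 1 \<in> {h..<a}" by auto
      then show False using h(3) run_stop[OF r] by blast
    qed
    then show "h \<in> {a - run B a..a}" using h by auto
  next
    fix h assume h: "h \<in> {a - run B a..a}"
    then have h1: "h \<in> {1..m}" using r assms by auto
    have "{h..<a} \<subseteq> {a - run B a..<a}" using h by auto
    then have "{h..<a} \<subseteq> B" using run_subset[of a B] by blast
    then show "h \<in> {h. h \<in> {1..m} \<and> parking_space m B h = a}"
      using linear_parking_iff[OF assms(1) h1 assms(3)] h h1 assms by auto
  qed
  have "(\<Sum>h\<in>{a - run B a..a}. q ^ displacement m B h) = (\<Sum>h\<in>{a - run B a..a}. q ^ (a - h))"
  proof (rule sum.cong[OF refl])
    fix h assume "h \<in> {a - run B a..a}"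
    then have "h \<in> {1..m}" "parking_space m B h = a" using * by blast+
    then show "q ^ displacement m B h = q ^ (a - h)"
      using linear_parking(1)[OF assms(1), of h] by (metis diff_add_inverse)
  qed
  also have "\<dots> = (\<Sum>l\<le>run B a. q ^ l)"
    by (rule sum.reindex_bij_witness[of _ "\<lambda>l. a - l" "\<lambda>h. a - h"]) (use r in auto)
  finally show ?thesis
    unfolding * by (simp add: q_int_def poly_sum poly_monom)
qed

text \<open>Histories are classified by the space \<open>a\<close> of the last car: before its
  arrival the set was \<open>A - {a}\<close>, and \<open>sum_parking_at\<close> sums over its
  address. The factor Suc n that turns \<open>fact n\<close> into \<open>fact (Suc n)\<close> comes
  from \<open>sum_remove_one\<close>.\<close>

lemma sum_final_set:
  assumes "0 < m" "A \<subseteq> {1..<m}"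
  shows "(\<Sum>hs | hs \<in> hash_lists m n \<and> occupied m hs = A. q ^ total_displacement m hs) =
     (if card A = n then fact n * set_weight q A m else 0)"
  using assms(2)
proof (induction n arbitrary: A)
  case 0
  have fin: "finite A" using 0 by (rule finite_subset) simp
  have r0: "run {} p = 0" for p by (cases p) auto
  have *: "{hs. hs = [] \<and> occupied m hs = A} = (if A = {} then {[]} else {})" by auto
  show ?case
    using fin by (auto simp: * total_displacement_def set_weight_def r0)
next
  case (Suc n)
  have finA: "finite A" using Suc.prems by (rule finite_subset) simp
  let ?S = "\<lambda>a. \<Sum>hs | hs \<in> hash_lists m n \<and> occupied m hs = A - {a}. q ^ total_displacement m hs"
  let ?H = "\<lambda>a. \<Sum>h | h \<in> {1..m} \<and> parking_space m (A - {a}) h = a. q ^ displacement m (A - {a}) h"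
  define X where "X hs h = q ^ total_displacement m hs * q ^ displacement m (occupied m hs) h" for hs h
  have "(\<Sum>hs | hs \<in> hash_lists m (Suc n) \<and> occupied m hs = A. q ^ total_displacement m hs) =
      (\<Sum>hs\<in>hash_lists m (Suc n). if occupied m hs = A then q ^ total_displacement m hs else 0)"
    by (simp add: sum.If_cases Int_def)
  also have "\<dots> = (\<Sum>hs\<in>hash_lists m n. \<Sum>h\<in>{1..m}.
      if insert (parking_space m (occupied m hs) h) (occupied m hs) = A then X hs h else 0)"
    unfolding sum_hash_lists_Suc occupied_snoc total_displacement_snoc X_def power_add ..
  \<comment> \<open>A history that ends in \<open>A\<close> is counted for one \<open>a\<close>
    only, since the last car took a space that was empty before.\<close>
  also have "\<dots> = (\<Sum>hs\<in>hash_lists m n. \<Sum>h\<in>{1..m}. \<Sum>a\<in>A.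
      if occupied m hs = A - {a} \<and> parking_space m (A - {a}) h = a then X hs h else 0)"
  proof (intro sum.cong refl)
    fix hs h assume hs: "hs \<in> hash_lists m n" and h: "h \<in> {1..m}"
    define B where "B = occupied m hs"
    define p where "p = parking_space m B h"
    have Bm: "B \<subseteq> {1..m}" unfolding B_def by (rule occupied_subset[OF assms(1)])
    have "(if insert p B = A then X hs h else 0) =
       (\<Sum>a\<in>A. if B = A - {a} \<and> parking_space m (A - {a}) h = a then X hs h else 0)"
      (is ?step)
    proof (cases "insert p B = A")
      case True
      then have "B \<subseteq> {1..<m}" using Suc.prems by auto
      then have "p \<notin> B" unfolding p_def using linear_parking[OF _ h] by metis
      then have BA: "B = A - {p}" "p \<in> A" using True by auto
      have "(\<Sum>a\<in>A. if B = A - {a} \<and> parking_space m (A - {a}) h = a then X hs h else 0) =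
          (\<Sum>a\<in>A. if a = p then X hs h else 0)"
        by (intro sum.cong refl) (use BA in \<open>auto simp: p_def\<close>)
      then show ?step
        using True BA finA by simp
    next
      case False
      have "\<not> (B = A - {a} \<and> parking_space m (A - {a}) h = a)" if "a \<in> A" for a
        using False that unfolding p_def by auto
      then show ?step
        using False by (subst sum.neutral) auto
    qed
    then show "(if insert (parking_space m (occupied m hs) h) (occupied m hs) = A then X hs h else 0) =
       (\<Sum>a\<in>A. if occupied m hs = A - {a} \<and> parking_space m (A - {a}) h = a then X hs h else 0)"
      unfolding p_def B_def .
  qed
  also have "\<dots> = (\<Sum>a\<in>A. \<Sum>hs\<in>hash_lists m n. \<Sum>h\<in>{1..m}.
      if occupied m hs = A - {a} \<and> parking_space m (A - {a}) h = a then X hs h else 0)"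
    by (subst sum.swap[of _ A], subst sum.swap[of _ _ A]) simp
  also have "\<dots> = (\<Sum>a\<in>A. ?S a *
      ?H a)"
  proof (rule sum.cong[OF refl])
    fix a
    have "(\<Sum>hs\<in>hash_lists m n. \<Sum>h\<in>{1..m}.
        if occupied m hs = A - {a} \<and> parking_space m (A - {a}) h = a then X hs h else 0)
      = (\<Sum>hs\<in>hash_lists m n. \<Sum>h\<in>{1..m}.
          (if occupied m hs = A - {a} then q ^ total_displacement m hs else 0) *
          (if parking_space m (A - {a}) h = a then q ^ displacement m (A - {a}) h else 0))"
      by (intro sum.cong refl) (auto simp: X_def)
    also have "\<dots> = (\<Sum>hs\<in>hash_lists m n. if occupied m hs = A - {a} then q ^ total_displacement m hs else 0) *
         (\<Sum>h\<in>{1..m}. if parking_space m (A - {a}) h = a then q ^ displacement m (A - {a}) h else 0)"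
      by (simp add: sum_product)
    finally show "(\<Sum>hs\<in>hash_lists m n. \<Sum>h\<in>{1..m}.
        if occupied m hs = A - {a} \<and> parking_space m (A - {a}) h = a then X hs h else 0)
       = ?S a *
         ?H a"
      by (simp add: sum.If_cases Int_def)
  qed
  also have "\<dots> = (\<Sum>a\<in>A. (if card A = Suc n then fact n * set_weight q (A - {a}) m else 0) *
      poly (q_int (run (A - {a}) a)) q)"
  proof (rule sum.cong[OF refl])
    fix a assume a: "a \<in> A"
    have "card A \<noteq> 0" using a finA by auto
    then have c: "card (A - {a}) = n \<longleftrightarrow> card A = Suc n"
      using card_Diff_singleton[OF a] by linarith
    have "?S a =
        (if card A = Suc n then fact n * set_weight q (A - {a}) m else 0)"
      by (subst Suc.IH) (use Suc.prems c in auto)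
    moreover have "?H a
        = poly (q_int (run (A - {a}) a)) q"
      by (rule sum_parking_at) (use Suc.prems a in auto)
    ultimately show "?S a *
         ?H a =
        (if card A = Suc n then fact n * set_weight q (A - {a}) m else 0) * poly (q_int (run (A - {a}) a)) q"
      by simp
  qed
  also have "\<dots> = (if card A = Suc n then fact (Suc n) * set_weight q A m else 0)"
  proof (cases "card A = Suc n")
    case True
    have "A \<inter> {..<m} = A" using Suc.prems by auto
    moreover have "(\<Sum>a\<in>A \<inter> {..<m}. set_weight q (A - {a}) m * poly (q_int (run (A - {a}) a)) q) =
       real (card (A \<inter> {..<m})) * set_weight q A m"
      by (rule sum_remove_one) (use Suc.prems assms in auto)
    ultimately have "(\<Sum>a\<in>A. set_weight q (A - {a}) m * poly (q_int (run (A - {a}) a)) q) =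
       real (Suc n) * set_weight q A m" using True by simp
    then show ?thesis using True by (simp add: sum_distrib_left[symmetric] mult.assoc del: of_nat_Suc)
  qed simp
  finally show ?case .
qed

text \<open>Cutting off the block that ends at m leaves a set with one empty space fewer, so the sum
  is a convolution, and m - n blocks give the power m - n.\<close>

lemma sum_set_weight:
  assumes "n < m"
  shows "(\<Sum>A | A \<subseteq> {1..<m} \<and> card A = n. set_weight q A m) =
     (block_gf q ^ (m - n)) $ n"
proof -
  have "(\<Sum>A | A \<subseteq> {1..<n + Suc N} \<and> card A = n. set_weight q A (n + Suc N)) =
     (block_gf q ^ Suc N) $ n" for N n
  proof (induction N arbitrary: n)
    case 0
    have *: "{A. A \<subseteq> {1..<n + Suc 0} \<and> card A = n} = {{1..<Suc n}}"
    proof (intro equalityI subsetI)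
      fix A assume "A \<in> {A. A \<subseteq> {1..<n + Suc 0} \<and> card A = n}"
      then have "A \<subseteq> {1..<Suc n}" "card A = card {1..<Suc n}" by auto
      then have "A = {1..<Suc n}" by (intro card_subset_eq) auto
      then show "A \<in> {{1..<Suc n}}" by simp
    qed auto
    have "set_weight q {1..<Suc n} (Suc n) = set_weight q {1..<Suc n} (1 - 1) * poly (block_poly (Suc n - 1)) q"
      by (rule set_weight_split) auto
    then show ?case unfolding * by (simp add: set_weight_def eval_coeffs_def block_fps_def)
  next
    case (Suc N)
    define m where "m = n + Suc (Suc N)"
    define S where "S = (SIGMA k:{0..n}. {A. A \<subseteq> {1..<n - k + Suc N} \<and> card A = n - k})"
    have fin: "finite {A. A \<subseteq> {1..<j} \<and> card A = i}" for i j :: nat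
      by (rule finite_subset[of _ "Pow {1..<j}"]) auto
    have "(\<Sum>A | A \<subseteq> {1..<m} \<and> card A = n. set_weight q A m) =
       (\<Sum>(k, A)\<in>S. poly (block_poly k) q * set_weight q A (n - k + Suc N))"
    \<comment> \<open>If the last block has k cars, then m - k - 1 is the empty space before it, so
      the remaining set lies strictly below m - k - 1.\<close>
    proof (rule sum.reindex_bij_witness[of _ "\<lambda>(k, A). A \<union> {m - k..<m}" "\<lambda>A. (run A m, A \<inter> {..<m - run A m - 1})"])
      fix A assume "A \<in> {A. A \<subseteq> {1..<m} \<and> card A = n}"
      then have A: "A \<subseteq> {1..<m}" "card A = n" by auto
      define k where "k = run A m"
      have kM: "k < m" unfolding k_def by (rule run_less) (use A in \<open>auto simp: m_def\<close>)
      have sA: "{m - k..<m} \<subseteq> A" unfolding k_def by (rule run_subset)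
      have sn: "m - k - 1 \<notin> A" unfolding k_def using run_stop[of A m] kM by (simp add: k_def)
      have eq: "A = (A \<inter> {..<m - k - 1}) \<union> {m - k..<m}"
      proof (intro equalityI subsetI)
        fix x assume x: "x \<in> A"
        then have "x < m" "x \<noteq> m - k - 1" using A sn by auto
        then show "x \<in> (A \<inter> {..<m - k - 1}) \<union> {m - k..<m}" using x by auto
      qed (use sA in auto)
      have fA: "finite A" using A(1) by (rule finite_subset) simp
      have "card A = card (A \<inter> {..<m - k - 1}) + card {m - k..<m}"
        by (subst eq, rule card_Un_disjoint) (use fA in auto)
      then have c: "n = card (A \<inter> {..<m - k - 1}) + k" using A kM by simp
      then have kn: "k \<le> n" "n - k + Suc N = m - k - 1" by (auto simp: m_def)
      show "(case (run A m, A \<inter> {..<m - run A m - 1}) of (k, A) \<Rightarrow> A \<union> {m - k..<m}) = A"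
        using eq by (simp add: k_def)
      show "(run A m, A \<inter> {..<m - run A m - 1}) \<in> S"
        unfolding k_def[symmetric] S_def using kn c A by auto
      have "set_weight q A m = set_weight q A (m - k - 1) * poly (block_poly (m - (m - k))) q"
        by (rule set_weight_split) (use sA sn kM A in auto)
      also have "set_weight q A (m - k - 1) = set_weight q (A \<inter> {..<m - k - 1}) (m - k - 1)"
        by (rule set_weight_cong) (use sn in \<open>auto simp: set_eq_iff le_less\<close>)
      finally show "(case (run A m, A \<inter> {..<m - run A m - 1}) of
           (k, A) \<Rightarrow> poly (block_poly k) q * set_weight q A (n - k + Suc N)) = set_weight q A m"
        unfolding k_def[symmetric] using kM kn by simp
    next
      fix b assume "b \<in> S"
      then obtain k A where b: "b = (k, A)" "k \<le> n" "A \<subseteq> {1..<n - k + Suc N}" "card A = n - k"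
        by (auto simp: S_def)
      have e: "n - k + Suc N = m - k - 1" using b by (auto simp: m_def)
      have km: "k + 1 < m" using b by (auto simp: m_def)
      have A: "A \<subseteq> {1..<m - k - 1}" using b e by simp
      have Am: "1 \<le> x \<and> x < m - k - 1" if "x \<in> A" for x
        using subsetD[OF A that] by simp
      have fA: "finite A" using A by (rule finite_subset) simp
      have r: "run (A \<union> {m - k..<m}) m = k"
      proof -
        have "run (A \<union> {m - k..<m}) m = m - (m - k)"
          by (rule run_unique) (use A km in auto)
        then show ?thesis using km by simp
      qed
      have i: "(A \<union> {m - k..<m}) \<inter> {..<m - k - 1} = A" using A by auto
      show "(run (case b of (k, A) \<Rightarrow> A \<union> {m - k..<m}) m,
          (case b of (k, A) \<Rightarrow> A \<union> {m - k..<m}) \<inter> {..<m - run (case b of (k, A) \<Rightarrow> A \<union> {m - k..<m}) m - 1}) = b"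
        using r i by (simp add: b)
      have "card (A \<union> {m - k..<m}) = card A + card {m - k..<m}"
        by (rule card_Un_disjoint) (use fA in \<open>auto dest!: Am\<close>)
      then have "card (A \<union> {m - k..<m}) = n" using b km by simp
      then show "(case b of (k, A) \<Rightarrow> A \<union> {m - k..<m}) \<in> {A. A \<subseteq> {1..<m} \<and> card A = n}"
        using Am km by (auto simp: b dest: Am)
    qed
    also have "\<dots> = (\<Sum>k=0..n. \<Sum>A | A \<subseteq> {1..<n - k + Suc N} \<and> card A = n - k.
        poly (block_poly k) q * set_weight q A (n - k + Suc N))"
      unfolding S_def by (rule sum.Sigma[symmetric]) (use fin in auto)
    also have "\<dots> = (\<Sum>k=0..n. poly (block_poly k) q * (block_gf q ^ Suc N) $ (n - k))"
      by (simp only: sum_distrib_left[symmetric] Suc.IH)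
    also have "\<dots> = (block_gf q ^ Suc (Suc N)) $ n"
      by (subst power_Suc[of _ "Suc N"], subst fps_mult_nth)
        (simp only: eval_coeffs_def block_fps_def fps_nth_Abs_fps)
    finally show ?case unfolding m_def .
  qed
  from this[of n "m - n - 1"] show ?thesis using assms by (simp add: Suc_diff_Suc)
qed

lemma sum_last_empty:
  assumes "n < m"
  shows "(\<Sum>hs | hs \<in> hash_lists m n \<and> m \<notin> occupied m hs. q ^ total_displacement m hs) =
     fact n * (block_gf q ^ (m - n)) $ n"
proof -
  define H where "H = {hs. hs \<in> hash_lists m n \<and> m \<notin> occupied m hs}"
  have m: "0 < m" using assms by simp
  have sub: "occupied m hs \<in> Pow {1..<m}" if "hs \<in> H" for hs
    using occupied_subset[OF m, of hs] that unfolding H_def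
    by (auto simp: subset_iff) (metis le_neq_implies_less)
  have "(\<Sum>hs\<in>H. q ^ total_displacement m hs) =
      (\<Sum>A\<in>Pow {1..<m}. \<Sum>hs | hs \<in> H \<and> occupied m hs = A. q ^ total_displacement m hs)"
    by (rule sum.group[symmetric]) (use sub in \<open>auto simp: H_def\<close>)
  also have "\<dots> = (\<Sum>A\<in>Pow {1..<m}. if card A = n then fact n * set_weight q A m else 0)"
  proof (rule sum.cong[OF refl])
    fix A assume A: "A \<in> Pow {1..<m}"
    then have "{hs. hs \<in> H \<and> occupied m hs = A} = {hs. hs \<in> hash_lists m n \<and> occupied m hs = A}"
      by (auto simp: H_def)
    then show "(\<Sum>hs | hs \<in> H \<and> occupied m hs = A. q ^ total_displacement m hs) =
        (if card A = n then fact n * set_weight q A m else 0)"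
      using sum_final_set[OF m, of A q n] A by simp
  qed
  also have "\<dots> = (\<Sum>A | A \<subseteq> {1..<m} \<and> card A = n. fact n * set_weight q A m)"
    by (simp add: sum.If_cases Int_def Pow_def)
  finally show ?thesis
    unfolding H_def by (simp only: sum_distrib_left[symmetric] sum_set_weight[OF assms])
qed

subsection \<open>Rotation and the law of the total displacement\<close>

definition next_space :: "nat \<Rightarrow> nat \<Rightarrow> nat" where
  "next_space m h = h mod m + 1"

lemma cyclic_space_range: "0 < m \<Longrightarrow> cyclic_space m h j \<in> {1..m}"
  by (auto simp: cyclic_space_def Suc_le_eq)

lemma cyclic_space_rotate:
  assumes "1 \<le> h"
  shows "cyclic_space m (next_space m h) j = next_space m (cyclic_space m h j)"
proof -
  have "(h mod m + j) mod m = Suc ((h - 1 + j) mod m) mod m"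
    using assms by (simp add: mod_simps)
  then show ?thesis by (simp add: cyclic_space_def next_space_def)
qed

lemma inj_on_next_space: "inj_on (next_space m) {1..m}"
proof (rule inj_onI)
  fix x y assume *: "x \<in> {1..m}" "y \<in> {1..m}" "next_space m x = next_space m y"
  then show "x = y"
    by (cases "x = m"; cases "y = m") (auto simp: next_space_def)
qed

lemma next_space_range: "0 < m \<Longrightarrow> next_space m h \<in> {1..m}"
  by (auto simp: next_space_def Suc_le_eq)

lemma displacement_rotate:
  assumes "0 < m" "A \<subseteq> {1..m}" "1 \<le> h"
  shows "displacement m (next_space m ` A) (next_space m h) = displacement m A h"
  unfolding displacement_def cyclic_space_rotate[OF assms(3)]
  using inj_on_image_mem_iff[OF inj_on_next_space cyclic_space_range[OF assms(1)] assms(2)]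
  by simp

lemma parking_space_rotate:
  assumes "0 < m" "A \<subseteq> {1..m}" "1 \<le> h"
  shows "parking_space m (next_space m ` A) (next_space m h) = next_space m (parking_space m A h)"
  unfolding parking_space_def displacement_rotate[OF assms] cyclic_space_rotate[OF assms(3)] ..

lemma total_displacement_rotate:
  assumes "0 < m" "set hs \<subseteq> {1..m}" "A \<subseteq> {1..m}"
  shows "total_displacement_from m (next_space m ` A) (map (next_space m) hs) =
      total_displacement_from m A hs \<and>
    occupied_from m (next_space m ` A) (map (next_space m) hs) =
      next_space m ` occupied_from m A hs"
  using assms(2,3)
proof (induction hs arbitrary: A)
  case (Cons h hs)
  have "insert (parking_space m A h) A \<subseteq> {1..m}"
    using parking_space_range[OF assms(1), of A h] Cons.prems by simp
  then show ?case
    using Cons.IH[of "insert (parking_space m A h) A"] Cons.prems assms(1)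
    by (simp add: displacement_rotate parking_space_rotate)
qed simp

lemma bij_betw_map_rotate:
  assumes "0 < m"
  shows "bij_betw (map (next_space m)) (hash_lists m n) (hash_lists m n)"
proof -
  have "inj_on (map (next_space m)) (hash_lists m n)"
  proof (rule inj_on_mapI)
    show "inj_on (next_space m) (\<Union> (set ` hash_lists m n))"
      by (rule inj_on_subset[OF inj_on_next_space]) (auto simp: hash_lists_def)
  qed
  moreover have "map (next_space m) ` hash_lists m n \<subseteq> hash_lists m n"
    using next_space_range[OF assms] by (auto simp: hash_lists_def)
  ultimately show ?thesis
    by (simp add: bij_betw_def endo_inj_surj)
qed

text \<open>Rotating all addresses by one space permutes the address lists, keeps the displacement
  and rotates the final set, so no position of an empty space is distinguished. At position m the
  process is linear.\<close>

lemma sum_empty_space: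
  assumes "0 < m" "p \<in> {1..m}"
  shows "(\<Sum>hs | hs \<in> hash_lists m n \<and> p \<notin> occupied m hs. f (total_displacement m hs)) =
     (\<Sum>hs | hs \<in> hash_lists m n \<and> m \<notin> occupied m hs. f (total_displacement m hs) :: real)"
proof -
  define G where "G p = (\<Sum>hs\<in>hash_lists m n. if p \<notin> occupied m hs then f (total_displacement m hs) else 0)" for p
  have rot: "G (next_space m p) = G p" if p: "p \<in> {1..m}" for p
  proof -
    have "G (next_space m p) = (\<Sum>hs\<in>hash_lists m n. 
       if next_space m p \<notin> occupied m (map (next_space m) hs)
       then f (total_displacement m (map (next_space m) hs)) else 0)"
      unfolding G_def by (rule sum.reindex_bij_betw[OF bij_betw_map_rotate[OF assms(1)], symmetric])
    also have "\<dots> = G p"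
      unfolding G_def
    proof (intro sum.cong refl)
      fix hs assume "hs \<in> hash_lists m n"
      then have hs: "set hs \<subseteq> {1..m}" by (simp add: hash_lists_def)
      have "total_displacement m (map (next_space m) hs) = total_displacement m hs"
        unfolding total_displacement_def using total_displacement_rotate[OF assms(1) hs, of "{}"] by simp
      moreover have "next_space m p \<notin> occupied m (map (next_space m) hs) \<longleftrightarrow> p \<notin> occupied m hs"
        using total_displacement_rotate[OF assms(1) hs, of "{}"]
          inj_on_image_mem_iff[OF inj_on_next_space p occupied_subset[OF assms(1)]] by simp
      ultimately show "(if next_space m p \<notin> occupied m (map (next_space m) hs)
          then f (total_displacement m (map (next_space m) hs)) else 0) =
          (if p \<notin> occupied m hs then f (total_displacement m hs) else 0)" by simp
    qed
    finally show ?thesis .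
  qed
  have "1 \<le> p \<and> p \<le> m \<longrightarrow> G p = G m" for p
  proof (induction p)
    case (Suc p)
    show ?case
    proof (cases "p = 0")
      case True
      then show ?thesis using rot[of m] assms by (auto simp: next_space_def)
    next
      case False
      then show ?thesis using Suc rot[of p] by (auto simp: next_space_def)
    qed
  qed simp
  then have "G p = G m" using assms by (metis atLeastAtMost_iff)
  then show ?thesis by (simp add: G_def sum.If_cases Int_def)
qed

lemma displacement_free:
  assumes "h \<in> {1..m}" "x \<in> {1..m}" "x \<notin> A"
  shows "parking_space m A h \<notin> A"
proof -
  \<comment> \<open>From \<open>h\<close> the space \<open>x\<close> is reached after x - h steps
    modulo m; adding m keeps the subtraction from truncating.\<close>
  have "(h - 1 + (x + m - h)) mod m = (x - 1 + m) mod m"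
    using assms by (intro arg_cong2[of _ _ _ _ "(mod)"]) auto
  also have "\<dots> = x - 1"
  proof -
    have "x - 1 < m" using assms by auto
    then show ?thesis unfolding mod_add_self2 by (rule mod_less)
  qed
  finally have "cyclic_space m h (x + m - h) = x"
    using assms by (simp add: cyclic_space_def)
  then have "cyclic_space m h (x + m - h) \<notin> A" using assms by simp
  then show ?thesis unfolding parking_space_def displacement_def by (rule LeastI)
qed

lemma card_occupied:
  assumes "hs \<in> hash_lists m n" "n \<le> m"
  shows "card (occupied m hs) = n"
  using assms
proof (induction hs arbitrary: n rule: rev_induct)
  case Nil
  then show ?case by (simp add: hash_lists_def)
next
  case (snoc h hs)
  then obtain n' where n: "n = Suc n'" "hs \<in> hash_lists m n'" "h \<in> {1..m}" "n' < m"
    by (cases n) (auto simp: hash_lists_def)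
  have c: "card (occupied m hs) = n'" using snoc.IH[OF n(2)] n(4) by simp
  have sub: "occupied m hs \<subseteq> {1..m}" using occupied_subset[of m hs] n by auto
  have "occupied m hs \<noteq> {1..m}" using c n by auto
  then obtain x where "x \<in> {1..m}" "x \<notin> occupied m hs" using sub by blast
  then have "parking_space m (occupied m hs) h \<notin> occupied m hs"
    using displacement_free n by blast
  moreover have "finite (occupied m hs)" using sub by (rule finite_subset) simp
  ultimately show ?case by (simp add: occupied_snoc c n)
qed

text \<open>Pairs of an address list and an empty space are counted twice: each list leaves m - n
  spaces empty, and each of the m spaces contributes as much as space m.\<close>

lemma sum_hash_lists:
  assumes "n < m"
  shows "real (m - n) * (\<Sum>hs\<in>hash_lists m n. q ^ total_displacement m hs) =
     real m * fact n * (block_gf q ^ (m - n)) $ n"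
proof -
  have m: "0 < m" using assms by simp
  have "real (m - n) * (\<Sum>hs\<in>hash_lists m n. q ^ total_displacement m hs) =
     (\<Sum>hs\<in>hash_lists m n. real (card ({1..m} - occupied m hs)) * q ^ total_displacement m hs)"
    unfolding sum_distrib_left
  proof (rule sum.cong[OF refl])
    fix hs assume hs: "hs \<in> hash_lists m n"
    have sub: "occupied m hs \<subseteq> {1..m}" by (rule occupied_subset[OF m])
    then have "card ({1..m} - occupied m hs) = m - n"
      using card_occupied[OF hs] assms by (simp add: card_Diff_subset finite_subset)
    then show "real (m - n) * q ^ total_displacement m hs =
        real (card ({1..m} - occupied m hs)) * q ^ total_displacement m hs" by simp
  qed
  also have "\<dots> = (\<Sum>hs\<in>hash_lists m n. \<Sum>p\<in>{1..m}. if p \<notin> occupied m hs then q ^ total_displacement m hs else 0)"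
    by (simp add: sum.If_cases Diff_eq Collect_neg_eq)
  also have "\<dots> = (\<Sum>p\<in>{1..m}. \<Sum>hs | hs \<in> hash_lists m n \<and> p \<notin> occupied m hs. q ^ total_displacement m hs)"
    by (subst sum.swap) (simp add: sum.If_cases Int_def)
  also have "\<dots> = (\<Sum>p\<in>{1..m}. fact n * (block_gf q ^ (m - n)) $ n)"
    by (intro sum.cong refl) (simp add: sum_empty_space[OF m] sum_last_empty[OF assms])
  finally show ?thesis by simp
qed

section \<open>The uniform law on address lists and the first moment\<close>

lemma card_hash_lists: "card (hash_lists m n) = m ^ n"
  using card_lists_length_eq[of "{1..m}" n] by (simp add: hash_lists_def)

lemma hash_lists_nonempty: "0 < m \<Longrightarrow> hash_lists m n \<noteq> {}"
  using card_hash_lists[of m n] by (metis card.empty gr_implies_not0 zero_less_power)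

lemma pair_pmf_of_set:
  assumes "finite A" "A \<noteq> {}" "finite B" "B \<noteq> {}"
  shows "pair_pmf (pmf_of_set A) (pmf_of_set B) = pmf_of_set (A \<times> B)"
proof (rule pmf_eqI)
  fix x
  show "pmf (pair_pmf (pmf_of_set A) (pmf_of_set B)) x = pmf (pmf_of_set (A \<times> B)) x"
    using assms by (cases x) (simp add: pmf_pair card_cartesian_product indicator_def)
qed

lemma addresses_eq:
  assumes "0 < m"
  shows "addresses m n = pmf_of_set (hash_lists m n)"
proof (induction n)
  case 0
  then show ?case by (simp add: addresses_def pmf_of_set_singleton)
next
  case (Suc n)
  have "addresses m (Suc n) = map_pmf (\<lambda>(x, xs). x # xs) (pair_pmf (pmf_of_set {1..m}) (addresses m n))"
    by (simp add: addresses_def pair_pmf_def map_bind_pmf)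
  also have "\<dots> = map_pmf (\<lambda>(x, xs). x # xs) (pmf_of_set ({1..m} \<times> hash_lists m n))"
    unfolding Suc using assms hash_lists_nonempty[OF assms] by (subst pair_pmf_of_set) auto
  also have "\<dots> = pmf_of_set ((\<lambda>(x, xs). x # xs) ` ({1..m} \<times> hash_lists m n))"
    using assms hash_lists_nonempty[OF assms] by (intro map_pmf_of_set_inj) (auto simp: inj_on_def)
  also have "(\<lambda>(x, xs). x # xs) ` ({1..m} \<times> hash_lists m n) = hash_lists m (Suc n)"
  proof (intro equalityI subsetI)
    fix xs assume "xs \<in> hash_lists m (Suc n)"
    then show "xs \<in> (\<lambda>(x, xs). x # xs) ` ({1..m} \<times> hash_lists m n)"
      by (cases xs) (auto simp: hash_lists_def image_iff)
  qed (auto simp: hash_lists_def)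
  finally show ?case .
qed

lemma expectation_addresses:
  fixes f :: "nat list \<Rightarrow> real"
  assumes "0 < m"
  shows "measure_pmf.expectation (addresses m n) f = (\<Sum>hs\<in>hash_lists m n. f hs) / real m ^ n"
  unfolding addresses_eq[OF assms]
  by (subst integral_pmf_of_set) (auto simp: hash_lists_nonempty[OF assms] card_hash_lists)

lemma power_eq_fps_A:
  assumes "n < m"
  shows "real (m - n) * real m ^ n = real m * fact n * (fps_A ^ (m - n)) $ n"
  using fps_A_power_nth[of "m - n" n] assms by (simp add: field_simps)

lemma expectation_power:
  assumes "n < m"
  shows "measure_pmf.expectation (addresses m n) (\<lambda>hs. q ^ total_displacement m hs) =
     (block_gf q ^ (m - n)) $ n / (fps_A ^ (m - n)) $ n"
proof -
  have m: "0 < m" "0 < m - n" using assms by auto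
  define s where "s = (\<Sum>hs\<in>hash_lists m n. q ^ total_displacement m hs)"
  define p where "p = (fps_A ^ (m - n)) $ n"
  define z where "z = (block_gf q ^ (m - n)) $ n"
  have p: "0 < p" unfolding p_def by (rule fps_A_power_pos) (use m in auto)
  have 1: "real (m - n) * s = real m * fact n * z"
    unfolding s_def z_def by (rule sum_hash_lists[OF assms])
  have 2: "real (m - n) * real m ^ n = real m * fact n * p"
    unfolding p_def by (rule power_eq_fps_A[OF assms])
  have "real (m - n) * (s * p) = real m * fact n * z * p" using 1 by simp
  also have "\<dots> = real (m - n) * (z * real m ^ n)" using 2 by (simp add: mult_ac)
  finally have "s * p = z * real m ^ n" using m by simp
  then have "s / real m ^ n = z / p"
    using p m by (simp add: frac_eq_eq)
  then show ?thesis
    unfolding expectation_addresses[OF m(1)] s_def p_def z_def .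
qed

text \<open>Both sides of \<open>expectation_power\<close> are polynomials in q. Their derivatives
  at q = 1 are the expectation and a coefficient of the derivative of a power of
  \<open>block_fps\<close>.\<close>

lemma expected_displacement_eq:
  assumes "n < m"
  shows "expected_displacement m n = mean_disp (m - n) n"
proof -
  have m: "0 < m" "0 < m - n" using assms by auto
  define p where "p = (fps_A ^ (m - n)) $ n"
  have p: "0 < p" unfolding p_def by (rule fps_A_power_pos) (use m in auto)
  define R where "R = (block_fps ^ (m - n)) $ n"
  have e: "(\<Sum>hs\<in>hash_lists m n. q ^ total_displacement m hs) / real m ^ n = poly R q / p" for q
  proof -
    have "(block_gf q ^ (m - n)) $ n = poly R q"
      unfolding eval_coeffs_power[symmetric] by (simp add: eval_coeffs_def R_def)
    then show ?thesis
      using expectation_power[OF assms, of q] unfolding expectation_addresses[OF m(1)] p_def by simp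
  qed
  have "((\<lambda>q. (\<Sum>hs\<in>hash_lists m n. q ^ total_displacement m hs) / real m ^ n) has_real_derivative
      (\<Sum>hs\<in>hash_lists m n. real (total_displacement m hs)) / real m ^ n) (at 1)"
    using m by (auto intro!: derivative_eq_intros)
  moreover have "((\<lambda>q. poly R q / p) has_real_derivative poly (pderiv R) 1 / p) (at 1)"
    using p by (auto intro!: derivative_eq_intros poly_DERIV)
  ultimately have "(\<Sum>hs\<in>hash_lists m n. real (total_displacement m hs)) / real m ^ n =
      poly (pderiv R) 1 / p"
    unfolding e by (rule DERIV_unique)
  moreover have "poly (pderiv R) 1 = (of_nat (m - n) * fps_A ^ (m - n - 1) * fps_B) $ n"
    unfolding fps_A_def fps_B_def fps_pderiv_power_eval[symmetric]
    by (simp add: R_def eval_coeffs_def fps_pderiv_def)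
  ultimately show ?thesis
    unfolding expected_displacement_def expectation_addresses[OF m(1)] mean_disp_def p_def by simp
qed

text \<open>Jensen's inequality for the exponential function. It bounds coefficients of
  \<open>block_gf\<close> from below by those of \<open>fps_A\<close>, which are explicit.\<close>

lemma jensen_power:
  assumes "n < m"
  shows "exp (- t * mean_disp (m - n) n) * (fps_A ^ (m - n)) $ n \<le>
     (block_gf (exp (- t)) ^ (m - n)) $ n"
proof -
  have m: "0 < m" using assms by auto
  define D where "D = mean_disp (m - n) n"
  define X where "X hs = real (total_displacement m hs)" for hs
  have D: "(\<Sum>hs\<in>hash_lists m n. X hs) / real m ^ n = D"
    unfolding D_def expected_displacement_eq[OF assms, symmetric] expected_displacement_def
      expectation_addresses[OF m] X_def ..
  \<comment> \<open>The tangent of x -> exp (- t x) at the mean D has expectation exp (- t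
    D).\<close>
  have "exp (- t * D) = exp (- t * D) * (1 + t * D) - t * exp (- t * D) * ((\<Sum>hs\<in>hash_lists m n. X hs) / real m ^ n)"
    unfolding D by (simp add: algebra_simps)
  also have "\<dots> = (\<Sum>hs\<in>hash_lists m n. exp (- t * D) * (1 + t * D) - t * exp (- t * D) * X hs) / real m ^ n"
    using m by (simp add: sum_subtractf sum_distrib_left card_hash_lists diff_divide_distrib)
  also have "\<dots> \<le> (\<Sum>hs\<in>hash_lists m n. exp (- t) ^ total_displacement m hs) / real m ^ n"
  proof (intro divide_right_mono sum_mono)
    fix hs
    have "exp (- t * D) * (1 + (t * D - t * X hs)) \<le> exp (- t * D) * exp (t * D - t * X hs)"
      by (intro mult_left_mono exp_ge_add_one_self) auto
    also have "\<dots> = exp (- t) ^ total_displacement m hs"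
      by (simp add: X_def exp_of_nat_mult[symmetric] exp_add[symmetric] mult_ac)
    finally show "exp (- t * D) * (1 + t * D) - t * exp (- t * D) * X hs \<le> exp (- t) ^ total_displacement m hs"
      by (simp add: algebra_simps)
  qed simp
  also have "\<dots> = (block_gf (exp (- t)) ^ (m - n)) $ n / (fps_A ^ (m - n)) $ n"
    unfolding expectation_power[OF assms, symmetric] expectation_addresses[OF m] ..
  finally show ?thesis
    using fps_A_power_pos[of "m - n" n] assms unfolding D_def by (simp add: pos_le_divide_eq)
qed

lemma block_fps_power_pos:
  assumes "n < m"
  shows "0 < (block_gf (exp (- t)) ^ (m - n)) $ n"
  using jensen_power[OF assms, of t] fps_A_power_pos[of "m - n" n] assms
  by (smt (verit) exp_gt_zero mult_pos_pos zero_less_diff)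

subsection \<open>Evaluation below the critical point\<close>

text \<open>This is k! \<le> e k (k / e) ^ k, Stirling's formula with k in place of a multiple of
  its root. The lost factor is polynomial and vanishes at speed R.\<close>

lemma ln_fact_le:
  assumes "1 \<le> k"
  shows "ln (fact k) \<le> (real k + 1) * ln (real k) + 1 - real k"
  using assms
proof (induction k rule: dec_induct)
  case (step k)
  have k: "0 < real k" using step by simp
  have "ln (real k / (real k + 1)) \<le> real k / (real k + 1) - 1"
    using k by (intro ln_le_minus_one) auto
  then have "ln (real k) - ln (real k + 1) \<le> - 1 / (real k + 1)"
    using k by (simp add: ln_div field_simps)
  then have "1 \<le> (real k + 1) * (ln (real k + 1) - ln (real k))"
    using k by (simp add: field_simps)
  moreover have "ln (fact (Suc k)) = ln (real k + 1) + ln (fact k :: real)"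
    using k by (simp add: ln_mult add.commute)
  ultimately have "ln (fact (Suc k)) \<le> ln (real k + 1) + ((real k + 1) * ln (real k) + 1 - real k) +
      ((real k + 1) * (ln (real k + 1) - ln (real k)) - 1)"
    using step.IH by simp
  also have "\<dots> = (real (Suc k) + 1) * ln (real (Suc k)) + 1 - real (Suc k)"
    by (simp add: algebra_simps)
  finally show ?case .
qed simp

lemma power_fact_le_exp:
  assumes "0 \<le> (x :: real)"
  shows "x ^ k / fact k \<le> exp x"
proof -
  have s: "(\<lambda>n. x ^ n / fact n) sums exp x"
    using exp_converges[of x] by (simp add: divide_inverse mult.commute)
  have "(\<Sum>n\<in>{k}. x ^ n / fact n) \<le> (\<Sum>n. x ^ n / fact n)"
    by (rule sum_le_suminf) (use s assms in \<open>auto simp: sums_iff\<close>)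
  then show ?thesis using s by (simp add: sums_iff)
qed

section \<open>Second-order expansion of the block polynomials at q = 1\<close>

lemma power_one_minus_bounds:
  fixes v :: real
  assumes "0 \<le> v" "v \<le> 1"
  shows "(1 - v) ^ n \<le> 1 - v * real n + v\<^sup>2 / 2 * (real n * (real n - 1))"
    and "1 - v * real n + v\<^sup>2 / 2 * (real n * (real n - 1)) - v ^ 3 * real n ^ 3 \<le> (1 - v) ^ n"
proof -
  show "(1 - v) ^ n \<le> 1 - v * real n + v\<^sup>2 / 2 * (real n * (real n - 1))"
  proof (induction n)
    case (Suc n)
    have nn: "0 \<le> real n * (real n - 1)" by (cases n) auto
    have "(1 - v) ^ Suc n \<le> (1 - v) * (1 - v * real n + v\<^sup>2 / 2 * (real n * (real n - 1)))"
      using mult_left_mono[OF Suc.IH, of "1 - v"] assms by simp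
    also have "\<dots> = 1 - v * real (Suc n) + v\<^sup>2 / 2 * (real (Suc n) * (real (Suc n) - 1)) -
        v ^ 3 / 2 * (real n * (real n - 1))"
      by (simp add: power2_eq_square power3_eq_cube field_simps)
    also have "\<dots> \<le> 1 - v * real (Suc n) + v\<^sup>2 / 2 * (real (Suc n) * (real (Suc n) - 1))"
      using nn assms by simp
    finally show ?case .
  qed simp
  show "1 - v * real n + v\<^sup>2 / 2 * (real n * (real n - 1)) - v ^ 3 * real n ^ 3 \<le> (1 - v) ^ n"
  proof (induction n)
    case (Suc n)
    have nn: "0 \<le> real n * (real n + 1)" by auto
    have "1 - v * real (Suc n) + v\<^sup>2 / 2 * (real (Suc n) * (real (Suc n) - 1)) - v ^ 3 * real (Suc n) ^ 3
      = (1 - v) * (1 - v * real n + v\<^sup>2 / 2 * (real n * (real n - 1)) - v ^ 3 * real n ^ 3)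
        - v ^ 3 * (1 + 3 * real n + 3 * (real n)\<^sup>2 - (real n * (real n - 1)) / 2) - v ^ 4 * real n ^ 3"
      by (simp add: power2_eq_square power3_eq_cube power4_eq_xxxx field_simps)
    also have "\<dots> \<le> (1 - v) * (1 - v * real n + v\<^sup>2 / 2 * (real n * (real n - 1)) - v ^ 3 * real n ^ 3)"
    proof -
      have "0 \<le> real n * (real n + 1)" "0 \<le> (real n)\<^sup>2" by auto
      then have "0 \<le> 1 + 3 * real n + 3 * (real n)\<^sup>2 - (real n * (real n - 1)) / 2"
        by (simp add: power2_eq_square algebra_simps)
      then have "0 \<le> v ^ 3 * (1 + 3 * real n + 3 * (real n)\<^sup>2 - (real n * (real n - 1)) / 2)"
        using assms by simp
      moreover have "0 \<le> v ^ 4 * real n ^ 3" by simp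
      ultimately show ?thesis by linarith
    qed
    also have "\<dots> \<le> (1 - v) * (1 - v) ^ n"
      using Suc.IH assms by (intro mult_left_mono) auto
    finally show ?case by simp
  qed simp
qed

lemma poly_expansion_at_1:
  fixes p :: "real poly"
  shows "poly p x = (\<Sum>i\<le>degree p. coeff p i * x ^ i)"
    "poly (pderiv p) 1 = (\<Sum>i\<le>degree p. coeff p i * real i)"
    "poly (pderiv (pderiv p)) 1 = (\<Sum>i\<le>degree p. coeff p i * (real i * (real i - 1)))"
proof -
  show "poly p x = (\<Sum>i\<le>degree p. coeff p i * x ^ i)" by (rule poly_altdef)
  have p: "p = (\<Sum>i\<le>degree p. monom (coeff p i) i)" by (rule poly_as_sum_of_monoms[symmetric])
  have "pderiv p = (\<Sum>i\<le>degree p. monom (of_nat i * coeff p i) (i - 1))"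
    by (subst p) (simp add: pderiv_sum pderiv_monom)
  then show "poly (pderiv p) 1 = (\<Sum>i\<le>degree p. coeff p i * real i)"
    by (simp add: poly_sum poly_monom mult.commute)
  have "pderiv (pderiv p) = (\<Sum>i\<le>degree p. monom (of_nat (i - 1) * (of_nat i * coeff p i)) (i - 1 - 1))"
    by (subst p) (simp add: pderiv_sum pderiv_monom)
  then show "poly (pderiv (pderiv p)) 1 = (\<Sum>i\<le>degree p. coeff p i * (real i * (real i - 1)))"
    by (auto simp add: poly_sum poly_monom mult_ac of_nat_diff intro!: sum.cong)
qed

context
  fixes p :: "real poly" and d :: nat
  assumes nonneg: "\<And>i. 0 \<le> coeff p i" and deg: "degree p \<le> d"
begin

lemmas poly_expansion = poly_expansion_at_1(1)[of p] poly_expansion_at_1(2)[of p] poly_expansion_at_1(3)[of p]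

lemma nonneg_poly_pderiv_bounds:
  "0 \<le> poly (pderiv p) 1" "poly (pderiv p) 1 \<le> real d * poly p 1"
  "0 \<le> poly (pderiv (pderiv p)) 1" "poly (pderiv (pderiv p)) 1 \<le> real d ^ 2 * poly p 1"
proof -
  have i: "0 \<le> real i * (real i - 1)" for i :: nat by (cases i) auto
  show "0 \<le> poly (pderiv p) 1" "0 \<le> poly (pderiv (pderiv p)) 1"
    unfolding poly_expansion by (intro sum_nonneg mult_nonneg_nonneg nonneg i; simp)+
  show "poly (pderiv p) 1 \<le> real d * poly p 1"
    unfolding poly_expansion sum_distrib_left
    using deg by (intro sum_mono) (auto simp: mult.commute[of "real d"] intro!: mult_left_mono nonneg)
  have "real i * (real i - 1) \<le> real d ^ 2" if "i \<le> degree p" for i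
  proof -
    have "real i * (real i - 1) \<le> real i ^ 2" by (simp add: power2_eq_square algebra_simps)
    also have "\<dots> \<le> real d ^ 2" using that deg by (intro power_mono) auto
    finally show ?thesis .
  qed
  then show "poly (pderiv (pderiv p)) 1 \<le> real d ^ 2 * poly p 1"
    unfolding poly_expansion sum_distrib_left
    by (intro sum_mono) (auto simp: mult.commute[of "(real d)\<^sup>2"] intro!: mult_left_mono nonneg)
qed

text \<open>The derivatives at 1 are factorial moments, so the bounds for (1 - v) ^ i can be summed
  against the nonnegative coefficients. The degree bounds the cubic remainder relative to
  \<open>poly p 1\<close>.\<close>

lemma nonneg_poly_taylor:
  assumes "0 \<le> v" "v \<le> 1"
  shows "poly p (1 - v) \<le> poly p 1 - v * poly (pderiv p) 1 + v\<^sup>2 / 2 * poly (pderiv (pderiv p)) 1"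
    and "poly p 1 - v * poly (pderiv p) 1 + v\<^sup>2 / 2 * poly (pderiv (pderiv p)) 1 -
      v ^ 3 * (real d ^ 3 * poly p 1) \<le> poly p (1 - v)"
proof -
  have e: "poly p 1 - v * poly (pderiv p) 1 + v\<^sup>2 / 2 * poly (pderiv (pderiv p)) 1 =
     (\<Sum>i\<le>degree p. coeff p i * (1 - v * real i + v\<^sup>2 / 2 * (real i * (real i - 1))))"
    unfolding poly_expansion
    unfolding sum_distrib_left sum_subtractf[symmetric] sum.distrib[symmetric]
    by (intro sum.cong refl) (simp add: field_simps)
  show "poly p (1 - v) \<le> poly p 1 - v * poly (pderiv p) 1 + v\<^sup>2 / 2 * poly (pderiv (pderiv p)) 1"
    unfolding e unfolding poly_expansion
    by (intro sum_mono mult_left_mono nonneg power_one_minus_bounds assms)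
  have e3: "v ^ 3 * (real d ^ 3 * poly p 1) = (\<Sum>i\<le>degree p. coeff p i * (v ^ 3 * real d ^ 3))"
    unfolding poly_expansion sum_distrib_right[symmetric] by simp
  show "poly p 1 - v * poly (pderiv p) 1 + v\<^sup>2 / 2 * poly (pderiv (pderiv p)) 1 -
      v ^ 3 * (real d ^ 3 * poly p 1) \<le> poly p (1 - v)"
    unfolding e e3 sum_subtractf[symmetric] right_diff_distrib[symmetric]
    unfolding poly_expansion
  proof (intro sum_mono mult_left_mono nonneg)
    fix i assume "i \<in> {..degree p}"
    then have "v ^ 3 * real i ^ 3 \<le> v ^ 3 * real d ^ 3"
      using assms deg by (intro mult_left_mono power_mono) auto
    then show "1 - v * real i + v\<^sup>2 / 2 * (real i * (real i - 1)) - v ^ 3 * real d ^ 3 \<le> (1 - v) ^ i"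
      using power_one_minus_bounds(2)[OF assms, of i] by linarith
  qed
qed

end

lemma block_poly_coeff_nonneg: "0 \<le> coeff (block_poly k) i"
proof (induction k arbitrary: i rule: less_induct)
  case (less k)
  show ?case
  proof (cases k)
    case 0
    then show ?thesis by (simp add: coeff_1)
  next
    case (Suc j)
    have q: "0 \<le> coeff (q_int i) l" for i l
      by (auto simp: q_int_def coeff_sum intro!: sum_nonneg)
    have "0 \<le> coeff (block_poly i * block_poly (j - i) * q_int i) l" if "i \<le> j" for i l
      using that Suc by (auto simp: coeff_mult intro!: sum_nonneg mult_nonneg_nonneg less q)
    then show ?thesis unfolding Suc by (auto simp: coeff_sum intro!: divide_nonneg_pos sum_nonneg)
  qed
qed

text \<open>Any polynomial bound is good enough: in the remainder it becomes a power of
  \<open>euler\<close>, which does not lower the radius of convergence.\<close>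

lemma degree_block_poly: "degree (block_poly k) \<le> k\<^sup>2"
proof (induction k rule: less_induct)
  case (less k)
  show ?case
  proof (cases k)
    case (Suc j)
    have q: "degree (q_int i) \<le> i" for i
      unfolding q_int_def by (intro degree_sum_le) (auto intro: order.trans[OF degree_monom_le])
    have "degree (block_poly i * block_poly (j - i) * q_int i) \<le> k\<^sup>2" if le: "i \<le> j" for i
    proof -
      obtain l where j: "j = i + l" using le_Suc_ex[OF le] by auto
      have "degree (block_poly i * block_poly (j - i) * q_int i) \<le>
          degree (block_poly i * block_poly (j - i)) + degree (q_int i)"
        by (rule degree_mult_le)
      also have "\<dots> \<le> degree (block_poly i) + degree (block_poly (j - i)) + degree (q_int i)"
        by (intro add_right_mono degree_mult_le)
      also have "\<dots> \<le> i\<^sup>2 + (j - i)\<^sup>2 + i"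
        by (intro add_mono less q) (use Suc le in auto)
      also have "\<dots> \<le> k\<^sup>2" unfolding Suc j by (simp add: power2_eq_square algebra_simps)
      finally show ?thesis .
    qed
    then show ?thesis unfolding Suc by (auto intro!: degree_sum_le order.trans[OF degree_smult_le])
  qed simp
qed

lemma block_gf_nth: "block_gf q $ k = poly (block_poly k) q"
  by (simp add: eval_coeffs_def block_fps_def)

lemma fps_ABC_nth:
  "fps_A $ k = poly (block_poly k) 1"
  "fps_B $ k = poly (pderiv (block_poly k)) 1"
  "fps_C $ k = poly (pderiv (pderiv (block_poly k))) 1"
  by (simp_all add: fps_A_def fps_B_def fps_C_def eval_coeffs_def fps_pderiv_def block_fps_def)

lemma block_gf_nonneg: "0 \<le> q \<Longrightarrow> 0 \<le> block_gf q $ k"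
  unfolding block_gf_nth poly_altdef
  by (intro sum_nonneg mult_nonneg_nonneg block_poly_coeff_nonneg) auto

lemma block_gf_le: "0 \<le> q \<Longrightarrow> q \<le> 1 \<Longrightarrow> block_gf q $ k \<le> fps_A $ k"
  unfolding block_gf_nth fps_ABC_nth poly_altdef
  by (intro sum_mono mult_left_mono block_poly_coeff_nonneg) (auto intro: power_le_one)

text \<open>The value \<open>exp (-1)\<close> is the common radius of convergence of the block series.\<close>

definition subcritical :: "real fps \<Rightarrow> bool" where
  "subcritical f \<longleftrightarrow> ereal (exp (-1)) \<le> fps_conv_radius f"

lemma subcritical_radius:
  fixes z :: real
  shows "subcritical f \<Longrightarrow> 0 \<le> z \<Longrightarrow> z < exp (-1) \<Longrightarrow> ereal (norm z) < fps_conv_radius f"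
  unfolding subcritical_def by (rule less_le_trans[of _ "ereal (exp (-1))"]) simp_all

lemma subcritical_mono:
  fixes f g :: "real fps"
  assumes "subcritical g" "\<And>k. \<bar>f $ k\<bar> \<le> g $ k"
  shows "subcritical f"
  unfolding subcritical_def fps_conv_radius_def
proof (rule conv_radius_geI_ex')
  fix r :: real assume r: "0 < r" "ereal r < ereal (exp (-1))"
  have "summable (\<lambda>n. g $ n * r ^ n)"
    by (rule summable_fps, rule subcritical_radius) (use r assms in auto)
  then show "summable (\<lambda>n. f $ n * of_real r ^ n)"
    by (rule summable_comparison_test') (use r assms in \<open>auto simp: abs_mult intro!: mult_right_mono\<close>)
qed

lemma subcritical_intros:
  "subcritical f \<Longrightarrow> subcritical g \<Longrightarrow> subcritical (f * g)"
  "subcritical f \<Longrightarrow> subcritical g \<Longrightarrow> subcritical (f + g)"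
  "subcritical f \<Longrightarrow> subcritical g \<Longrightarrow> subcritical (f - g)"
  "subcritical f \<Longrightarrow> subcritical (f ^ n)"
  "subcritical (numeral k)" "subcritical 1" "subcritical fps_X"
  "subcritical f \<Longrightarrow> subcritical (fps_deriv f)"
  "subcritical f \<Longrightarrow> subcritical (euler f)"
proof -
  show m: "subcritical (f * g)" if "subcritical f" "subcritical g" for f g
    using that fps_conv_radius_mult[of f g] unfolding subcritical_def by (meson min.boundedI order.trans)
  show "subcritical (f + g)" if "subcritical f" "subcritical g" for f g
    using that fps_conv_radius_add[of f g] unfolding subcritical_def by (meson min.boundedI order.trans)
  show "subcritical (f - g)" if "subcritical f" "subcritical g" for f g
    using that fps_conv_radius_diff[of f g] unfolding subcritical_def by (meson min.boundedI order.trans)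
  show "subcritical (f ^ n)" if "subcritical f" for f n
    using that fps_conv_radius_power[of f n] unfolding subcritical_def by (meson order.trans)
  show x: "subcritical (numeral k)" "subcritical 1" "subcritical fps_X" for k
    by (simp_all add: subcritical_def)
  show d: "subcritical (fps_deriv f)" if "subcritical f" for f
    using that fps_conv_radius_deriv[of f] unfolding subcritical_def by (meson order.trans)
  show "subcritical (euler f)" if "subcritical f" for f
    unfolding euler_def by (intro m x d that)
qed

lemma fps_A_nth: "real (k + 1) * fps_A $ k = real (k + 1) ^ k / fact k"
  using fps_A_power_nth[of 1 k] by (simp add: add.commute)

text \<open>Each coefficient is at most exp (k + 1), because (k + 1) ^ k / k! is a single term of
  the exponential series at k + 1.\<close>

lemma subcritical_A: "subcritical fps_A"
proof (rule subcritical_mono)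
  show "subcritical (Abs_fps (\<lambda>k. exp 1 * exp 1 ^ k))"
    unfolding subcritical_def fps_conv_radius_def
  proof (rule conv_radius_geI_ex')
    fix r :: real assume r: "0 < r" "ereal r < ereal (exp (-1))"
    then have "exp 1 * r < 1" by (simp add: exp_minus field_simps)
    then have "summable (\<lambda>n. exp 1 * (exp 1 * r) ^ n)"
      using r by (intro summable_mult summable_geometric) auto
    then show "summable (\<lambda>n. Abs_fps (\<lambda>k. exp 1 * exp 1 ^ k :: real) $ n * of_real r ^ n)"
      by (simp only: fps_nth_Abs_fps of_real_eq_id id_apply power_mult_distrib mult.assoc)
  qed
  fix k
  have "fps_A $ k \<le> real (k + 1) * fps_A $ k"
    using block_gf_nonneg[of 1 k] by (simp add: fps_A_def mult_le_cancel_right1)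
  also have "\<dots> = real (k + 1) ^ k / fact k" by (rule fps_A_nth)
  also have "\<dots> \<le> exp (real (k + 1))" by (rule power_fact_le_exp) simp
  also have "\<dots> = exp 1 * exp 1 ^ k" by (simp add: exp_add exp_of_nat_mult[symmetric])
  finally show "\<bar>fps_A $ k\<bar> \<le> Abs_fps (\<lambda>k. exp 1 * exp 1 ^ k) $ k"
    using block_gf_nonneg[of 1 k] by (simp add: fps_A_def)
qed

lemma subcritical_block_gf: "0 \<le> q \<Longrightarrow> q \<le> 1 \<Longrightarrow> subcritical (block_gf q)"
  by (rule subcritical_mono[OF subcritical_A]) (use block_gf_nonneg block_gf_le in auto)

lemma subcritical_B: "subcritical fps_B"
proof (rule subcritical_mono)
  show "subcritical (euler (euler fps_A))" by (intro subcritical_intros subcritical_A)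
  show "\<bar>fps_B $ k\<bar> \<le> euler (euler fps_A) $ k" for k
    using nonneg_poly_pderiv_bounds(1,2)[OF block_poly_coeff_nonneg degree_block_poly, of k]
    by (simp add: fps_ABC_nth euler_nth power2_eq_square mult_ac)
qed

lemma subcritical_C: "subcritical fps_C"
proof (rule subcritical_mono)
  show "subcritical (euler (euler (euler (euler fps_A))))" by (intro subcritical_intros subcritical_A)
  show "\<bar>fps_C $ k\<bar> \<le> euler (euler (euler (euler fps_A))) $ k" for k
    using nonneg_poly_pderiv_bounds(3,4)[OF block_poly_coeff_nonneg degree_block_poly, of k]
    by (simp add: fps_ABC_nth euler_nth power2_eq_square mult_ac)
qed

text \<open>This makes l -> \<open>tilt l\<close> injective on [0, 1], with values below exp (-1)
  for l < 1.\<close>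

lemma x_exp_minus_strict_mono:
  fixes x y :: real
  assumes "0 \<le> x" "x < y" "y \<le> 1"
  shows "x * exp (- x) < y * exp (- y)"
proof -
  define d where "d = y - x"
  have d: "0 < d" "d \<le> 1" using assms by (auto simp: d_def)
  \<comment> \<open>Squaring the bound at half the argument makes the weak inequality 1 - d \<le>
    exp (- d) strict.\<close>
  have "1 - d < (1 - d / 2)\<^sup>2" using d by (simp add: power2_eq_square field_simps)
  also have "\<dots> \<le> exp (- (d / 2)) ^ 2"
    using d exp_ge_add_one_self[of "- (d / 2)"] by (intro power_mono) auto
  also have "\<dots> = exp (- d)" by (simp add: power2_eq_square exp_add[symmetric])
  finally have "y * (1 - d) < y * exp (- d)" using assms by simp
  moreover have "x \<le> y * (1 - d)"
  proof -
    have "y * d \<le> 1 * d" using assms d by (intro mult_right_mono) auto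
    then show ?thesis by (simp add: d_def algebra_simps)
  qed
  ultimately have "x * exp (- x) < y * exp (- d) * exp (- x)" by simp
  also have "\<dots> = y * exp (- y)" by (simp add: d_def exp_add[symmetric])
  finally show ?thesis .
qed

text \<open>By the differential equation a(z) exp (- z a(z)) is constant, so w = z a(z) solves w exp
  (- w) = z = l exp (- l). This gives w = l once w is known not to exceed 1.\<close>

lemma eval_A:
  assumes "0 \<le> l" "l < 1"
  shows "eval_fps fps_A (l * exp (- l)) = exp l"
proof -
  define I where "I = {0..<exp (-1) :: real}"
  define a where "a = eval_fps fps_A"
  have rad: "ereal (norm z) < fps_conv_radius f" if "z \<in> I" "subcritical f" for z f
    using that by (intro subcritical_radius) (auto simp: I_def)
  have conv: "convex I" unfolding I_def by (rule convex_real_interval)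
  have der: "(a has_real_derivative eval_fps (fps_deriv fps_A) z) (at z within I)" if "z \<in> I" for z
    unfolding a_def by (rule has_field_derivative_eval_fps) (use rad that subcritical_A in auto)
  have ode: "eval_fps (fps_deriv fps_A) z = a z * (a z + z * eval_fps (fps_deriv fps_A) z)" if "z \<in> I" for z
  proof -
    have r: "ereal (norm z) < fps_conv_radius f" if "subcritical f" for f
      by (rule rad) (use that \<open>z \<in> I\<close> in auto)
    show ?thesis
      by (subst fps_A_deriv, subst eval_fps_mult[OF r r], (intro subcritical_intros subcritical_A)+,
          subst eval_fps_add[OF r r], (intro subcritical_intros subcritical_A)+,
          unfold euler_def, subst eval_fps_mult[OF r r], (intro subcritical_intros subcritical_A)+)
        (simp add: a_def)
  qed
  have "((\<lambda>z. a z * exp (- (z * a z))) has_real_derivative 0) (at z within I)" if "z \<in> I" for z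
  proof -
    have "((\<lambda>z. a z * exp (- (z * a z))) has_real_derivative
       (eval_fps (fps_deriv fps_A) z - a z * (a z + z * eval_fps (fps_deriv fps_A) z)) * exp (- (z * a z)))
       (at z within I)"
      by (rule derivative_eq_intros der that refl)+ (simp add: algebra_simps)
    then show ?thesis using ode[OF that] by simp
  qed
  then obtain c where c: "\<And>z. z \<in> I \<Longrightarrow> a z * exp (- (z * a z)) = c"
    using has_field_derivative_zero_constant[OF conv, of "\<lambda>z. a z * exp (- (z * a z))"] by auto
  have "a 0 = 1" by (simp add: a_def eval_fps_at_0 fps_A_0)
  then have "c = 1" using c[of 0] by (simp add: I_def)
  then have key: "a z * exp (- (z * a z)) = 1" if "z \<in> I" for z using c that by simp
  define z where "z = l * exp (- l)"
  have z: "z \<in> I" using x_exp_minus_strict_mono[of l 1] assms by (auto simp: I_def z_def)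
  define w where "w = z * a z"
  have pos: "0 < a y" if "y \<in> I" for y
    using key[OF that] by (metis exp_gt_zero zero_less_mult_pos2 zero_less_one)
  have w0: "0 \<le> w" unfolding w_def using pos[OF z] z by (simp add: I_def)
  have weq: "w * exp (- w) = z" unfolding w_def using key[OF z] by (simp add: mult.assoc)
  \<comment> \<open>Otherwise z a(z) takes the value 1 at some y in \<open>I\<close> by continuity,
    and then y = exp (-1), which lies outside \<open>I\<close>.\<close>
  have w1: "w \<le> 1"
  proof (rule ccontr)
    assume "\<not> w \<le> 1"
    have cI: "continuous_on I a" by (rule DERIV_continuous_on) (rule der)
    have "continuous_on {0..z} a"
      by (rule continuous_on_subset[OF cI]) (use z in \<open>auto simp: I_def\<close>)
    then have "continuous_on {0..z} (\<lambda>y. y * a y)"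
      by (intro continuous_on_mult continuous_on_id)
    moreover have "0 \<le> z" "1 \<le> z * a z" using \<open>\<not> w \<le> 1\<close> z by (simp_all add: w_def I_def)
    ultimately obtain y where y: "0 \<le> y" "y \<le> z" "y * a y = 1"
      using IVT'[of "\<lambda>y. y * a y" 0 1 z] by fastforce
    then have "y \<in> I" using z by (auto simp: I_def)
    from key[OF this] y have "a y * exp (-1) = 1" by simp
    then have "y = (y * a y) * exp (-1)" by (simp add: mult.assoc)
    then have "y = exp (-1)" using y by simp
    with \<open>y \<in> I\<close> show False by (simp add: I_def)
  qed
  have "w = l"
    using x_exp_minus_strict_mono[of w l] x_exp_minus_strict_mono[of l w] weq w0 w1 assms
    by (cases w l rule: linorder_cases) (auto simp: z_def)
  then have "a z = exp l" using key[OF z] unfolding w_def[symmetric]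
    by (simp add: exp_minus field_simps)
  then show ?thesis by (simp add: a_def z_def)
qed

definition block_sum :: "real \<Rightarrow> real \<Rightarrow> real" where
  "block_sum q z = eval_fps (block_gf q) z"

text \<open>Mean and second factorial moment of the displacement of a block whose size has the Borel law with
  parameter \<open>l\<close>, that is, at \<open>z = tilt l\<close>.\<close>

definition block_mean :: "real \<Rightarrow> real" where
  "block_mean l = (l / (1 - l))\<^sup>2 / 2"

definition block_moment2 :: "real \<Rightarrow> real" where
  "block_moment2 l = (24 * (l / (1 - l)) ^ 3 + 37 * (l / (1 - l)) ^ 4 + 15 * (l / (1 - l)) ^ 5) / 12"

text \<open>The inverse of the tree function. With z = \<open>tilt l\<close> the block sum at q = 1
  is exp l, and the moments of size and displacement are rational in l.\<close>

definition tilt :: "real \<Rightarrow> real" where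
  "tilt l = l * exp (- l)"

lemma tilt_bounds: "0 \<le> l \<Longrightarrow> l < 1 \<Longrightarrow> 0 \<le> tilt l" "0 \<le> l \<Longrightarrow> l < 1 \<Longrightarrow> tilt l < exp (-1)"
  using x_exp_minus_strict_mono[of l 1] by (auto simp: tilt_def)

lemma tilt_mono: "0 \<le> l \<Longrightarrow> l \<le> l' \<Longrightarrow> l' < 1 \<Longrightarrow> tilt l \<le> tilt l'"
  using x_exp_minus_strict_mono[of l l'] by (cases "l = l'") (auto simp: tilt_def)

text \<open>The closed forms are multiplied by powers of 1 - T before they are evaluated, so that
  only \<open>fps_A\<close>, \<open>fps_B\<close>, \<open>fps_C\<close> and \<open>fps_T\<close>
  have to converge and not the quotient \<open>fps_U\<close>.\<close>

lemma eval_BC: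
  assumes "0 \<le> l" "l < 1"
  shows "eval_fps fps_B (tilt l) = exp l * block_mean l" "eval_fps fps_C (tilt l) = exp l * block_moment2 l"
proof -
  define z where "z = tilt l"
  have rad: "ereal (norm z) < fps_conv_radius f" if "subcritical f" for f
    using that tilt_bounds[OF assms] by (intro subcritical_radius) (auto simp: z_def)
  have ev: "eval_fps (f * g) z = eval_fps f z * eval_fps g z"
    "eval_fps (f + g) z = eval_fps f z + eval_fps g z"
    "eval_fps (f - g) z = eval_fps f z - eval_fps g z" if "subcritical f" "subcritical g" for f g
    using that rad by (simp_all add: eval_fps_mult eval_fps_add eval_fps_diff)
  have ev_pow: "eval_fps (f ^ n) z = eval_fps f z ^ n" if "subcritical f" for f n
    using that rad by (simp add: eval_fps_power)
  have subT: "subcritical fps_T" unfolding fps_T_def by (intro subcritical_intros subcritical_A)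
  note sub = subcritical_intros subcritical_A subcritical_B subcritical_C subT
  have A: "eval_fps fps_A z = exp l" unfolding z_def tilt_def by (rule eval_A[OF assms])
  have T: "eval_fps fps_T z = l"
  proof -
    have "eval_fps fps_T z = z * exp l" unfolding fps_T_def by (simp add: ev sub A)
    then show ?thesis by (simp add: z_def tilt_def exp_minus)
  qed
  have "2 * fps_B * (1 - fps_T)\<^sup>2 = fps_A * fps_T\<^sup>2"
    using fps_B_closed fps_U_eq by algebra
  then have "eval_fps (2 * fps_B * (1 - fps_T)\<^sup>2) z = eval_fps (fps_A * fps_T\<^sup>2) z" by simp
  then have "2 * eval_fps fps_B z * (1 - l)\<^sup>2 = exp l * l\<^sup>2"
    by (simp add: ev ev_pow sub A T)
  then show "eval_fps fps_B (tilt l) = exp l * block_mean l"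
    using assms unfolding block_mean_def z_def by (simp add: field_simps power_divide)
  have "12 * fps_C * (1 - fps_T) ^ 5 = fps_A * (24 * (fps_U * (1 - fps_T)) ^ 3 * (1 - fps_T)\<^sup>2 +
      37 * (fps_U * (1 - fps_T)) ^ 4 * (1 - fps_T) + 15 * (fps_U * (1 - fps_T)) ^ 5)"
    unfolding fps_C_closed by (simp add: eval_nat_numeral algebra_simps)
  then have "12 * fps_C * (1 - fps_T) ^ 5 = fps_A * (24 * fps_T ^ 3 * (1 - fps_T)\<^sup>2 +
      37 * fps_T ^ 4 * (1 - fps_T) + 15 * fps_T ^ 5)"
    unfolding fps_U_eq .
  then have "eval_fps (12 * fps_C * (1 - fps_T) ^ 5) z = eval_fps (fps_A * (24 * fps_T ^ 3 * (1 - fps_T)\<^sup>2 +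
      37 * fps_T ^ 4 * (1 - fps_T) + 15 * fps_T ^ 5)) z" by simp
  then have c: "12 * eval_fps fps_C z * (1 - l) ^ 5 =
      exp l * (24 * l ^ 3 * (1 - l)\<^sup>2 + 37 * l ^ 4 * (1 - l) + 15 * l ^ 5)"
    by (simp add: ev ev_pow sub A T)
  have u: "l / (1 - l) * (1 - l) = l" using assms by simp
  define u where "u = l / (1 - l)"
  have g: "block_moment2 l * 12 = 24 * u ^ 3 + 37 * u ^ 4 + 15 * u ^ 5" by (simp add: block_moment2_def u_def)
  have "block_moment2 l * 12 * w ^ 5 = 24 * (u * w) ^ 3 * w\<^sup>2 + 37 * (u * w) ^ 4 * w + 15 * (u * w) ^ 5" for w
    unfolding g by (simp add: eval_nat_numeral algebra_simps)
  from this[of "1 - l"] have "block_moment2 l * 12 * (1 - l) ^ 5 = 24 * (u * (1 - l)) ^ 3 * (1 - l)\<^sup>2 +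
      37 * (u * (1 - l)) ^ 4 * (1 - l) + 15 * (u * (1 - l)) ^ 5" .
  also have "u * (1 - l) = l" using u by (simp add: u_def)
  finally have "12 * eval_fps fps_C z * (1 - l) ^ 5 = exp l * (block_moment2 l * 12 * (1 - l) ^ 5)"
    using c by simp
  then show "eval_fps fps_C (tilt l) = exp l * block_moment2 l"
    using assms by (simp add: z_def)
qed

text \<open>The remainder is taken at a fixed \<open>l1\<close> above \<open>l\<close>, so that it
  stays a constant times v^3 when \<open>l\<close> varies with m.\<close>

lemma block_sum_bounds:
  assumes "0 \<le> l" "l \<le> l1" "l1 < 1" "0 \<le> v" "v \<le> 1"
  shows "block_sum (1 - v) (tilt l) \<le> exp l * (1 - v * block_mean l + v\<^sup>2 / 2 * block_moment2 l)"
    and "exp l * (1 - v * block_mean l + v\<^sup>2 / 2 * block_moment2 l) - v ^ 3 * eval_fps ((euler ^^ 6) fps_A) (tilt l1)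
      \<le> block_sum (1 - v) (tilt l)"
proof -
  define z where "z = tilt l"
  define z1 where "z1 = tilt l1"
  have z: "0 \<le> z" "z < exp (-1)" "z \<le> z1" "z1 < exp (-1)"
    using tilt_bounds[of l] tilt_bounds[of l1] tilt_mono[of l l1] assms by (auto simp: z_def z1_def)
  \<comment> \<open>A block of k cars has degree at most k^2 in q, so its cubic remainder carries
    the factor k^6.\<close>
  define G where "G = (euler ^^ 6) fps_A"
  have G: "subcritical G" unfolding G_def
    by (simp add: eval_nat_numeral subcritical_intros subcritical_A)
  have Gn: "G $ k = real (k\<^sup>2) ^ 3 * fps_A $ k" for k
    unfolding G_def by (simp add: eval_nat_numeral euler_nth)
  have s: "(\<lambda>k. f $ k * y ^ k) sums eval_fps f y" if "subcritical f" "0 \<le> y" "y < exp (-1)" for f y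
    by (rule sums_eval_fps) (rule subcritical_radius[OF that])
  have AB: "(\<lambda>k. fps_A $ k * z ^ k - v * (fps_B $ k * z ^ k) + v\<^sup>2 / 2 * (fps_C $ k * z ^ k)) sums
      (exp l - v * (exp l * block_mean l) + v\<^sup>2 / 2 * (exp l * block_moment2 l))"
    using s[OF subcritical_A z(1,2)] s[OF subcritical_B z(1,2)] s[OF subcritical_C z(1,2)] assms
    unfolding z_def eval_A[of l, folded tilt_def, OF assms(1) order.strict_trans1[OF assms(2,3)]]
      eval_BC[of l, OF assms(1) order.strict_trans1[OF assms(2,3)]]
    by (intro sums_add sums_diff sums_mult)
  have S: "(\<lambda>k. block_gf (1 - v) $ k * z ^ k) sums block_sum (1 - v) z"
    unfolding block_sum_def by (rule s[OF subcritical_block_gf z(1,2)]) (use assms in auto)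
  have GS: "(\<lambda>k. v ^ 3 * (G $ k * z ^ k)) sums (v ^ 3 * eval_fps G z)"
    by (intro sums_mult s G z)
  have taylor: "block_gf (1 - v) $ k \<le> fps_A $ k - v * fps_B $ k + v\<^sup>2 / 2 * fps_C $ k"
    "fps_A $ k - v * fps_B $ k + v\<^sup>2 / 2 * fps_C $ k - v ^ 3 * G $ k \<le> block_gf (1 - v) $ k" for k
    using nonneg_poly_taylor[OF block_poly_coeff_nonneg degree_block_poly assms(4,5), of k]
    unfolding Gn fps_ABC_nth block_gf_nth .
  have "block_sum (1 - v) z \<le> exp l - v * (exp l * block_mean l) + v\<^sup>2 / 2 * (exp l * block_moment2 l)"
  proof (rule sums_le[OF _ S AB])
    fix k
    have "block_gf (1 - v) $ k * z ^ k \<le> (fps_A $ k - v * fps_B $ k + v\<^sup>2 / 2 * fps_C $ k) * z ^ k"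
      using z by (intro mult_right_mono taylor(1)) auto
    then show "block_gf (1 - v) $ k * z ^ k \<le>
        fps_A $ k * z ^ k - v * (fps_B $ k * z ^ k) + v\<^sup>2 / 2 * (fps_C $ k * z ^ k)"
      by (simp add: algebra_simps)
  qed
  then show "block_sum (1 - v) (tilt l) \<le> exp l * (1 - v * block_mean l + v\<^sup>2 / 2 * block_moment2 l)"
    by (simp add: z_def algebra_simps)
  have "exp l - v * (exp l * block_mean l) + v\<^sup>2 / 2 * (exp l * block_moment2 l) - v ^ 3 * eval_fps G z \<le> block_sum (1 - v) z"
  proof (rule sums_le[OF _ sums_diff[OF AB GS] S])
    fix k
    have "(fps_A $ k - v * fps_B $ k + v\<^sup>2 / 2 * fps_C $ k - v ^ 3 * G $ k) * z ^ k \<le> block_gf (1 - v) $ k * z ^ k"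
      using z by (intro mult_right_mono taylor(2)) auto
    then show "fps_A $ k * z ^ k - v * (fps_B $ k * z ^ k) + v\<^sup>2 / 2 * (fps_C $ k * z ^ k) - v ^ 3 * (G $ k * z ^ k)
         \<le> block_gf (1 - v) $ k * z ^ k"
      by (simp add: algebra_simps)
  qed
  moreover have "eval_fps G z \<le> eval_fps G z1"
  proof (rule sums_le[OF _ s[OF G z(1,2)] s[OF G]])
    show "G $ k * z ^ k \<le> G $ k * z1 ^ k" for k
      using z block_gf_nonneg[of 1 k]
      by (intro mult_left_mono power_mono) (auto simp: Gn fps_A_def)
  qed (use z in auto)
  then have "v ^ 3 * eval_fps G z \<le> v ^ 3 * eval_fps G z1"
    using assms by (intro mult_left_mono) auto
  ultimately show "exp l * (1 - v * block_mean l + v\<^sup>2 / 2 * block_moment2 l) - v ^ 3 * eval_fps ((euler ^^ 6) fps_A) (tilt l1)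
      \<le> block_sum (1 - v) (tilt l)"
    unfolding G_def[symmetric] z1_def[symmetric] z_def[symmetric] by (simp add: algebra_simps)
qed

lemma block_sum_1: "0 \<le> l \<Longrightarrow> l < 1 \<Longrightarrow> block_sum 1 (tilt l) = exp l"
  unfolding block_sum_def fps_A_def[symmetric] tilt_def by (rule eval_A)

section \<open>Coefficients of powers of the block series\<close>

context
  fixes q :: real
  assumes q: "0 \<le> q" "q \<le> 1"
begin

lemma block_gf_power_nonneg: "0 \<le> (block_gf q ^ N) $ n"
proof (induction N arbitrary: n)
  case (Suc N)
  then show ?case
    by (auto simp: fps_mult_nth intro!: sum_nonneg mult_nonneg_nonneg block_gf_nonneg q)
qed (simp add: fps_one_nth)

lemma block_gf_power_sums:
  assumes "0 \<le> l" "l < 1"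
  shows "(\<lambda>n. (block_gf q ^ N) $ n * tilt l ^ n) sums (block_sum q (tilt l) ^ N)"
proof -
  have r: "ereal (norm (tilt l)) < fps_conv_radius f" if "subcritical f" for f
    by (intro subcritical_radius that tilt_bounds assms)
  have "(\<lambda>n. (block_gf q ^ N) $ n * tilt l ^ n) sums eval_fps (block_gf q ^ N) (tilt l)"
    by (intro sums_eval_fps r subcritical_intros subcritical_block_gf q)
  also have "eval_fps (block_gf q ^ N) (tilt l) = block_sum q (tilt l) ^ N"
    unfolding block_sum_def by (intro eval_fps_power r subcritical_block_gf q)
  finally show ?thesis .
qed

lemma block_gf_power_le:
  assumes "0 \<le> l" "l < 1"
  shows "(block_gf q ^ N) $ n * tilt l ^ n \<le> block_sum q (tilt l) ^ N"
proof -
  have "(\<Sum>n\<in>{n}. (block_gf q ^ N) $ n * tilt l ^ n) \<le> (\<Sum>n. (block_gf q ^ N) $ n * tilt l ^ n)"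
    by (rule sum_le_suminf)
      (use block_gf_power_sums[OF assms, of N] block_gf_power_nonneg tilt_bounds(1)[OF assms]
        in \<open>auto simp: sums_iff\<close>)
  then show ?thesis using block_gf_power_sums[OF assms, of N] by (simp add: sums_iff)
qed

lemma block_sum_ge_1:
  assumes "0 \<le> l" "l < 1"
  shows "1 \<le> block_sum q (tilt l)"
  using block_gf_power_le[OF assms, of 1 0] by (simp add: block_gf_nth)

text \<open>Chernoff: outside the window the terms are dominated by those at the parameters \<open>l1\<close> and \<open>l2\<close>.\<close>

lemma block_gf_power_window:
  fixes lo hi :: real
  assumes "0 < l1" "l1 \<le> l" "l \<le> l2" "l2 < 1" "finite W" "\<And>j. lo \<le> real j \<Longrightarrow> real j \<le> hi \<Longrightarrow> j \<in> W"
  shows "block_sum q (tilt l) ^ N -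
      exp (lo * (ln (tilt l) - ln (tilt l1))) * block_sum q (tilt l1) ^ N -
      exp (- (hi * (ln (tilt l2) - ln (tilt l)))) * block_sum q (tilt l2) ^ N
    \<le> (\<Sum>j\<in>W. (block_gf q ^ N) $ j * tilt l ^ j)"
proof -
  define Z where "Z j = (block_gf q ^ N) $ j" for j
  have Z: "0 \<le> Z j" for j unfolding Z_def by (rule block_gf_power_nonneg)
  define x where "x = ln (tilt l)" define x1 where "x1 = ln (tilt l1)" define x2 where "x2 = ln (tilt l2)"
  have tp: "0 < tilt l1" "0 < tilt l" "0 < tilt l2" using assms by (auto simp: tilt_def)
  have x: "x1 \<le> x" "x \<le> x2"
    unfolding x1_def x_def x2_def using tp tilt_mono[of l1 l] tilt_mono[of l l2] assms by auto
  have pw: "tilt l ^ j = exp (real j * x)" "tilt l1 ^ j = exp (real j * x1)" "tilt l2 ^ j = exp (real j * x2)" for j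
    unfolding x_def x1_def x2_def using tp by (simp_all add: exp_of_nat_mult)
  have s0: "(\<lambda>j. Z j * tilt l ^ j) sums (block_sum q (tilt l) ^ N)"
    unfolding Z_def by (rule block_gf_power_sums) (use assms in auto)
  have s1: "(\<lambda>j. exp (lo * (x - x1)) * (Z j * tilt l1 ^ j)) sums (exp (lo * (x - x1)) * block_sum q (tilt l1) ^ N)"
    unfolding Z_def by (intro sums_mult block_gf_power_sums) (use assms in auto)
  have s2: "(\<lambda>j. exp (- (hi * (x2 - x))) * (Z j * tilt l2 ^ j)) sums (exp (- (hi * (x2 - x))) * block_sum q (tilt l2) ^ N)"
    unfolding Z_def by (intro sums_mult block_gf_power_sums) (use assms in auto)
  have sW: "(\<lambda>j. if j \<in> W then Z j * tilt l ^ j else 0) sums (\<Sum>j\<in>W. Z j * tilt l ^ j)"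
    by (rule sums_If_finite_set) (rule assms)
  have "block_sum q (tilt l) ^ N - exp (lo * (x - x1)) * block_sum q (tilt l1) ^ N -
      exp (- (hi * (x2 - x))) * block_sum q (tilt l2) ^ N \<le> (\<Sum>j\<in>W. Z j * tilt l ^ j)"
  proof (rule sums_le[OF _ sums_diff[OF sums_diff[OF s0 s1] s2] sW])
    fix j
    have n1: "0 \<le> exp (lo * (x - x1)) * (Z j * tilt l1 ^ j)"
      and n2: "0 \<le> exp (- (hi * (x2 - x))) * (Z j * tilt l2 ^ j)"
      using Z[of j] tp by auto
    consider "j \<in> W" | "real j < lo" | "hi < real j" using assms(6)[of j] by fastforce
    then show "Z j * tilt l ^ j - exp (lo * (x - x1)) * (Z j * tilt l1 ^ j) -
       exp (- (hi * (x2 - x))) * (Z j * tilt l2 ^ j) \<le> (if j \<in> W then Z j * tilt l ^ j else 0)"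
    proof cases
      case 1
      then show ?thesis using n1 n2 by simp
    next
      case 2
      have "real j * (x - x1) \<le> lo * (x - x1)" using 2 x by (intro mult_right_mono) auto
      then have "tilt l ^ j \<le> exp (lo * (x - x1)) * tilt l1 ^ j"
        unfolding pw exp_add[symmetric] by (simp add: algebra_simps)
      from mult_left_mono[OF this Z[of j]]
      have "Z j * tilt l ^ j \<le> exp (lo * (x - x1)) * (Z j * tilt l1 ^ j)" by (simp add: mult_ac)
      moreover have "0 \<le> Z j * tilt l ^ j" using Z[of j] tp by simp
      ultimately show ?thesis using n2 by simp
    next
      case 3
      have "hi * (x2 - x) \<le> real j * (x2 - x)" using 3 x by (intro mult_right_mono) auto
      then have "tilt l ^ j \<le> exp (- (hi * (x2 - x))) * tilt l2 ^ j"
        unfolding pw exp_add[symmetric] by (simp add: algebra_simps)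
      from mult_left_mono[OF this Z[of j]]
      have "Z j * tilt l ^ j \<le> exp (- (hi * (x2 - x))) * (Z j * tilt l2 ^ j)" by (simp add: mult_ac)
      moreover have "0 \<le> Z j * tilt l ^ j" using Z[of j] tp by simp
      ultimately show ?thesis using n1 by simp
    qed
  qed
  then show ?thesis unfolding Z_def x_def x1_def x2_def .
qed

text \<open>Of the convolution for N + M blocks only those terms are kept where N blocks hold a
  number of cars in W; each time the other M blocks contribute at least L.\<close>

lemma block_gf_power_split:
  assumes "finite W" "\<And>j. j \<in> W \<Longrightarrow> j \<le> n"
    and "\<And>j. j \<in> W \<Longrightarrow> L \<le> (block_gf q ^ M) $ (n - j) * z ^ (n - j)" and "0 < z"
  shows "L * (\<Sum>j\<in>W. (block_gf q ^ N) $ j * z ^ j) \<le> (block_gf q ^ (N + M)) $ n * z ^ n"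
proof -
  have "L * (\<Sum>j\<in>W. (block_gf q ^ N) $ j * z ^ j) \<le>
      (\<Sum>j\<in>W. ((block_gf q ^ N) $ j * z ^ j) * ((block_gf q ^ M) $ (n - j) * z ^ (n - j)))"
    unfolding sum_distrib_left mult.commute[of L]
    using assms(3,4) by (intro sum_mono mult_left_mono mult_nonneg_nonneg block_gf_power_nonneg) auto
  also have "\<dots> = (\<Sum>j\<in>W. (block_gf q ^ N) $ j * (block_gf q ^ M) $ (n - j) * z ^ n)"
  proof (rule sum.cong[OF refl])
    fix j assume "j \<in> W"
    then have "z ^ n = z ^ j * z ^ (n - j)" using assms(2) by (simp add: power_add[symmetric])
    then show "((block_gf q ^ N) $ j * z ^ j) * ((block_gf q ^ M) $ (n - j) * z ^ (n - j)) =
       (block_gf q ^ N) $ j * (block_gf q ^ M) $ (n - j) * z ^ n" by simp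
  qed
  also have "\<dots> \<le> (\<Sum>j=0..n. (block_gf q ^ N) $ j * (block_gf q ^ M) $ (n - j) * z ^ n)"
    using assms by (intro sum_mono2) (auto intro!: mult_nonneg_nonneg block_gf_power_nonneg)
  also have "\<dots> = (block_gf q ^ (N + M)) $ n * z ^ n"
    by (simp add: power_add fps_mult_nth sum_distrib_right)
  finally show ?thesis .
qed

end

text \<open>Under the tilt l the mean number of cars in M blocks is M l / (1 - l), and l M - (1 - l)
  k vanishes when k is this mean. Since l (M + k) / k is 1 plus this deviation divided by k, the
  expansion of the logarithm leaves a quadratic loss and the prefactor of
  \<open>ln_fact_le\<close>.\<close>

lemma ln_fps_A_power_ge:
  assumes "1 \<le> M" "1 \<le> k" "0 < l" and small: "\<bar>l * real M - (1 - l) * real k\<bar> \<le> real k / 2"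
  shows "real M * l - 2 * (l * real M - (1 - l) * real k)\<^sup>2 / real k +
      ln (real M / (exp 1 * real k * real (M + k))) \<le> ln ((fps_A ^ M) $ k) + real k * ln (tilt l)"
proof -
  define d where "d = l * real M - (1 - l) * real k"
  define x where "x = d / real k"
  define m' where "m' = real (M + k)"
  have k: "0 < real k" and M: "0 < real M" and m': "0 < m'" using assms by (auto simp: m'_def)
  have x: "\<bar>x\<bar> \<le> 1 / 2" using small k by (simp add: x_def d_def field_simps)
  have x1: "l * m' / real k = 1 + x" using k by (simp add: x_def d_def m'_def field_simps)
  have "\<bar>ln (1 + x) - x\<bar> \<le> 2 * x\<^sup>2" by (rule abs_ln_one_plus_x_minus_x_bound[OF x])
  then have "x - 2 * x\<^sup>2 \<le> ln (l * m' / real k)" unfolding x1 by linarith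
  then have "real k * (x - 2 * x\<^sup>2) \<le> real k * ln (l * m' / real k)"
    using k by (intro mult_left_mono) auto
  also have "ln (l * m' / real k) = ln l + ln m' - ln (real k)"
    using k m' assms by (simp add: ln_mult ln_div)
  finally have 1: "d - 2 * d\<^sup>2 / real k \<le> real k * (ln l + ln m' - ln (real k))"
    using k by (simp add: x_def power2_eq_square algebra_simps)
  have "(fps_A ^ M) $ k = real M * m' ^ k / (fact k * m')"
    using fps_A_power_nth[of M k] assms m' by (simp add: m'_def field_simps del: of_nat_add)
  then have 2: "ln ((fps_A ^ M) $ k) = ln (real M) + real k * ln m' - ln (fact k) - ln m'"
    using M m' by (simp add: ln_mult ln_div ln_realpow)
  have "ln (tilt l) = ln l - l" using assms by (simp add: tilt_def ln_mult)
  then have 3: "real k * ln (tilt l) = real k * ln l - l * real k"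
    by (simp only: right_diff_distrib mult.commute)
  have 4: "ln (real M / (exp 1 * real k * m')) = ln (real M) - 1 - ln (real k) - ln m'"
    using M k m' by (simp add: ln_mult ln_div)
  have 5: "d = real M * l + l * real k - real k" by (simp add: d_def algebra_simps)
  have 6: "d - 2 * d\<^sup>2 / real k \<le> real k * ln l + real k * ln m' - real k * ln (real k)"
    using 1 by (simp only: distrib_left right_diff_distrib)
  have 7: "ln (fact k) \<le> real k * ln (real k) + ln (real k) + 1 - real k"
    using ln_fact_le[OF assms(2)] by (simp add: distrib_right)
  show ?thesis
    unfolding d_def[symmetric] m'_def[symmetric] 2 3 4 using 5 6 7 by linarith
qed

subsection \<open>Scaling limit of the generating function\<close>

text \<open>The relative second-order remainder, made continuous by its value at 0. With it and
  \<open>exp_rem\<close> the expansions below are exact identities, whose limits are taken factor by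
  factor.\<close>

definition ln_rem :: "real \<Rightarrow> real" where
  "ln_rem x = (if x = 0 then 1/2 else (x - ln (1 + x)) / x\<^sup>2)"

lemma ln_rem_eq: "ln (1 + x) = x - x\<^sup>2 * ln_rem x"
  by (simp add: ln_rem_def)

lemma ln_rem_tendsto:
  assumes "(X \<longlongrightarrow> 0) F"
  shows "((\<lambda>k. ln_rem (X k)) \<longlongrightarrow> 1/2) F"
proof -
  have "((\<lambda>x::real. (x - ln (1 + x)) / x\<^sup>2) \<longlongrightarrow> 1/2) (at 0)"
    by real_asymp
  then have "(ln_rem \<longlongrightarrow> 1/2) (at 0)"
    by (rule Lim_transform_eventually) (auto simp: ln_rem_def eventually_at_filter)
  then have "isCont ln_rem 0" by (simp add: isCont_def ln_rem_def[of 0])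
  from isCont_tendsto_compose[OF this assms] show ?thesis by (simp add: ln_rem_def)
qed

definition exp_rem :: "real \<Rightarrow> real" where
  "exp_rem x = (if x = 0 then 1/2 else (x - (1 - exp (- x))) / x\<^sup>2)"

lemma exp_rem_eq: "1 - exp (- x) = x - x\<^sup>2 * exp_rem x"
  by (simp add: exp_rem_def)

lemma exp_rem_tendsto:
  assumes "(X \<longlongrightarrow> 0) F"
  shows "((\<lambda>k. exp_rem (X k)) \<longlongrightarrow> 1/2) F"
proof -
  have "((\<lambda>x::real. (x - (1 - exp (- x))) / x\<^sup>2) \<longlongrightarrow> 1/2) (at 0)"
    by real_asymp
  then have "(exp_rem \<longlongrightarrow> 1/2) (at 0)"
    by (rule Lim_transform_eventually) (auto simp: exp_rem_def eventually_at_filter)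
  then have "isCont exp_rem 0" by (simp add: isCont_def exp_rem_def[of 0])
  from isCont_tendsto_compose[OF this assms] show ?thesis by (simp add: exp_rem_def)
qed

text \<open>The factor l - t becomes b times \<open>eps\<close>. It measures the effect of centring
  at \<open>T k\<close> rather than at \<open>lam b k\<close> and produces the mixed term of
  \<open>psi\<close>.\<close>

lemma beta_diff:
  assumes "l < 1" "t < 1"
  shows "block_mean l - block_mean t = (l - t) * ((l / (1 - l) + t / (1 - t)) / (2 * (1 - l) * (1 - t)))"
proof -
  have "l / (1 - l) - t / (1 - t) = (l - t) / ((1 - l) * (1 - t))"
    using assms by (simp add: field_simps)
  then have "block_mean l - block_mean t = (l - t) / ((1 - l) * (1 - t)) * (l / (1 - l) + t / (1 - t)) / 2"
    unfolding block_mean_def by (metis (no_types, opaque_lifting) diff_divide_distrib power2_eq_square square_diff_square_factored mult.commute)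
  then show ?thesis by (simp add: field_simps)
qed

section \<open>The asymptotic regime and the second-order limit of the exponent\<close>

locale sparse_regime =
  fixes \<mu> \<alpha> :: real and m n :: "nat \<Rightarrow> nat"
  assumes mu: "0 < \<mu>" "\<mu> < 1"
    and n_le: "\<And>k. n k \<le> m k"
    and m_lim: "filterlim m at_top sequentially"
    and T_lim: "(\<lambda>k. real (n k) / real (m k)) \<longlonglongrightarrow> \<mu>"
    and alpha: "1 / 2 < \<alpha>" "\<alpha> < 1"
begin

definition "N k = m k - n k"
definition "T k = real (n k) / real (m k)"
definition "eps k = real (N k) powr (\<alpha> - 1)"
definition "R k = real (N k) powr (2 * \<alpha> - 1)"

lemma T_tendsto: "T \<longlonglongrightarrow> \<mu>"
  unfolding T_def[abs_def] by (rule T_lim)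

lemma ev_T: "\<forall>\<^sub>F k in sequentially. 0 < T k \<and> T k < 1"
  using order_tendstoD[OF T_tendsto] mu by (auto intro: eventually_conj)

lemma N_eq: "real (N k) = real (m k) * (1 - T k)"
  using n_le[of k] by (cases "m k = 0") (auto simp: N_def T_def field_simps of_nat_diff)

lemma real_m: "filterlim (\<lambda>k. real (m k)) at_top sequentially"
  by (rule filterlim_compose[OF filterlim_real_sequentially m_lim])

lemma N_lim: "filterlim (\<lambda>k. real (N k)) at_top sequentially"
proof -
  have "(\<lambda>k. 1 - T k) \<longlonglongrightarrow> 1 - \<mu>" by (intro tendsto_intros T_tendsto)
  from filterlim_tendsto_pos_mult_at_top[OF this _ real_m] show ?thesis
    using mu by (simp add: N_eq mult.commute)
qed

lemma ev_N: "\<forall>\<^sub>F k in sequentially. 1 \<le> N k"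
  using N_lim[unfolded filterlim_at_top, rule_format, of 1] by eventually_elim simp

lemma eps_lim: "eps \<longlonglongrightarrow> 0"
  unfolding eps_def[abs_def] using alpha by (intro tendsto_neg_powr N_lim) auto

lemma R_lim: "filterlim R at_top sequentially"
proof -
  have "filterlim (\<lambda>x::real. x powr (2 * \<alpha> - 1)) at_top at_top"
    using alpha by real_asymp
  from filterlim_compose[OF this N_lim] show ?thesis by (simp add: R_def[abs_def])
qed

lemma ev_basic: "\<forall>\<^sub>F k in sequentially. 0 < T k \<and> T k < 1 \<and> 1 \<le> N k \<and> 0 < eps k \<and> 0 < R k \<and>
    R k = real (N k) * (eps k)\<^sup>2 \<and> real (N k) powr \<alpha> * eps k = R k \<and>
    (real (N k) powr \<alpha>)\<^sup>2 = real (N k) * R k"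
  using ev_T ev_N
proof eventually_elim
  case (elim k)
  define x where "x = real (N k)"
  have x: "0 < x" using elim by (simp add: x_def)
  have "(x powr (\<alpha> - 1))\<^sup>2 = x powr (2 * \<alpha> - 2)"
    by (simp add: power2_eq_square powr_add[symmetric])
  then have "x powr (2 * \<alpha> - 1) = x * (x powr (\<alpha> - 1))\<^sup>2"
    using x by (simp add: powr_mult_base)
  moreover have "x powr \<alpha> * x powr (\<alpha> - 1) = x powr (2 * \<alpha> - 1)"
    by (simp add: powr_add[symmetric])
  moreover have "(x powr \<alpha>)\<^sup>2 = x * x powr (2 * \<alpha> - 1)"
  proof -
    have "(x powr \<alpha>)\<^sup>2 = x powr (2 * \<alpha>)" by (simp add: powr_add[symmetric] power2_eq_square)
    then show ?thesis using x by (simp add: powr_mult_base)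
  qed
  ultimately show ?case using elim x unfolding eps_def R_def x_def[symmetric] by auto
qed

text \<open>\<open>T k\<close> is the saddle point at q = 1: there the mean size l / (1 - l) of a
  block is n / N. The shift is measured in the tree parameter l rather than in z.\<close>

definition "lam b k = T k + b * eps k"

lemma lam_lim: "lam b \<longlonglongrightarrow> \<mu>"
proof -
  have "(\<lambda>k. T k + b * eps k) \<longlonglongrightarrow> \<mu> + b * 0"
    by (intro tendsto_intros T_tendsto eps_lim)
  then show ?thesis by (simp add: lam_def[abs_def])
qed

lemma ev_lam: "\<forall>\<^sub>F k in sequentially. 0 < lam b k \<and> lam b k < (1 + \<mu>) / 2"
  using order_tendstoD(1)[OF lam_lim[of b], of 0] order_tendstoD(2)[OF lam_lim[of b], of "(1 + \<mu>) / 2"] mu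
  by (intro eventually_conj) auto

definition "log_gf s b k =
  ln (block_sum (exp (- (s * eps k))) (tilt (lam b k))) - T k / (1 - T k) * ln (tilt (lam b k))"

text \<open>The exponent of \<open>F\<^sub>q(z) ^ N z ^ (- n)\<close> relative to the saddle point at \<open>q = 1\<close> and centred by the
  mean, in units of \<open>R k\<close>.\<close>

definition "Phi s b k =
  (log_gf s b k - (T k - T k / (1 - T k) * ln (tilt (T k))) + s * eps k * block_mean (T k)) / (eps k)\<^sup>2"

text \<open>The quadratic form of second cumulants of a block. In l the size has variance \<mu> / (1
  - \<mu>)^3 with respect to log z, and b shifts log z by b (1 - \<mu>) / \<mu> times
  \<open>eps\<close>, which gives the first term; the second comes from the covariance \<mu>^2 / (1
  - \<mu>)^4 of size and displacement, the third from the variance of the displacement.\<close>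

definition "psi s b = b\<^sup>2 / (2 * \<mu> * (1 - \<mu>)) - s * b * (\<mu> / (1 - \<mu>) ^ 3) +
  s\<^sup>2 / 2 * (block_mean \<mu> + block_moment2 \<mu> - (block_mean \<mu>)\<^sup>2)"

lemma ln_tilt_diff_lim:
  "(\<lambda>k. (ln (tilt (lam b k)) - ln (tilt (T k))) / eps k) \<longlonglongrightarrow> b * (1 / \<mu> - 1)"
proof -
  have x0: "(\<lambda>k. b * eps k / T k) \<longlonglongrightarrow> 0"
    using tendsto_divide[OF tendsto_mult[OF tendsto_const eps_lim, of b] T_tendsto] mu by simp
  have "(\<lambda>k. b / T k - eps k * (b / T k)\<^sup>2 * ln_rem (b * eps k / T k) - b) \<longlonglongrightarrow>
     b / \<mu> - 0 * (b / \<mu>)\<^sup>2 * (1/2) - b"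
    using mu by (intro tendsto_intros T_tendsto eps_lim ln_rem_tendsto x0) auto
  also have "b / \<mu> - 0 * (b / \<mu>)\<^sup>2 * (1/2) - b = b * (1 / \<mu> - 1)" by (simp add: algebra_simps)
  finally show ?thesis
  proof (rule Lim_transform_eventually)
    show "\<forall>\<^sub>F k in sequentially. b / T k - eps k * (b / T k)\<^sup>2 * ln_rem (b * eps k / T k) - b =
       (ln (tilt (lam b k)) - ln (tilt (T k))) / eps k"
      using ev_basic ev_lam[of b]
    proof eventually_elim
      case (elim k)
      then have T: "0 < T k" "0 < eps k" "0 < lam b k" by auto
      have "lam b k = T k * (1 + b * eps k / T k)" using T by (simp add: lam_def field_simps)
      moreover from this have "0 < 1 + b * eps k / T k" using T by (metis zero_less_mult_pos)
      ultimately have "ln (lam b k) = ln (T k) + ln (1 + b * eps k / T k)"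
        using T by (simp add: ln_mult)
      then have "ln (tilt (lam b k)) - ln (tilt (T k)) =
          (b * eps k / T k - (b * eps k / T k)\<^sup>2 * ln_rem (b * eps k / T k)) - b * eps k"
        using T unfolding ln_rem_eq[symmetric] by (simp add: tilt_def ln_mult lam_def)
      then show ?case using T by (simp add: field_simps power2_eq_square)
    qed
  qed
qed

lemma Phi_lim:
  assumes s: "0 \<le> s"
  shows "Phi s b \<longlonglongrightarrow> psi s b"
proof -
  define v where "v k = 1 - exp (- (s * eps k))" for k
  \<comment> \<open>The relative change of the block sum from q = 1 to q; the bounds of
    \<open>block_sum_bounds\<close> determine it up to order v^3.\<close>
  define w where "w k = block_sum (1 - v k) (tilt (lam b k)) / exp (lam b k) - 1" for k
  define l1 where "l1 = (1 + \<mu>) / 2"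
  define K where "K = eval_fps ((euler ^^ 6) fps_A) (tilt l1)"
  have l1: "l1 < 1" using mu by (simp add: l1_def)
  have se0: "(\<lambda>k. s * eps k) \<longlonglongrightarrow> 0"
    using tendsto_mult[OF tendsto_const eps_lim, of s] by simp
  have v_eq: "v k = s * eps k - (s * eps k)\<^sup>2 * exp_rem (s * eps k)" for k
    unfolding v_def by (rule exp_rem_eq)
  have v0: "v \<longlonglongrightarrow> 0"
    unfolding v_def[abs_def] using tendsto_diff[OF tendsto_const tendsto_exp[OF tendsto_minus[OF se0]], of 1] by simp
  have ve: "(\<lambda>k. v k / eps k) \<longlonglongrightarrow> s"
  proof -
    have "(\<lambda>k. s - s\<^sup>2 * eps k * exp_rem (s * eps k)) \<longlonglongrightarrow> s - s\<^sup>2 * 0 * (1/2)"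
      by (intro tendsto_intros eps_lim exp_rem_tendsto se0)
    moreover have "\<forall>\<^sub>F k in sequentially. s - s\<^sup>2 * eps k * exp_rem (s * eps k) = v k / eps k"
      using ev_basic by eventually_elim (simp add: v_eq power2_eq_square field_simps)
    ultimately show ?thesis using Lim_transform_eventually by fastforce
  qed
  \<comment> \<open>The difference between 1 - q and s \<open>eps\<close> is of second order. It
    turns the second factorial moment into the second moment.\<close>
  have sev: "(\<lambda>k. (s * eps k - v k) / (eps k)\<^sup>2) \<longlonglongrightarrow> s\<^sup>2 / 2"
  proof -
    have "(\<lambda>k. s\<^sup>2 * exp_rem (s * eps k)) \<longlonglongrightarrow> s\<^sup>2 * (1/2)"
      by (intro tendsto_intros exp_rem_tendsto se0)
    moreover have "\<forall>\<^sub>F k in sequentially. s\<^sup>2 * exp_rem (s * eps k) = (s * eps k - v k) / (eps k)\<^sup>2"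
      using ev_basic by eventually_elim (simp add: v_eq power2_eq_square field_simps)
    ultimately show ?thesis using Lim_transform_eventually by fastforce
  qed
  have u_lim: "(\<lambda>k. lam b k / (1 - lam b k)) \<longlonglongrightarrow> \<mu> / (1 - \<mu>)"
    using mu by (intro tendsto_intros lam_lim) auto
  have beta_lim: "(\<lambda>k. block_mean (lam b k)) \<longlonglongrightarrow> block_mean \<mu>"
    unfolding block_mean_def using mu by (intro tendsto_intros u_lim) auto
  have gam_lim: "(\<lambda>k. block_moment2 (lam b k)) \<longlonglongrightarrow> block_moment2 \<mu>"
    unfolding block_moment2_def using mu by (intro tendsto_intros u_lim) auto
  have ev_v: "\<forall>\<^sub>F k in sequentially. 0 \<le> v k \<and> v k \<le> 1"
    using ev_basic by eventually_elim (use s in \<open>auto simp: v_def\<close>)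
  have ev_w: "\<forall>\<^sub>F k in sequentially. - v k * block_mean (lam b k) + (v k)\<^sup>2 / 2 * block_moment2 (lam b k) - v k ^ 3 * K / exp (lam b k) \<le> w k
     \<and> w k \<le> - v k * block_mean (lam b k) + (v k)\<^sup>2 / 2 * block_moment2 (lam b k)"
    using ev_v ev_lam[of b]
  proof eventually_elim
    case (elim k)
    have 1: "block_sum (1 - v k) (tilt (lam b k)) = exp (lam b k) * (1 + w k)"
      by (simp add: w_def)
    have bnd: "exp (lam b k) * (1 + w k) \<le> exp (lam b k) * (1 - v k * block_mean (lam b k) + (v k)\<^sup>2 / 2 * block_moment2 (lam b k))"
      "exp (lam b k) * (1 - v k * block_mean (lam b k) + (v k)\<^sup>2 / 2 * block_moment2 (lam b k)) - v k ^ 3 * K \<le> exp (lam b k) * (1 + w k)"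
      unfolding 1[symmetric] K_def
      by (rule block_sum_bounds[where ?l1.0 = l1]; use elim l1 in \<open>auto simp: l1_def\<close>)+
    have "1 + w k \<le> 1 - v k * block_mean (lam b k) + (v k)\<^sup>2 / 2 * block_moment2 (lam b k)"
      using bnd(1) by simp
    moreover have "(exp (lam b k) * (1 - v k * block_mean (lam b k) + (v k)\<^sup>2 / 2 * block_moment2 (lam b k)) - v k ^ 3 * K) / exp (lam b k)
        \<le> (exp (lam b k) * (1 + w k)) / exp (lam b k)"
      using bnd(2) by (intro divide_right_mono) auto
    then have "1 - v k * block_mean (lam b k) + (v k)\<^sup>2 / 2 * block_moment2 (lam b k) - v k ^ 3 * K / exp (lam b k) \<le> 1 + w k"
      by (simp add: diff_divide_distrib)
    ultimately show ?case by simp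
  qed
  have wv: "(\<lambda>k. (w k + v k * block_mean (lam b k)) / (eps k)\<^sup>2) \<longlonglongrightarrow> s\<^sup>2 / 2 * block_moment2 \<mu>"
  proof -
    have lim2: "(\<lambda>k. (v k / eps k)\<^sup>2 / 2 * block_moment2 (lam b k)) \<longlonglongrightarrow> s\<^sup>2 / 2 * block_moment2 \<mu>"
      by (intro tendsto_intros ve gam_lim) auto
    have "(\<lambda>k. (v k / eps k)\<^sup>2 / 2 * block_moment2 (lam b k) - (v k / eps k)\<^sup>2 * v k * K / exp (lam b k)) \<longlonglongrightarrow>
        s\<^sup>2 / 2 * block_moment2 \<mu> - s\<^sup>2 * 0 * K / exp \<mu>"
      by (intro tendsto_intros ve gam_lim v0 lam_lim) auto
    then have lim1: "(\<lambda>k. (v k / eps k)\<^sup>2 / 2 * block_moment2 (lam b k) - (v k / eps k)\<^sup>2 * v k * K / exp (lam b k)) \<longlonglongrightarrow>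
        s\<^sup>2 / 2 * block_moment2 \<mu>" by simp
    have ev1: "\<forall>\<^sub>F k in sequentially. (v k / eps k)\<^sup>2 / 2 * block_moment2 (lam b k) - (v k / eps k)\<^sup>2 * v k * K / exp (lam b k)
        \<le> (w k + v k * block_mean (lam b k)) / (eps k)\<^sup>2"
      using ev_w ev_basic
    proof eventually_elim
      case (elim k)
      have "((v k)\<^sup>2 / 2 * block_moment2 (lam b k) - v k ^ 3 * K / exp (lam b k)) / (eps k)\<^sup>2 \<le> (w k + v k * block_mean (lam b k)) / (eps k)\<^sup>2"
        using elim by (intro divide_right_mono) auto
      then show ?case by (simp add: diff_divide_distrib power_divide power3_eq_cube power2_eq_square mult_ac)
    qed
    have ev2: "\<forall>\<^sub>F k in sequentially. (w k + v k * block_mean (lam b k)) / (eps k)\<^sup>2 \<le> (v k / eps k)\<^sup>2 / 2 * block_moment2 (lam b k)"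
      using ev_w ev_basic
    proof eventually_elim
      case (elim k)
      have "(w k + v k * block_mean (lam b k)) / (eps k)\<^sup>2 \<le> ((v k)\<^sup>2 / 2 * block_moment2 (lam b k)) / (eps k)\<^sup>2"
        using elim by (intro divide_right_mono) auto
      then show ?case by (simp add: power_divide mult_ac)
    qed
    show ?thesis by (rule tendsto_sandwich[OF ev1 ev2 lim1 lim2])
  qed
  have we: "(\<lambda>k. w k / eps k) \<longlonglongrightarrow> - (s * block_mean \<mu>)"
  proof -
    have "(\<lambda>k. eps k * ((w k + v k * block_mean (lam b k)) / (eps k)\<^sup>2) - v k / eps k * block_mean (lam b k)) \<longlonglongrightarrow>
        0 * (s\<^sup>2 / 2 * block_moment2 \<mu>) - s * block_mean \<mu>"
      by (intro tendsto_intros eps_lim wv ve beta_lim)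
    moreover have "\<forall>\<^sub>F k in sequentially. eps k * ((w k + v k * block_mean (lam b k)) / (eps k)\<^sup>2) - v k / eps k * block_mean (lam b k) = w k / eps k"
      using ev_basic by eventually_elim (simp add: power2_eq_square field_simps)
    ultimately show ?thesis using Lim_transform_eventually by fastforce
  qed
  have w0: "w \<longlonglongrightarrow> 0"
  proof -
    have "(\<lambda>k. w k / eps k * eps k) \<longlonglongrightarrow> - (s * block_mean \<mu>) * 0"
      by (intro tendsto_intros we eps_lim)
    moreover have "\<forall>\<^sub>F k in sequentially. w k / eps k * eps k = w k"
      using ev_basic by eventually_elim simp
    ultimately show ?thesis using Lim_transform_eventually by fastforce
  qed
  have x0: "(\<lambda>k. b * eps k / T k) \<longlonglongrightarrow> 0"
    using tendsto_divide[OF tendsto_mult[OF tendsto_const eps_lim, of b] T_tendsto] mu by simp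
  \<comment> \<open>\<open>G\<close> is \<open>Phi\<close> after the cancellation of all first-order
    terms, arranged such that each factor has a limit.\<close>
  define G where "G k = b\<^sup>2 / (T k * (1 - T k)) * ln_rem (b * eps k / T k) +
     ((w k + v k * block_mean (lam b k)) / (eps k)\<^sup>2 + (s * eps k - v k) / (eps k)\<^sup>2 * block_mean (lam b k) -
      s * (b * ((lam b k / (1 - lam b k) + T k / (1 - T k)) / (2 * (1 - lam b k) * (1 - T k)))) -
      (w k / eps k)\<^sup>2 * ln_rem (w k))" for k
  have "G \<longlonglongrightarrow> b\<^sup>2 / (\<mu> * (1 - \<mu>)) * (1/2) +
     (s\<^sup>2 / 2 * block_moment2 \<mu> + s\<^sup>2 / 2 * block_mean \<mu> -
      s * (b * ((\<mu> / (1 - \<mu>) + \<mu> / (1 - \<mu>)) / (2 * (1 - \<mu>) * (1 - \<mu>)))) -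
      (- (s * block_mean \<mu>))\<^sup>2 * (1/2))"
    unfolding G_def[abs_def]
    using mu by (intro tendsto_intros T_tendsto ln_rem_tendsto x0 wv sev beta_lim u_lim lam_lim we w0) auto
  also have "b\<^sup>2 / (\<mu> * (1 - \<mu>)) * (1/2) +
     (s\<^sup>2 / 2 * block_moment2 \<mu> + s\<^sup>2 / 2 * block_mean \<mu> -
      s * (b * ((\<mu> / (1 - \<mu>) + \<mu> / (1 - \<mu>)) / (2 * (1 - \<mu>) * (1 - \<mu>)))) -
      (- (s * block_mean \<mu>))\<^sup>2 * (1/2)) = psi s b"
  proof -
    have "(\<mu> / (1 - \<mu>) + \<mu> / (1 - \<mu>)) / (2 * (1 - \<mu>) * (1 - \<mu>)) = \<mu> / (1 - \<mu>) ^ 3"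
      using mu by (simp add: divide_simps power3_eq_cube)
    then show ?thesis unfolding psi_def by (simp add: algebra_simps power2_eq_square)
  qed
  finally show ?thesis
  proof (rule Lim_transform_eventually)
    show "\<forall>\<^sub>F k in sequentially. G k = Phi s b k"
      using ev_basic ev_lam[of b] ev_lam[of 0] ev_v
    proof eventually_elim
      case (elim k)
      define t where "t = T k" define e where "e = eps k" define l where "l = lam b k"
      have t: "0 < t" "t < 1" "0 < e" "0 < l" "l < 1"
        using elim mu by (auto simp: t_def e_def l_def)
      have le: "l = t + b * e" by (simp add: l_def t_def e_def lam_def)
      have S: "block_sum (exp (- (s * e))) (tilt l) = exp l * (1 + w k)"
        by (simp add: w_def v_def e_def l_def)
      have "1 \<le> block_sum (exp (- (s * e))) (tilt l)"
        by (rule block_sum_ge_1) (use t s in auto)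
      then have "0 < exp l * (1 + w k)" unfolding S by linarith
      then have w1: "0 < 1 + w k" by (simp add: zero_less_mult_iff)
      have lnS: "ln (block_sum (exp (- (s * e))) (tilt l)) = l + (w k - (w k)\<^sup>2 * ln_rem (w k))"
        unfolding S ln_rem_eq[symmetric] using w1 by (simp add: ln_mult)
      have "l = t * (1 + b * e / t)" using t by (simp add: le field_simps)
      moreover from this have "0 < 1 + b * e / t" using t by (metis zero_less_mult_pos)
      ultimately have "ln l = ln t + ln (1 + b * e / t)"
        using t by (simp add: ln_mult)
      then have lnT: "ln (tilt l) = ln (tilt t) + ((b * e / t - (b * e / t)\<^sup>2 * ln_rem (b * e / t)) - b * e)"
        using t unfolding ln_rem_eq[symmetric] by (simp add: tilt_def ln_mult le)
      have bd: "block_mean t = block_mean l - (l - t) * ((l / (1 - l) + t / (1 - t)) / (2 * (1 - l) * (1 - t)))"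
        using beta_diff[of l t] t by simp
      define Q where "Q = (l / (1 - l) + t / (1 - t)) / (2 * (1 - l) * (1 - t))"
      define p where "p = ln_rem (b * e / t)" define p' where "p' = ln_rem (w k)"
      have "Phi s b k * e\<^sup>2 = (l + (w k - (w k)\<^sup>2 * p')) - t / (1 - t) *
          (ln (tilt t) + ((b * e / t - (b * e / t)\<^sup>2 * p) - b * e)) -
         (t - t / (1 - t) * ln (tilt t)) + s * e * (block_mean l - b * e * Q)"
        unfolding Phi_def log_gf_def l_def[symmetric] t_def[symmetric] e_def[symmetric] lnS lnT p_def p'_def
        using t bd by (simp add: Q_def le)
      also have "\<dots> = b * e + w k - (w k)\<^sup>2 * p' - t / (1 - t) * ((b * e / t - (b * e / t)\<^sup>2 * p) - b * e)
          + s * e * block_mean l - s * e * (b * e * Q)"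
        by (simp add: algebra_simps le)
      also have "t / (1 - t) * ((b * e / t - (b * e / t)\<^sup>2 * p) - b * e) = b * e - b\<^sup>2 / (t * (1 - t)) * p * e\<^sup>2"
        using t by (simp add: divide_simps power2_eq_square) (simp add: algebra_simps)
      finally have P: "Phi s b k * e\<^sup>2 = b\<^sup>2 / (t * (1 - t)) * p * e\<^sup>2 + w k - (w k)\<^sup>2 * p' + s * e * block_mean l - s * b * Q * e\<^sup>2"
        by (simp add: power2_eq_square)
      have "G k * e\<^sup>2 = b\<^sup>2 / (t * (1 - t)) * p * e\<^sup>2 + ((w k + v k * block_mean l) + (s * e - v k) * block_mean l -
          s * (b * Q) * e\<^sup>2 - (w k)\<^sup>2 * p')"
        unfolding G_def l_def[symmetric] t_def[symmetric] e_def[symmetric] p_def[symmetric] p'_def[symmetric] Q_def[symmetric]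
        using t by (simp add: distrib_right left_diff_distrib power_divide) (simp add: field_simps)
      also have "\<dots> = Phi s b k * e\<^sup>2" unfolding P by (simp add: algebra_simps)
      finally show ?case using t by simp
    qed
  qed
qed

end

subsection \<open>Moment generating function of the displacement\<close>

context sparse_regime
begin

text \<open>The logarithm of the expectation of exp (s eps (E d - d)), see
  \<open>log_mgf_expectation\<close>.\<close>

definition "log_mgf s k =
  ln ((block_gf (exp (- (s * eps k))) ^ N k) $ n k) - ln ((fps_A ^ N k) $ n k) + s * eps k * mean_disp (N k) (n k)"

lemma n_eq: "0 < T k \<Longrightarrow> T k < 1 \<Longrightarrow> real (n k) = real (N k) * (T k / (1 - T k))"
  unfolding N_eq by (cases "m k = 0") (auto simp: T_def)

lemma m_eq: "T k < 1 \<Longrightarrow> real (m k) = real (N k) / (1 - T k)"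
  unfolding N_eq by simp

lemma beta_T: "0 < T k \<Longrightarrow> T k < 1 \<Longrightarrow> 1 \<le> N k \<Longrightarrow> (real (n k))\<^sup>2 / (2 * real (N k)) = real (N k) * block_mean (T k)"
proof -
  assume *: "0 < T k" "T k < 1" "1 \<le> N k"
  define u where "u = T k / (1 - T k)"
  have "real (n k) = real (N k) * u" unfolding u_def by (rule n_eq) (use * in auto)
  then show ?thesis using * unfolding block_mean_def u_def[symmetric] by (simp add: power2_eq_square)
qed

text \<open>Factors polynomial in m vanish at speed \<open>R\<close>, since \<alpha> > 1 / 2. Hence
  no sharp local estimates are required.\<close>

lemma ln_m_over_R: "(\<lambda>k. (c + 2 * ln (real (m k))) / R k) \<longlonglongrightarrow> 0"
proof -
  have N: "(\<lambda>k. (c - 2 * ln (1 - T k)) / R k + 2 * (ln (real (N k)) / real (N k) powr (2 * \<alpha> - 1))) \<longlonglongrightarrow> 0 + 2 * 0"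
  proof (intro tendsto_intros)
    have "(\<lambda>k. c - 2 * ln (1 - T k)) \<longlonglongrightarrow> c - 2 * ln (1 - \<mu>)"
      using mu by (intro tendsto_intros T_tendsto) auto
    then show "(\<lambda>k. (c - 2 * ln (1 - T k)) / R k) \<longlonglongrightarrow> 0"
      by (rule real_tendsto_divide_at_top) (rule R_lim)
    have "((\<lambda>x::real. ln x / x powr (2 * \<alpha> - 1)) \<longlongrightarrow> 0) at_top"
      using alpha by real_asymp
    from filterlim_compose[OF this N_lim]
    show "(\<lambda>k. ln (real (N k)) / real (N k) powr (2 * \<alpha> - 1)) \<longlonglongrightarrow> 0" .
  qed
  have "\<forall>\<^sub>F k in sequentially. (c - 2 * ln (1 - T k)) / R k + 2 * (ln (real (N k)) / real (N k) powr (2 * \<alpha> - 1))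
      = (c + 2 * ln (real (m k))) / R k"
    using ev_basic
  proof eventually_elim
    case (elim k)
    then have "ln (real (m k)) = ln (real (N k)) - ln (1 - T k)"
      using m_eq[of k] by (simp add: ln_div)
    then show ?case
      unfolding R_def[symmetric] by (simp add: diff_divide_distrib add_divide_distrib)
  qed
  from Lim_transform_eventually[OF N this] show ?thesis by simp
qed

lemma ln_fps_A_le:
  assumes "0 < T k" "T k < 1" "1 \<le> N k"
  shows "ln ((fps_A ^ N k) $ n k) \<le> real (N k) * T k - real (n k) * ln (tilt (T k))"
proof -
  have t: "0 < tilt (T k)" using assms by (simp add: tilt_def)
  have p: "0 < (fps_A ^ N k) $ n k" using assms by (intro fps_A_power_pos) auto
  have "(fps_A ^ N k) $ n k * tilt (T k) ^ n k \<le> exp (T k) ^ N k"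
    using block_gf_power_le[of 1 "T k" "N k" "n k"] assms
    by (simp add: block_sum_1 fps_A_def[symmetric])
  then have "ln ((fps_A ^ N k) $ n k * tilt (T k) ^ n k) \<le> ln (exp (T k) ^ N k)"
    using p t by (intro ln_mono) auto
  then show ?thesis using p t by (simp add: ln_mult ln_realpow)
qed

text \<open>A coefficient of a series with nonnegative terms is at most the value of the series
  divided by z ^ n, for each admissible z and so for each b. The denominator is evaluated at its own
  saddle point.\<close>

lemma mgf_upper:
  assumes s: "0 \<le> s"
  shows "\<forall>\<^sub>F k in sequentially. log_mgf s k / R k \<le> Phi s b k + (1 + 2 * ln (real (m k))) / R k"
  using ev_basic ev_lam[of b]
proof eventually_elim
  case (elim k)
  define t where "t = T k" define e where "e = eps k" define l where "l = lam b k"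
  define M where "M = real (N k)" define c where "c = real (n k)"
  define q where "q = exp (- (s * e))"
  have t: "0 < t" "t < 1" "0 < e" "0 < l" "l < 1" "1 \<le> M"
    using elim mu by (auto simp: t_def e_def l_def M_def)
  have q: "0 < q" "q \<le> 1" using s t by (auto simp: q_def)
  have c: "c = M * (t / (1 - t))" unfolding c_def M_def t_def using n_eq elim by auto
  then have c0: "0 < c" using t by simp
  have nk: "1 \<le> n k" using c0 by (simp add: c_def)
  have Nk: "1 \<le> N k" using elim by simp
  have mnN: "m k = N k + n k" using n_le[of k] by (simp add: N_def)
  have tl: "0 < tilt l" "0 < tilt t" using t by (auto simp: tilt_def)
  have S1: "1 \<le> block_sum q (tilt l)" by (rule block_sum_ge_1) (use t q in auto)
  have Z0: "0 < (block_gf q ^ N k) $ n k"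
    using block_fps_power_pos[of "n k" "m k" "s * e"] Nk by (simp add: N_def q_def)
  have "(block_gf q ^ N k) $ n k * tilt l ^ n k \<le> block_sum q (tilt l) ^ N k"
    by (rule block_gf_power_le) (use t q in auto)
  then have "ln ((block_gf q ^ N k) $ n k * tilt l ^ n k) \<le> ln (block_sum q (tilt l) ^ N k)"
    using Z0 tl by (intro ln_mono) auto
  then have lnZ: "ln ((block_gf q ^ N k) $ n k) \<le> M * ln (block_sum q (tilt l)) - c * ln (tilt l)"
    using Z0 tl S1 by (simp add: ln_mult ln_realpow M_def c_def)
  \<comment> \<open>The n cars are exactly the mean number for N blocks under the tilt
    \<open>T k\<close>, so \<open>ln_fps_A_power_ge\<close> loses only its prefactor.\<close>
  have z: "t * M - (1 - t) * c = 0" unfolding c using t by simp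
  have lnP: "M * t + ln (M / (exp 1 * c * real (m k))) \<le> ln ((fps_A ^ N k) $ n k) + c * ln (tilt t)"
    using ln_fps_A_power_ge[OF Nk nk t(1)] unfolding M_def[symmetric] c_def[symmetric] mnN[symmetric] z
    using c0 by simp
  have mm: "1 \<le> real (m k)" "c \<le> real (m k)" "M \<le> real (m k)" using mnN Nk by (auto simp: c_def M_def)
  have lnb: "- (1 + 2 * ln (real (m k))) \<le> ln (M / (exp 1 * c * real (m k)))"
  proof -
    have "ln c \<le> ln (real (m k))" using mm c0 by simp
    moreover have "0 \<le> ln M" using t by simp
    moreover have "ln (M / (exp 1 * c * real (m k))) = ln M - 1 - ln c - ln (real (m k))"
      using t c0 mm by (simp add: ln_div ln_mult)
    ultimately show ?thesis by linarith
  qed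
  have "mean_disp (N k) (n k) \<le> c * (c - 1) / (2 * (M + 1))"
    unfolding c_def M_def by (rule mean_disp_upper) (use Nk in auto)
  also have "\<dots> \<le> c\<^sup>2 / (2 * M)"
    using t c0 by (intro frac_le) (auto simp: power2_eq_square algebra_simps)
  also have "\<dots> = M * block_mean t" unfolding c_def M_def t_def by (rule beta_T) (use elim in auto)
  finally have "s * e * mean_disp (N k) (n k) \<le> s * e * (M * block_mean t)"
    using s t by (intro mult_left_mono) auto
  then have "log_mgf s k \<le> M * (log_gf s b k - (t - t / (1 - t) * ln (tilt t)) + s * e * block_mean t) + (1 + 2 * ln (real (m k)))"
    using lnZ lnP lnb unfolding log_mgf_def log_gf_def e_def[symmetric] q_def[symmetric] l_def[symmetric] t_def[symmetric]
    by (simp add: c algebra_simps)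
  also have "\<dots> = Phi s b k * R k + (1 + 2 * ln (real (m k)))"
    using elim t unfolding Phi_def e_def[symmetric] t_def[symmetric] M_def by simp
  finally have "log_mgf s k / R k \<le> (Phi s b k * R k + (1 + 2 * ln (real (m k)))) / R k"
    using elim by (intro divide_right_mono) auto
  then show ?case using elim by (simp add: add_divide_distrib)
qed

text \<open>\<open>M\<close> of the \<open>N\<close> blocks are kept to correct the number of cars. The hypotheses \<open>win1\<close> and \<open>win2\<close>
  say that the other blocks, tilted to \<open>lam b k\<close>, hold a number of cars within \<open>w\<close> of its expected value.\<close>

lemma mgf_lower_pointwise:
  fixes M k :: nat and s b dl kp :: real
  defines "t \<equiv> T k" and "e \<equiv> eps k" and "l \<equiv> lam b k" and "rho \<equiv> real M / real (N k)"
    and "w \<equiv> dl * real (N k) powr \<alpha>" and "tau \<equiv> T k / (1 - T k)"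
  assumes basic: "0 < T k \<and> T k < 1 \<and> 1 \<le> N k \<and> 0 < eps k \<and> 0 < R k \<and>
    R k = real (N k) * (eps k)\<^sup>2 \<and> real (N k) powr \<alpha> * eps k = R k \<and>
    (real (N k) powr \<alpha>)\<^sup>2 = real (N k) * R k"
    and s: "0 \<le> s" and dl: "0 < dl" and kp: "0 < kp"
    and lam0: "0 < lam (b - kp) k" "lam (b + kp) k < 1"
    and M: "1 \<le> M" "M < N k" and k0: "4 \<le> real M * tau"
    and small: "real M * \<bar>b\<bar> * e / (1 - t) + w \<le> real M * tau / 4"
    and win1: "R k * ((1 - rho) * (Phi s (b - kp) k - Phi s b k) -
        dl * ((ln (tilt (lam b k)) - ln (tilt (lam (b - kp) k))) / e)) \<le> - ln 4"
    and win2: "R k * ((1 - rho) * (Phi s (b + kp) k - Phi s b k) -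
        dl * ((ln (tilt (lam (b + kp) k)) - ln (tilt (lam b k))) / e)) \<le> - ln 4"
  shows "(1 - rho) * Phi s b k + rho * Phi 0 b k - s * tau * dl - s * e * dl\<^sup>2 / (2 * rho)
     - 8 * (rho * b\<^sup>2 / (t * (1 - t)) + dl\<^sup>2 * (1 - t) / (rho * t))
     - (1 + ln 2 + s * e / (2 * (1 - t) ^ 3) + 2 * ln (real (m k))) / R k
     \<le> log_mgf s k / R k"
proof -
  define q where "q = exp (- (s * e))"
  define M' where "M' = N k - M"
  define NN where "NN = real (N k)"
  define na where "na = NN powr \<alpha>"
  define r where "r = R k"
  define Mr where "Mr = real M"
  have t: "0 < t" "t < 1" "0 < e" "1 \<le> NN" "0 < r" using basic by (auto simp: t_def e_def NN_def r_def)
  have rr: "r = NN * e\<^sup>2" "na * e = r" "na\<^sup>2 = NN * r" using basic by (auto simp: e_def NN_def r_def na_def)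
  have Mr: "1 \<le> Mr" "Mr < NN" using M by (auto simp: Mr_def NN_def)
  have tau: "tau = t / (1 - t)" "0 < tau" using t by (auto simp: tau_def t_def)
  have M'r: "real M' = NN - Mr" using M by (simp add: M'_def NN_def Mr_def of_nat_diff)
  have w: "w = dl * na" "0 < w" using dl t by (auto simp: w_def na_def NN_def)
  have q: "0 < q" "q \<le> 1" using s t by (auto simp: q_def)
  have q0: "0 \<le> q" using q by simp
  have l12: "lam (b - kp) k \<le> l" "l \<le> lam (b + kp) k" using kp t by (auto simp: lam_def l_def e_def)
  have l: "0 < l" "l < 1" using l12 lam0 by auto
  have le: "l = t + b * e" by (simp add: l_def lam_def t_def e_def)
  have tl: "0 < tilt l" "0 < tilt t" using l t by (auto simp: tilt_def)
  define c where "c = real (n k)"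
  have c: "c = NN * tau" unfolding c_def NN_def tau_def using n_eq basic by auto
  define lo where "lo = real M' * tau - w"
  define hi where "hi = real M' * tau + w"
  define W where "W = {j\<in>{..n k}. lo \<le> real j \<and> real j \<le> hi}"
  define S where "S = block_sum q (tilt l)"
  have Sge: "1 \<le> block_sum q (tilt (lam b' k))" if "0 < lam b' k" "lam b' k < 1" for b'
    by (rule block_sum_ge_1) (use that q in auto)
  have S1: "1 \<le> S" unfolding S_def by (rule block_sum_ge_1) (use l q in auto)
  have w4: "w \<le> Mr * tau / 4" and b4: "Mr * \<bar>b\<bar> * e / (1 - t) \<le> Mr * tau / 4 - w"
  proof -
    have "0 \<le> Mr * \<bar>b\<bar> * e / (1 - t)" using t Mr by simp
    then show "w \<le> Mr * tau / 4" "Mr * \<bar>b\<bar> * e / (1 - t) \<le> Mr * tau / 4 - w"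
      using small unfolding Mr_def by linarith+
  qed
  \<comment> \<open>The terms that normalise \<open>Phi\<close> do not depend on b, so comparing two
    tilts of the same blocks leaves a difference of values of \<open>Phi\<close>.\<close>
  have win_eq: "real M' * (ln (block_sum q (tilt (lam b' k))) - ln S) -
      real M' * tau * (ln (tilt (lam b' k)) - ln (tilt l)) = r * ((1 - rho) * (Phi s b' k - Phi s b k))" for b'
  proof -
    have "r * (1 - rho) = real M' * e\<^sup>2"
      unfolding rr M'r rho_def Mr_def NN_def[symmetric] using t by (simp add: field_simps)
    moreover have "(Phi s b' k - Phi s b k) * e\<^sup>2 = log_gf s b' k - log_gf s b k"
      unfolding Phi_def e_def[symmetric] using t by (simp add: diff_divide_distrib[symmetric])
    ultimately have "r * ((1 - rho) * (Phi s b' k - Phi s b k)) = real M' * (log_gf s b' k - log_gf s b k)"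
      by (metis mult.assoc mult.commute)
    then show ?thesis
      unfolding log_gf_def e_def[symmetric] q_def[symmetric] l_def[symmetric] S_def[symmetric] tau_def[symmetric]
      by (simp add: algebra_simps)
  qed
  have wr: "w * y = r * (dl * (y / e))" for y
    unfolding w rr(2)[symmetric] using t by simp
  have quarter: "exp u * block_sum q (tilt (lam b' k)) ^ M' \<le> S ^ M' / 4"
    if "0 < lam b' k" "lam b' k < 1" "u + real M' * ln (block_sum q (tilt (lam b' k))) - real M' * ln S \<le> - ln 4"
    for u b'
  proof -
    have "exp (u + real M' * ln (block_sum q (tilt (lam b' k)))) \<le> exp (real M' * ln S - ln 4)"
      using that by simp
    then show ?thesis
      using Sge[OF that(1,2)] S1 unfolding exp_add exp_diff exp_of_nat_mult by simp
  qed
  \<comment> \<open>Each Chernoff term removes at most a quarter of the total, so half of it remains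
    in the window.\<close>
  have window: "S ^ M' / 2 \<le> (\<Sum>j\<in>W. (block_gf q ^ M') $ j * tilt l ^ j)"
  proof -
    have "exp (lo * (ln (tilt l) - ln (tilt (lam (b - kp) k)))) * block_sum q (tilt (lam (b - kp) k)) ^ M'
       \<le> S ^ M' / 4"
    proof (rule quarter)
      define D where "D = ln (tilt l) - ln (tilt (lam (b - kp) k))"
      have "lo * D + real M' * ln (block_sum q (tilt (lam (b - kp) k))) - real M' * ln S =
          r * ((1 - rho) * (Phi s (b - kp) k - Phi s b k)) - w * D"
        unfolding win_eq[symmetric] lo_def D_def by (simp add: algebra_simps)
      then show "lo * (ln (tilt l) - ln (tilt (lam (b - kp) k))) +
          real M' * ln (block_sum q (tilt (lam (b - kp) k))) - real M' * ln S \<le> - ln 4"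
        using win1 unfolding wr D_def[symmetric] by (simp add: right_diff_distrib r_def D_def l_def)
    qed (use lam0 l12 l in auto)
    moreover have "exp (- (hi * (ln (tilt (lam (b + kp) k)) - ln (tilt l)))) * block_sum q (tilt (lam (b + kp) k)) ^ M'
       \<le> S ^ M' / 4"
    proof (rule quarter)
      define D where "D = ln (tilt (lam (b + kp) k)) - ln (tilt l)"
      have "- (hi * D) + real M' * ln (block_sum q (tilt (lam (b + kp) k))) - real M' * ln S =
          r * ((1 - rho) * (Phi s (b + kp) k - Phi s b k)) - w * D"
        unfolding win_eq[symmetric] hi_def D_def by (simp add: algebra_simps)
      then show "- (hi * (ln (tilt (lam (b + kp) k)) - ln (tilt l))) +
          real M' * ln (block_sum q (tilt (lam (b + kp) k))) - real M' * ln S \<le> - ln 4"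
        using win2 unfolding wr D_def[symmetric] by (simp add: right_diff_distrib r_def D_def l_def)
    qed (use lam0 l12 l in auto)
    moreover have "S ^ M' - exp (lo * (ln (tilt l) - ln (tilt (lam (b - kp) k)))) * block_sum q (tilt (lam (b - kp) k)) ^ M'
       - exp (- (hi * (ln (tilt (lam (b + kp) k)) - ln (tilt l)))) * block_sum q (tilt (lam (b + kp) k)) ^ M'
       \<le> (\<Sum>j\<in>W. (block_gf q ^ M') $ j * tilt l ^ j)"
      unfolding S_def
    proof (rule block_gf_power_window[OF q0 q(2) lam0(1) l12 lam0(2)])
      fix j assume j: "lo \<le> real j" "real j \<le> hi"
      \<comment> \<open>Even at the upper end of the window the cars do not exceed n, so the
        correction blocks receive a nonnegative number.\<close>
      have "0 < Mr * tau" using Mr tau(2) by simp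
      then have "w \<le> Mr * tau" using w4 by linarith
      then have "hi \<le> c" unfolding hi_def c M'r by (simp add: left_diff_distrib)
      then have "j \<le> n k" using j by (simp add: c_def)
      then show "j \<in> W" using j by (simp add: W_def)
    qed (simp add: W_def)
    ultimately show ?thesis by simp
  qed
  \<comment> \<open>This bounds the loss 2 d^2 / x of \<open>ln_fps_A_power_ge\<close> for x cars in
    the correction blocks: d^2 is at most twice the sum of two squares, and x is at least M tau / 2,
    whence the constant 8.\<close>
  define cost where "cost = 8 * ((Mr * b * e / (1 - t))\<^sup>2 + w\<^sup>2) / (Mr * tau)"
  \<comment> \<open>The losses are Jensen's bound at the largest number of cars
    \<open>Mr * tau + w\<close>, the quadratic cost and the prefactor.\<close>
  define lnL where "lnL = - (s * e * ((Mr * tau + w)\<^sup>2 / (2 * Mr))) + Mr * l - cost - (1 + 2 * ln (real (m k)))"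
  have each: "exp lnL \<le> (block_gf q ^ M) $ (n k - j) * tilt l ^ (n k - j)" if "j \<in> W" for j
  proof -
    define i where "i = n k - j"
    define x where "x = real i"
    have j: "j \<le> n k" "lo \<le> real j" "real j \<le> hi" using that by (auto simp: W_def)
    have xj: "x = c - real j" using j by (simp add: x_def i_def c_def of_nat_diff)
    have cM: "c - real M' * tau = Mr * tau" unfolding c M'r by (simp add: algebra_simps)
    have x1: "Mr * tau - w \<le> x" "x \<le> Mr * tau + w" using j xj cM unfolding lo_def hi_def by linarith+
    have k04: "4 \<le> Mr * tau" using k0 by (simp add: Mr_def)
    have x2: "Mr * tau / 2 \<le> x" "2 \<le> x" using x1 w4 k04 by linarith+
    have i1: "1 \<le> i" using x2 by (simp add: x_def)
    have x0: "0 < x" using x2 by simp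
    define d where "d = l * Mr - (1 - l) * x"
    \<comment> \<open>The first part is due to the difference of \<open>l\<close> and
      \<open>t\<close>, the second to the deviation that the window leaves to the correction blocks.
      Both are small against M tau.\<close>
    have "d = (l * Mr - (1 - l) * (Mr * tau)) - (1 - l) * (x - Mr * tau)"
      by (simp add: d_def algebra_simps)
    also have "l * Mr - (1 - l) * (Mr * tau) = Mr * b * e / (1 - t)"
      unfolding tau le using t by (simp add: field_simps)
    finally have d: "d = Mr * b * e / (1 - t) - (1 - l) * (x - Mr * tau)" .
    have dx: "\<bar>(1 - l) * (x - Mr * tau)\<bar> \<le> w"
    proof -
      have "\<bar>(1 - l) * (x - Mr * tau)\<bar> = (1 - l) * \<bar>x - Mr * tau\<bar>" using l by (simp add: abs_mult)
      also have "\<dots> \<le> 1 * w" using l x1 w by (intro mult_mono) auto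
      finally show ?thesis by simp
    qed
    have da: "\<bar>d\<bar> \<le> x / 2"
    proof -
      have "\<bar>Mr * b * e / (1 - t)\<bar> = Mr * \<bar>b\<bar> * e / (1 - t)" using Mr t by (simp add: abs_mult)
      then have "\<bar>d\<bar> \<le> Mr * tau / 4" unfolding d using dx b4 by linarith
      then show ?thesis using x2 by linarith
    qed
    have dc: "2 * d\<^sup>2 / x \<le> cost"
    proof -
      define u where "u = Mr * b * e / (1 - t)" define v where "v = (1 - l) * (x - Mr * tau)"
      have "v\<^sup>2 \<le> w\<^sup>2" using dx w unfolding v_def[symmetric] by (simp add: abs_le_square_iff[symmetric])
      moreover have "d\<^sup>2 \<le> 2 * u\<^sup>2 + 2 * v\<^sup>2"
        unfolding d u_def[symmetric] v_def[symmetric]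
        using zero_le_power2[of "u + v"] by (simp add: power2_eq_square algebra_simps)
      ultimately have "2 * d\<^sup>2 \<le> 4 * (u\<^sup>2 + w\<^sup>2)" by simp
      then have "2 * d\<^sup>2 / x \<le> 4 * (u\<^sup>2 + w\<^sup>2) / (Mr * tau / 2)"
        using x2 k04 by (intro frac_le) auto
      then show ?thesis unfolding cost_def u_def[symmetric] by simp
    qed
    have xm: "x \<le> real (m k)" "Mr + x \<le> real (m k)"
    proof -
      have "x \<le> c" using xj by simp
      moreover have "c + NN = real (m k)" using n_le[of k] by (simp add: c_def NN_def N_def of_nat_diff)
      ultimately show "x \<le> real (m k)" "Mr + x \<le> real (m k)" using Mr by linarith+
    qed
    have lnM: "- (1 + 2 * ln (real (m k))) \<le> ln (Mr / (exp 1 * x * (Mr + x)))"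
    proof -
      have "ln x \<le> ln (real (m k))" "ln (Mr + x) \<le> ln (real (m k))" using xm x0 Mr by simp_all
      moreover have "0 \<le> ln Mr" using Mr by simp
      moreover have "ln (Mr / (exp 1 * x * (Mr + x))) = ln Mr - 1 - ln x - ln (Mr + x)"
        using x0 Mr by (simp add: ln_div ln_mult)
      ultimately show ?thesis by linarith
    qed
    have A: "Mr * l - 2 * d\<^sup>2 / x + ln (Mr / (exp 1 * x * (Mr + x))) \<le> ln ((fps_A ^ M) $ i) + x * ln (tilt l)"
      using ln_fps_A_power_ge[OF M(1) i1 l(1)] da unfolding Mr_def x_def d_def by simp
    have "mean_disp M i \<le> x * (x - 1) / (2 * (Mr + 1))"
      unfolding x_def Mr_def by (rule mean_disp_upper) (use M in auto)
    also have "\<dots> \<le> (Mr * tau + w)\<^sup>2 / (2 * Mr)"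
    proof (rule frac_le)
      have "x * (x - 1) \<le> x\<^sup>2" using x0 by (simp add: power2_eq_square algebra_simps)
      also have "\<dots> \<le> (Mr * tau + w)\<^sup>2" using x0 x1 by (intro power_mono) auto
      finally show "x * (x - 1) \<le> (Mr * tau + w)\<^sup>2" .
    qed (use Mr in auto)
    finally have D: "s * e * mean_disp M i \<le> s * e * ((Mr * tau + w)\<^sup>2 / (2 * Mr))"
      using s t by (intro mult_left_mono) auto
    have P0: "0 < (fps_A ^ M) $ i" using M by (intro fps_A_power_pos) auto
    have "lnL \<le> - (s * e * mean_disp M i) + ln ((fps_A ^ M) $ i) + x * ln (tilt l)"
      unfolding lnL_def using A D dc lnM by linarith
    then have "exp lnL \<le> exp (- (s * e * mean_disp M i) + ln ((fps_A ^ M) $ i) + x * ln (tilt l))" by simp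
    also have "\<dots> = exp (- (s * e) * mean_disp M i) * (fps_A ^ M) $ i * tilt l ^ i"
      unfolding exp_add x_def exp_of_nat_mult using P0 tl by simp
    also have "\<dots> \<le> (block_gf q ^ M) $ i * tilt l ^ i"
      using jensen_power[of i "M + i" "s * e"] M tl unfolding q_def
      by (intro mult_right_mono) auto
    finally show ?thesis by (simp add: i_def)
  qed
  have "exp lnL * (S ^ M' / 2) \<le> exp lnL * (\<Sum>j\<in>W. (block_gf q ^ M') $ j * tilt l ^ j)"
    using window by (intro mult_left_mono) auto
  also have "\<dots> \<le> (block_gf q ^ (M' + M)) $ n k * tilt l ^ n k"
    by (rule block_gf_power_split[OF q0 q(2) _ _ each tl(1)]) (auto simp: W_def)
  also have "M' + M = N k" using M by (simp add: M'_def)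
  finally have ZZ: "exp lnL * (S ^ M' / 2) \<le> (block_gf q ^ N k) $ n k * tilt l ^ n k" .
  have "0 < exp lnL * (S ^ M' / 2)" using S1 by simp
  then have Zt: "0 < (block_gf q ^ N k) $ n k * tilt l ^ n k" using ZZ by linarith
  then have Z0: "0 < (block_gf q ^ N k) $ n k" using tl by (simp add: zero_less_mult_iff)
  have "ln (exp lnL * (S ^ M' / 2)) \<le> ln ((block_gf q ^ N k) $ n k * tilt l ^ n k)"
    using ZZ S1 by (intro ln_mono) auto
  then have lnZ: "lnL + real M' * ln S - ln 2 - c * ln (tilt l) \<le> ln ((block_gf q ^ N k) $ n k)"
    using S1 Z0 tl by (simp add: ln_mult ln_div ln_realpow c_def)
  have lnP: "ln ((fps_A ^ N k) $ n k) \<le> NN * t - c * ln (tilt t)"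
    unfolding NN_def t_def c_def by (rule ln_fps_A_le) (use basic in auto)
  have mean: "s * e * (NN * block_mean t) - s * e / (2 * (1 - t) ^ 3) \<le> s * e * mean_disp (N k) (n k)"
  proof -
    have "(real (n k))\<^sup>2 / (2 * real (N k)) - real (m k) ^ 3 / (2 * real (N k) ^ 3) \<le> mean_disp (N k) (n k)"
      by (rule mean_disp_lower) (use basic n_le[of k] in \<open>auto simp: N_def\<close>)
    moreover have "(real (n k))\<^sup>2 / (2 * real (N k)) = NN * block_mean t"
      unfolding NN_def t_def by (rule beta_T) (use basic in auto)
    moreover have "real (m k) ^ 3 / (2 * real (N k) ^ 3) = 1 / (2 * (1 - t) ^ 3)"
      using m_eq[of k] basic t unfolding NN_def[symmetric] t_def[symmetric] by (simp add: power_divide)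
    ultimately have "s * e * (NN * block_mean t - 1 / (2 * (1 - t) ^ 3)) \<le> s * e * mean_disp (N k) (n k)"
      using s t by (intro mult_left_mono) auto
    then show ?thesis by (simp add: right_diff_distrib)
  qed
  define cst where "cst = ln (tilt t)"
  \<comment> \<open>\<open>X\<close> is the contribution of a block weighted by q. \<open>Y\<close>
    is that of a correction block, for which q = 1 and the mean displacement is accounted for
    separately, whence \<open>Phi 0\<close>.\<close>
  define X where "X = ln S - tau * ln (tilt l) - (t - tau * cst) + s * e * block_mean t"
  define Y where "Y = l - tau * ln (tilt l) - (t - tau * cst)"
  define err where "err = 1 + ln 2 + s * e / (2 * (1 - t) ^ 3) + 2 * ln (real (m k))"
  have PX: "Phi s b k * e\<^sup>2 = X"
    unfolding Phi_def log_gf_def X_def S_def q_def l_def t_def e_def cst_def tau_def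
    using t by (simp add: e_def)
  have PY: "Phi 0 b k * e\<^sup>2 = Y"
    unfolding Phi_def log_gf_def Y_def cst_def tau_def using t l block_sum_1[of l]
    by (simp add: e_def l_def t_def)
  have sq: "s * e * ((Mr * tau + w)\<^sup>2 / (2 * Mr)) = Mr * (s * e * block_mean t) + s * tau * dl * r + s * e * dl\<^sup>2 / (2 * rho) * r"
  proof -
    have "(Mr * tau + w)\<^sup>2 / (2 * Mr) = Mr * block_mean t + tau * w + w\<^sup>2 / (2 * Mr)"
      using Mr unfolding block_mean_def tau(1)[symmetric] by (simp add: power2_eq_square field_simps)
    then have "s * e * ((Mr * tau + w)\<^sup>2 / (2 * Mr)) = Mr * (s * e * block_mean t) + s * tau * dl * (na * e) + s * e * (w\<^sup>2 / (2 * Mr))"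
      by (simp add: w(1) algebra_simps)
    also have "w\<^sup>2 / (2 * Mr) = dl\<^sup>2 / (2 * rho) * r"
      unfolding w(1) power_mult_distrib rr(3) rho_def Mr_def[symmetric] NN_def[symmetric] using Mr by simp
    finally show ?thesis unfolding rr(2) by simp
  qed
  have cost: "cost = 8 * (rho * b\<^sup>2 / (t * (1 - t)) + dl\<^sup>2 * (1 - t) / (rho * t)) * r"
  proof -
    have "(Mr * b * e / (1 - t))\<^sup>2 / (Mr * tau) = rho * b\<^sup>2 / (t * (1 - t)) * r"
      unfolding tau rr(1) rho_def Mr_def[symmetric] NN_def[symmetric] using Mr t
      by (simp add: power2_eq_square divide_simps)
    moreover have "w\<^sup>2 / (Mr * tau) = dl\<^sup>2 * (1 - t) / (rho * t) * r"
      unfolding w(1) power_mult_distrib rr(3) tau rho_def Mr_def[symmetric] NN_def[symmetric] using Mr t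
      by (simp add: divide_simps)
    ultimately show ?thesis unfolding cost_def by (simp add: add_divide_distrib distrib_right distrib_left)
  qed
  have "log_mgf s k \<ge> (NN - Mr) * X + Mr * Y - s * tau * dl * r - s * e * dl\<^sup>2 / (2 * rho) * r - cost - err"
  proof -
    have "lnL + real M' * ln S - ln 2 - c * ln (tilt l) - (NN * t - c * cst) + (s * e * (NN * block_mean t) - s * e / (2 * (1 - t) ^ 3))
       \<le> log_mgf s k"
      using lnZ lnP mean unfolding log_mgf_def e_def[symmetric] q_def[symmetric] cst_def by linarith
    moreover have "lnL + real M' * ln S - ln 2 - c * ln (tilt l) - (NN * t - c * cst) + (s * e * (NN * block_mean t) - s * e / (2 * (1 - t) ^ 3))
      = (NN - Mr) * X + Mr * Y - s * tau * dl * r - s * e * dl\<^sup>2 / (2 * rho) * r - cost - err"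
      unfolding lnL_def sq M'r c X_def Y_def err_def by (simp add: algebra_simps)
    ultimately show ?thesis by linarith
  qed
  moreover have "(NN - Mr) * X + Mr * Y = r * ((1 - rho) * Phi s b k + rho * Phi 0 b k)"
    unfolding PX[symmetric] PY[symmetric] rr(1) rho_def Mr_def[symmetric] NN_def[symmetric] using t
    by (simp add: field_simps)
  ultimately have "r * ((1 - rho) * Phi s b k + rho * Phi 0 b k - s * tau * dl - s * e * dl\<^sup>2 / (2 * rho)
     - 8 * (rho * b\<^sup>2 / (t * (1 - t)) + dl\<^sup>2 * (1 - t) / (rho * t))) - err \<le> log_mgf s k"
    unfolding cost by (simp add: algebra_simps)
  then have "(r * ((1 - rho) * Phi s b k + rho * Phi 0 b k - s * tau * dl - s * e * dl\<^sup>2 / (2 * rho)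
     - 8 * (rho * b\<^sup>2 / (t * (1 - t)) + dl\<^sup>2 * (1 - t) / (rho * t))) - err) / r \<le> log_mgf s k / r"
    using t by (intro divide_right_mono) auto
  then show ?thesis using t unfolding err_def r_def by (simp add: diff_divide_distrib)
qed

end

section \<open>Optimal tilt and limit of the logarithmic moment generating function\<close>

context sparse_regime
begin

text \<open>The minimiser of \<open>psi s\<close>.\<close>

definition "opt_tilt s = s * \<mu>\<^sup>2 / (1 - \<mu>)\<^sup>2"

text \<open>There is no linear term in x: at the minimiser the tilted blocks have the prescribed
  mean size to first order, so that Chernoff's bound succeeds on both sides of the window.\<close>

lemma psi_shift: "psi s (opt_tilt s + x) - psi s (opt_tilt s) = x\<^sup>2 / (2 * \<mu> * (1 - \<mu>))"
proof -
  define w where "w = 1 - \<mu>"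
  have w: "0 < w" using mu by (simp add: w_def)
  have "2 * (opt_tilt s) * x / (2 * \<mu> * w) = s * x * (\<mu> / w ^ 3)"
    unfolding opt_tilt_def w_def[symmetric] using mu w by (simp add: power2_eq_square power3_eq_cube field_simps)
  then show ?thesis
    unfolding psi_def w_def[symmetric] by (simp add: power2_eq_square add_divide_distrib algebra_simps)
qed

text \<open>Minimising over b subtracts from the variance of the displacement the squared covariance
  with the size over the variance of the size, here \<mu>^3 / (1 - \<mu>)^5.\<close>

lemma psi_opt_tilt: "psi s (opt_tilt s) = s\<^sup>2 * sigma2 \<mu> / 2"
proof -
  define w where "w = 1 - \<mu>"
  have w: "0 < w" "\<mu> = 1 - w" using mu by (auto simp: w_def)
  have "opt_tilt s ^ 2 / (2 * \<mu> * w) - s * opt_tilt s * (\<mu> / w ^ 3) = - (s\<^sup>2 / 2 * (\<mu> ^ 3 / w ^ 5))"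
    unfolding opt_tilt_def w_def[symmetric] using mu w(1) by (simp add: divide_simps) (simp add: eval_nat_numeral)
  moreover have "block_mean \<mu> + block_moment2 \<mu> - (block_mean \<mu>)\<^sup>2 - \<mu> ^ 3 / w ^ 5 = sigma2 \<mu>"
  proof -
    have "block_mean \<mu> + block_moment2 \<mu> - (block_mean \<mu>)\<^sup>2 - \<mu> ^ 3 / w ^ 5 =
      (6 * \<mu>\<^sup>2 * w ^ 3 + 24 * \<mu> ^ 3 * w\<^sup>2 + 37 * \<mu> ^ 4 * w + 15 * \<mu> ^ 5 - 3 * \<mu> ^ 4 * w - 12 * \<mu> ^ 3) / (12 * w ^ 5)"
      unfolding block_mean_def block_moment2_def w_def[symmetric] using w(1)
      by (simp add: power_divide divide_simps) (simp add: eval_nat_numeral algebra_simps)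
    also have "6 * \<mu>\<^sup>2 * w ^ 3 + 24 * \<mu> ^ 3 * w\<^sup>2 + 37 * \<mu> ^ 4 * w + 15 * \<mu> ^ 5 - 3 * \<mu> ^ 4 * w - 12 * \<mu> ^ 3
       = 6 * \<mu>\<^sup>2 - 6 * \<mu> ^ 3 + 4 * \<mu> ^ 4 - \<mu> ^ 5"
      unfolding w_def by (simp add: eval_nat_numeral algebra_simps)
    finally show ?thesis unfolding sigma2_def w_def .
  qed
  ultimately show ?thesis
    unfolding psi_def w_def[symmetric] by (simp add: algebra_simps)
qed

text \<open>The limit of the bound in \<open>mgf_lower_pointwise\<close> when \<open>dl\<close> is
  both the proportion of correction blocks and the half-width of the window in units of N powr
  \<alpha>. With this coupling dl^2 / rho is of order \<open>dl\<close>, so all losses vanish with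
  \<open>dl\<close>.\<close>

definition "lower_rate s dl = (1 - dl) * psi s (opt_tilt s) + dl * psi 0 (opt_tilt s) - s * (\<mu> / (1 - \<mu>)) * dl
  - 8 * (dl * (opt_tilt s)\<^sup>2 / (\<mu> * (1 - \<mu>)) + dl * (1 - \<mu>) / \<mu>)"

lemma mgf_lower:
  assumes s: "0 \<le> s" and dl: "0 < dl" "dl < 1" and a: "a < lower_rate s dl"
  shows "\<forall>\<^sub>F k in sequentially. a < log_mgf s k / R k"
proof -
  define b where "b = opt_tilt s"
  \<comment> \<open>This minimises kp^2 / (2 \<mu> (1 - \<mu>)) - dl kp (1 / \<mu> - 1), the price
    of shifting the tilt by \<open>kp\<close> minus the gain from leaving the window; the minimum is
    negative.\<close>
  define kp where "kp = dl * (1 - \<mu>)\<^sup>2"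
  define M where "M k = nat \<lfloor>dl * real (N k)\<rfloor>" for k
  define rho where "rho k = real (M k) / real (N k)" for k
  define tau where "tau k = T k / (1 - T k)" for k
  have kp: "0 < kp" using dl mu by (simp add: kp_def)
  have Mb: "real (M k) \<le> dl * real (N k)" "dl * real (N k) - 1 \<le> real (M k)" for k
    using dl by (auto simp: M_def intro: order.trans[OF of_nat_floor])
  have inv_N: "(\<lambda>k. 1 / real (N k)) \<longlonglongrightarrow> 0"
    by (rule real_tendsto_divide_at_top[OF tendsto_const N_lim])
  have rho_lim: "rho \<longlonglongrightarrow> dl"
  proof (rule tendsto_sandwich)
    show "\<forall>\<^sub>F k in sequentially. dl - 1 / real (N k) \<le> rho k"
      using ev_N
    proof eventually_elim
      case (elim k)
      have "(dl * real (N k) - 1) / real (N k) \<le> rho k"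
        unfolding rho_def by (intro divide_right_mono Mb) auto
      then show ?case using elim by (simp add: diff_divide_distrib)
    qed
    show "\<forall>\<^sub>F k in sequentially. rho k \<le> dl"
      using ev_N by eventually_elim (use Mb in \<open>auto simp: rho_def divide_le_eq\<close>)
    show "(\<lambda>k. dl - 1 / real (N k)) \<longlonglongrightarrow> dl"
      using tendsto_diff[OF tendsto_const inv_N, of dl] by simp
  qed simp
  have tau_lim: "tau \<longlonglongrightarrow> \<mu> / (1 - \<mu>)"
    unfolding tau_def[abs_def] using mu by (intro tendsto_intros T_tendsto) auto
  have tp: "0 < dl * (\<mu> / (1 - \<mu>))" using dl mu by simp
  have rt: "(\<lambda>k. rho k * tau k) \<longlonglongrightarrow> dl * (\<mu> / (1 - \<mu>))"
    by (intro tendsto_intros rho_lim tau_lim)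
  have ev_k0: "\<forall>\<^sub>F k in sequentially. 4 \<le> real (M k) * tau k"
  proof -
    have "\<forall>\<^sub>F k in sequentially. 4 \<le> rho k * tau k * real (N k)"
      using filterlim_tendsto_pos_mult_at_top[OF rt tp N_lim] unfolding filterlim_at_top by blast
    with ev_N show ?thesis by eventually_elim (simp add: rho_def mult_ac)
  qed
  have ev_M: "\<forall>\<^sub>F k in sequentially. 1 \<le> M k \<and> M k < N k"
    using ev_k0 ev_N
  proof eventually_elim
    case (elim k)
    have "M k \<noteq> 0" using elim by (metis mult_zero_left of_nat_0 not_numeral_le_zero)
    moreover have "dl * real (N k) < real (N k)" using elim dl by simp
    then have "real (M k) < real (N k)" using Mb(1)[of k] by linarith
    ultimately show ?case by simp
  qed
  \<comment> \<open>The window has width of order N \<open>eps\<close> and the correction blocks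
    hold a multiple of N cars. As \<alpha> < 1, \<open>eps\<close> tends to 0 and the window is
    negligible.\<close>
  have ev_small: "\<forall>\<^sub>F k in sequentially.
     real (M k) * \<bar>b\<bar> * eps k / (1 - T k) + dl * real (N k) powr \<alpha> \<le> real (M k) * tau k / 4"
  proof -
    have "(\<lambda>k. rho k * tau k / 4 - (rho k * \<bar>b\<bar> * eps k / (1 - T k) + dl * eps k)) \<longlonglongrightarrow>
      dl * (\<mu> / (1 - \<mu>)) / 4 - (dl * \<bar>b\<bar> * 0 / (1 - \<mu>) + dl * 0)"
      using mu by (intro tendsto_intros rt rho_lim eps_lim T_tendsto) auto
    then have "\<forall>\<^sub>F k in sequentially. 0 < rho k * tau k / 4 - (rho k * \<bar>b\<bar> * eps k / (1 - T k) + dl * eps k)"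
      by (rule order_tendstoD) (use dl mu in simp)
    with ev_N show ?thesis
    proof eventually_elim
      case (elim k)
      have p: "real (N k) powr \<alpha> = real (N k) * eps k"
        using elim by (simp add: eps_def powr_mult_base)
      have r: "real (M k) = rho k * real (N k)" using elim by (simp add: rho_def)
      have "0 \<le> (rho k * tau k / 4 - (rho k * \<bar>b\<bar> * eps k / (1 - T k) + dl * eps k)) * real (N k)"
        using elim by (intro mult_nonneg_nonneg) auto
      then show ?case unfolding p r by (simp add: algebra_simps)
    qed
  qed
  have win_lim: "(\<lambda>k. (1 - rho k) * (Phi s (b + x) k - Phi s b k) - dl * y k) \<longlonglongrightarrow>
      (1 - dl) * (x\<^sup>2 / (2 * \<mu> * (1 - \<mu>))) - dl * y0" if "y \<longlonglongrightarrow> y0" for x y y0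
    unfolding b_def psi_shift[of s, symmetric]
    by (intro tendsto_intros rho_lim Phi_lim that s)
  have neg: "(1 - dl) * (kp\<^sup>2 / (2 * \<mu> * (1 - \<mu>))) - dl * (kp * (1 / \<mu> - 1)) < 0"
  proof -
    have "(1 - dl) * (kp\<^sup>2 / (2 * \<mu> * (1 - \<mu>))) \<le> kp\<^sup>2 / (2 * \<mu> * (1 - \<mu>))"
      using dl mu by (intro mult_left_le_one_le) auto
    also have "\<dots> = dl * kp * (1 - \<mu>) / (2 * \<mu>)"
      using mu unfolding kp_def by (simp add: power2_eq_square field_simps)
    also have "\<dots> < dl * kp * (1 - \<mu>) / \<mu>"
      using mu dl kp by (intro divide_strict_left_mono) auto
    also have "\<dots> = dl * (kp * (1 / \<mu> - 1))" using mu by (simp add: field_simps)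
    finally show ?thesis by simp
  qed
  have ev_neg: "\<forall>\<^sub>F k in sequentially. R k * f k \<le> - ln 4" if "f \<longlonglongrightarrow> c" "c < 0" for f c
    using filterlim_tendsto_neg_mult_at_bot[OF that R_lim] unfolding filterlim_at_bot
    by (simp add: mult.commute)
  define low where "low k = (1 - rho k) * Phi s b k + rho k * Phi 0 b k - s * tau k * dl
     - s * eps k * dl\<^sup>2 / (2 * rho k)
     - 8 * (rho k * b\<^sup>2 / (T k * (1 - T k)) + dl\<^sup>2 * (1 - T k) / (rho k * T k))
     - ((s * eps k / (2 * (1 - T k) ^ 3)) / R k + (1 + ln 2 + 2 * ln (real (m k))) / R k)" for k
  have "\<forall>\<^sub>F k in sequentially. R k * ((1 - rho k) * (Phi s (b - kp) k - Phi s b k) -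
        dl * ((ln (tilt (lam b k)) - ln (tilt (lam (b - kp) k))) / eps k)) \<le> - ln 4"
  proof (rule ev_neg)
    have "(\<lambda>k. (ln (tilt (lam b k)) - ln (tilt (T k))) / eps k - (ln (tilt (lam (b - kp) k)) - ln (tilt (T k))) / eps k)
        \<longlonglongrightarrow> b * (1 / \<mu> - 1) - (b - kp) * (1 / \<mu> - 1)"
      by (intro tendsto_diff ln_tilt_diff_lim)
    then have "(\<lambda>k. (ln (tilt (lam b k)) - ln (tilt (lam (b - kp) k))) / eps k) \<longlonglongrightarrow> kp * (1 / \<mu> - 1)"
      by (simp add: diff_divide_distrib left_diff_distrib)
    from win_lim[OF this, of "- kp"]
    show "(\<lambda>k. (1 - rho k) * (Phi s (b - kp) k - Phi s b k) -
        dl * ((ln (tilt (lam b k)) - ln (tilt (lam (b - kp) k))) / eps k)) \<longlonglongrightarrow>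
        (1 - dl) * (kp\<^sup>2 / (2 * \<mu> * (1 - \<mu>))) - dl * (kp * (1 / \<mu> - 1))" by simp
  qed (rule neg)
  moreover have "\<forall>\<^sub>F k in sequentially. R k * ((1 - rho k) * (Phi s (b + kp) k - Phi s b k) -
        dl * ((ln (tilt (lam (b + kp) k)) - ln (tilt (lam b k))) / eps k)) \<le> - ln 4"
  proof (rule ev_neg)
    have "(\<lambda>k. (ln (tilt (lam (b + kp) k)) - ln (tilt (T k))) / eps k - (ln (tilt (lam b k)) - ln (tilt (T k))) / eps k)
        \<longlonglongrightarrow> (b + kp) * (1 / \<mu> - 1) - b * (1 / \<mu> - 1)"
      by (intro tendsto_diff ln_tilt_diff_lim)
    then have "(\<lambda>k. (ln (tilt (lam (b + kp) k)) - ln (tilt (lam b k))) / eps k) \<longlonglongrightarrow> kp * (1 / \<mu> - 1)"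
      by (simp add: diff_divide_distrib distrib_right)
    from win_lim[OF this, of kp]
    show "(\<lambda>k. (1 - rho k) * (Phi s (b + kp) k - Phi s b k) -
        dl * ((ln (tilt (lam (b + kp) k)) - ln (tilt (lam b k))) / eps k)) \<longlonglongrightarrow>
        (1 - dl) * (kp\<^sup>2 / (2 * \<mu> * (1 - \<mu>))) - dl * (kp * (1 / \<mu> - 1))" .
  qed (rule neg)
  moreover have "\<forall>\<^sub>F k in sequentially. a < low k"
  proof (rule order_tendstoD(1))
    have z: "(\<lambda>k. (s * eps k / (2 * (1 - T k) ^ 3)) / R k) \<longlonglongrightarrow> 0"
    proof (rule real_tendsto_divide_at_top[OF _ R_lim])
      show "(\<lambda>k. s * eps k / (2 * (1 - T k) ^ 3)) \<longlonglongrightarrow> s * 0 / (2 * (1 - \<mu>) ^ 3)"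
        using mu by (intro tendsto_intros eps_lim T_tendsto) auto
    qed
    show "low \<longlonglongrightarrow>
       (1 - dl) * psi s b + dl * psi 0 b - s * (\<mu> / (1 - \<mu>)) * dl
       - s * 0 * dl\<^sup>2 / (2 * dl)
       - 8 * (dl * b\<^sup>2 / (\<mu> * (1 - \<mu>)) + dl\<^sup>2 * (1 - \<mu>) / (dl * \<mu>)) - (0 + 0)"
      unfolding low_def[abs_def] using mu dl s
      by (intro tendsto_intros rho_lim Phi_lim tau_lim eps_lim T_tendsto z ln_m_over_R[of "1 + ln 2"]) auto
    have "dl\<^sup>2 * (1 - \<mu>) / (dl * \<mu>) = dl * (1 - \<mu>) / \<mu>"
      using dl mu by (simp add: power2_eq_square)
    then show "a < (1 - dl) * psi s b + dl * psi 0 b - s * (\<mu> / (1 - \<mu>)) * dl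
       - s * 0 * dl\<^sup>2 / (2 * dl)
       - 8 * (dl * b\<^sup>2 / (\<mu> * (1 - \<mu>)) + dl\<^sup>2 * (1 - \<mu>) / (dl * \<mu>)) - (0 + 0)"
      using a unfolding lower_rate_def b_def by simp
  qed
  ultimately show ?thesis
    using ev_basic ev_M ev_k0 ev_small ev_lam[of "b - kp"] ev_lam[of "b + kp"]
  proof eventually_elim
    case (elim k)
    have "(1 + ln 2 + s * eps k / (2 * (1 - T k) ^ 3) + 2 * ln (real (m k))) / R k =
       (s * eps k / (2 * (1 - T k) ^ 3)) / R k + (1 + ln 2 + 2 * ln (real (m k))) / R k"
      by (simp add: add_divide_distrib)
    moreover have "(1 - rho k) * Phi s b k + rho k * Phi 0 b k - s * tau k * dl
     - s * eps k * dl\<^sup>2 / (2 * rho k)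
     - 8 * (rho k * b\<^sup>2 / (T k * (1 - T k)) + dl\<^sup>2 * (1 - T k) / (rho k * T k))
     - (1 + ln 2 + s * eps k / (2 * (1 - T k) ^ 3) + 2 * ln (real (m k))) / R k \<le> log_mgf s k / R k"
      unfolding rho_def tau_def
      by (rule mgf_lower_pointwise[where kp = kp])
        (use elim s dl kp mu in \<open>auto simp: rho_def tau_def\<close>)
    ultimately show ?case using elim unfolding low_def by linarith
  qed
qed

text \<open>For the lower bound k tends to infinity at fixed \<open>dl\<close>, and only then
  \<open>dl\<close> tends to 0.\<close>

lemma mgf_lim:
  assumes s: "0 \<le> s"
  shows "(\<lambda>k. log_mgf s k / R k) \<longlonglongrightarrow> s\<^sup>2 * sigma2 \<mu> / 2"
proof (rule order_tendstoI)
  fix a assume a: "a < s\<^sup>2 * sigma2 \<mu> / 2"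
  have "((\<lambda>dl. lower_rate s dl) \<longlongrightarrow> lower_rate s 0) (at_right 0)"
    unfolding lower_rate_def using mu by (intro tendsto_intros) auto
  moreover have "lower_rate s 0 = s\<^sup>2 * sigma2 \<mu> / 2"
    by (simp add: lower_rate_def psi_opt_tilt)
  ultimately have "\<forall>\<^sub>F dl in at_right 0. a < lower_rate s dl"
    using a by (auto intro: order_tendstoD)
  moreover have "\<forall>\<^sub>F dl in at_right (0::real). 0 < dl \<and> dl < 1"
    by (auto simp: eventually_at_right_field intro!: exI[of _ 1])
  ultimately have "\<forall>\<^sub>F dl in at_right 0. a < lower_rate s dl \<and> 0 < dl \<and> dl < 1"
    by eventually_elim simp
  then obtain dl where "a < lower_rate s dl" "0 < dl" "dl < 1"
    using eventually_happens'[OF trivial_limit_at_right_real] by blast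
  then show "\<forall>\<^sub>F k in sequentially. a < log_mgf s k / R k"
    by (intro mgf_lower s)
next
  fix a assume a: "s\<^sup>2 * sigma2 \<mu> / 2 < a"
  have "(\<lambda>k. Phi s (opt_tilt s) k + (1 + 2 * ln (real (m k))) / R k) \<longlonglongrightarrow> psi s (opt_tilt s) + 0"
    by (intro tendsto_intros Phi_lim s ln_m_over_R)
  then have "\<forall>\<^sub>F k in sequentially. Phi s (opt_tilt s) k + (1 + 2 * ln (real (m k))) / R k < a"
    by (rule order_tendstoD) (use a psi_opt_tilt[of s] in linarith)
  with mgf_upper[OF s, of "opt_tilt s"] show "\<forall>\<^sub>F k in sequentially. log_mgf s k / R k < a"
    by eventually_elim linarith
qed

lemma log_mgf_expectation:
  assumes s: "0 \<le> s" and k: "1 \<le> N k" "0 < R k" "real (N k) powr \<alpha> * eps k = R k"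
  shows "ln (measure_pmf.expectation (addresses (m k) (n k)) (\<lambda>hs. exp (s * R k *
     ((expected_displacement (m k) (n k) - real (total_displacement (m k) hs)) / real (N k) powr \<alpha>)))) = log_mgf s k"
proof -
  have nm: "n k < m k" "0 < m k" using k by (auto simp: N_def)
  define E where "E = expected_displacement (m k) (n k)"
  define q where "q = exp (- (s * eps k))"
  have a: "0 < real (N k) powr \<alpha>" using k by simp
  have "s * (x * eps k) * ((E - real d) / x) = s * eps k * E + real d * (- (s * eps k))"
    if "0 < x" for d :: nat and x
    using that by (simp add: field_simps)
  from this[OF a] have "s * R k * ((E - real d) / real (N k) powr \<alpha>) = s * eps k * E + real d * (- (s * eps k))"
    for d :: nat unfolding k(3) .
  then have *: "exp (s * R k * ((E - real (total_displacement (m k) hs)) / real (N k) powr \<alpha>)) =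
      exp (s * eps k * E) * q ^ total_displacement (m k) hs" for hs
    by (simp only: exp_add exp_of_nat_mult q_def)
  have P: "0 < (fps_A ^ N k) $ n k" by (rule fps_A_power_pos) (use k in auto)
  have Z: "0 < (block_gf q ^ N k) $ n k"
    using block_fps_power_pos[OF nm(1), of "s * eps k"] by (simp add: N_def q_def)
  have "measure_pmf.expectation (addresses (m k) (n k)) (\<lambda>hs. exp (s * eps k * E) * q ^ total_displacement (m k) hs)
     = exp (s * eps k * E) * ((block_gf q ^ N k) $ n k / (fps_A ^ N k) $ n k)"
    using expectation_power[OF nm(1), of q] by (simp add: N_def)
  then show ?thesis
    unfolding E_def[symmetric] * using P Z
    by (simp add: ln_mult ln_div log_mgf_def q_def E_def expected_displacement_eq[OF nm(1)] N_def[symmetric])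
qed

end

section \<open>From the moment generating function to the tail\<close>

text \<open>The limit is given for nonnegative s only. This suffices: the tilt used for the lower
  bound is centred at y + h, and with d = h / v both s - d = y / v and s + d are
  nonnegative.\<close>

lemma gartner_ellis_upper_tail:
  fixes p :: "nat \<Rightarrow> 'a pmf" and X :: "nat \<Rightarrow> 'a \<Rightarrow> real" and R :: "nat \<Rightarrow> real"
  assumes fin: "\<And>k. finite (set_pmf (p k))" and R: "filterlim R at_top sequentially"
    and v: "0 < v" and y: "0 \<le> y"
    and mgf: "\<And>s. 0 \<le> s \<Longrightarrow> (\<lambda>k. ln (measure_pmf.expectation (p k) (\<lambda>x. exp (s * R k * X k x))) / R k) \<longlonglongrightarrow> s\<^sup>2 * v / 2"
  shows "(\<lambda>k. ln (measure_pmf.prob (p k) {x. y \<le> X k x}) / R k) \<longlonglongrightarrow> - (y\<^sup>2 / (2 * v))"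
proof -
  define P where "P k = measure_pmf.prob (p k) {x. y \<le> X k x}" for k
  define E where "E s k = measure_pmf.expectation (p k) (\<lambda>x. exp (s * R k * X k x))" for s k
  define L where "L s k = ln (E s k) / R k" for s k
  have L: "L s \<longlonglongrightarrow> s\<^sup>2 * v / 2" if "0 \<le> s" for s
    unfolding L_def[abs_def] E_def by (rule mgf[OF that])
  have int: "integrable (measure_pmf (p k)) f" for f :: "'a \<Rightarrow> real" and k
    by (rule integrable_measure_pmf_finite[OF fin])
  have E_sum: "measure_pmf.expectation (p k) f = (\<Sum>x\<in>set_pmf (p k). pmf (p k) x * f x)" for f :: "'a \<Rightarrow> real" and k
    by (subst integral_measure_pmf_real[OF fin]) (auto simp: mult.commute)
  have E0: "0 < E s k" for s k
    unfolding E_def E_sum using fin set_pmf_not_empty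
    by (intro sum_pos) (auto simp: pmf_positive)
  have P_int: "P k = measure_pmf.expectation (p k) (\<lambda>x. indicator {x. y \<le> X k x} x)" for k
    unfolding P_def by simp
  have ev_R: "\<forall>\<^sub>F k in sequentially. 0 < R k"
    using R[unfolded filterlim_at_top_dense, rule_format, of 0] .
  have E_exp: "E s k = exp (R k * L s k)" if "0 < R k" for s k
    using that E0[of s k] by (simp add: L_def)
  have upper: "P k \<le> exp (- (s * R k * y)) * E s k" if "0 < R k" "0 \<le> s" for s k
  proof -
    have "P k \<le> measure_pmf.expectation (p k) (\<lambda>x. exp (- (s * R k * y)) * exp (s * R k * X k x))"
      unfolding P_int
    proof (rule integral_mono[OF int int])
      fix x
      show "indicator {x. y \<le> X k x} x \<le> exp (- (s * R k * y)) * exp (s * R k * X k x)"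
        using that by (auto simp: indicator_def exp_add[symmetric] mult_left_mono)
    qed
    then show ?thesis by (simp add: E_def)
  qed
  \<comment> \<open>Under the tilt s = (y + h) / v the mass concentrates near y + h, in the interval
    from y to y + 2 h.\<close>
  have lower: "\<forall>\<^sub>F k in sequentially. exp (- (s * R k * (y + 2 * h))) * E s k / 2 \<le> P k"
    if h: "0 < h" and s: "s = (y + h) / v" for h s
  proof -
    \<comment> \<open>The optimal change of tilt for an exit at distance h from y + h; it makes both
      exit exponents equal to - h^2 / (2 v).\<close>
    define d where "d = h / v"
    have d: "0 < d" using h v by (simp add: d_def)
    have sd: "0 \<le> s - d" "0 \<le> s" "0 \<le> s + d" using s d y h v by (auto simp: d_def diff_divide_distrib[symmetric])
    have neg: "- (h\<^sup>2 / (2 * v)) < 0" using h v by simp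
    have bnd: "\<forall>\<^sub>F k in sequentially. R k * f k \<le> - ln 4" if "f \<longlonglongrightarrow> - (h\<^sup>2 / (2 * v))" for f
      using filterlim_tendsto_neg_mult_at_bot[OF that neg R] unfolding filterlim_at_bot
      by (simp add: mult.commute)
    have "\<forall>\<^sub>F k in sequentially. R k * (d * y + L (s - d) k - L s k) \<le> - ln 4"
    proof (rule bnd)
      have "(\<lambda>k. d * y + L (s - d) k - L s k) \<longlonglongrightarrow> d * y + (s - d)\<^sup>2 * v / 2 - s\<^sup>2 * v / 2"
        by (intro tendsto_intros L sd)
      moreover have "d * y + (s - d)\<^sup>2 * v / 2 - s\<^sup>2 * v / 2 = - (h\<^sup>2 / (2 * v))"
        unfolding s d_def using v by (simp add: power2_eq_square field_simps)
      ultimately show "(\<lambda>k. d * y + L (s - d) k - L s k) \<longlonglongrightarrow> - (h\<^sup>2 / (2 * v))" by simp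
    qed
    moreover have "\<forall>\<^sub>F k in sequentially. R k * (- (d * (y + 2 * h)) + L (s + d) k - L s k) \<le> - ln 4"
    proof (rule bnd)
      have "(\<lambda>k. - (d * (y + 2 * h)) + L (s + d) k - L s k) \<longlonglongrightarrow> - (d * (y + 2 * h)) + (s + d)\<^sup>2 * v / 2 - s\<^sup>2 * v / 2"
        by (intro tendsto_intros L sd)
      moreover have "- (d * (y + 2 * h)) + (s + d)\<^sup>2 * v / 2 - s\<^sup>2 * v / 2 = - (h\<^sup>2 / (2 * v))"
        unfolding s d_def using v by (simp add: power2_eq_square field_simps)
      ultimately show "(\<lambda>k. - (d * (y + 2 * h)) + L (s + d) k - L s k) \<longlonglongrightarrow> - (h\<^sup>2 / (2 * v))" by simp
    qed
    ultimately show ?thesis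
      using ev_R
    proof eventually_elim
      case (elim k)
      have small: "exp (R k * c) * E s' k \<le> E s k / 4" if "R k * (c + L s' k - L s k) \<le> - ln 4" for c s'
      proof -
        have "exp (R k * c + R k * L s' k) \<le> exp (R k * L s k - ln 4)"
          using that by (simp add: algebra_simps)
        then show ?thesis using elim by (simp add: exp_add exp_diff E_exp)
      qed
      \<comment> \<open>The integrand is bounded on the window by its value at y + 2 h, and on
        either side by the integrand with tilt s - d or s + d.\<close>
      have "E s k \<le> measure_pmf.expectation (p k) (\<lambda>x. exp (s * R k * (y + 2 * h)) * indicator {x. y \<le> X k x} x
          + exp (R k * (d * y)) * exp ((s - d) * R k * X k x) + exp (R k * (- (d * (y + 2 * h)))) * exp ((s + d) * R k * X k x))"
        unfolding E_def
      proof (rule integral_mono[OF int int])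
        fix x
        have R0: "0 < R k" using elim by simp
        consider "X k x < y" | "y \<le> X k x" "X k x \<le> y + 2 * h" | "y + 2 * h < X k x" by linarith
        then show "exp (s * R k * X k x) \<le> exp (s * R k * (y + 2 * h)) * indicator {x. y \<le> X k x} x
          + exp (R k * (d * y)) * exp ((s - d) * R k * X k x) + exp (R k * (- (d * (y + 2 * h)))) * exp ((s + d) * R k * X k x)"
        proof cases
          case 1
          have "R k * d * X k x \<le> R k * d * y" using 1 R0 d by (intro mult_left_mono) auto
          then have "exp (s * R k * X k x) \<le> exp (R k * (d * y)) * exp ((s - d) * R k * X k x)"
            unfolding exp_add[symmetric] by (simp add: algebra_simps)
          then show ?thesis by (smt (verit) exp_ge_zero indicator_pos_le mult_nonneg_nonneg)
        next
          case 2
          have "s * R k * X k x \<le> s * R k * (y + 2 * h)" using 2 R0 sd by (intro mult_left_mono) auto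
          then have "exp (s * R k * X k x) \<le> exp (s * R k * (y + 2 * h)) * indicator {x. y \<le> X k x} x"
            using 2 by simp
          then show ?thesis by (smt (verit) exp_ge_zero mult_nonneg_nonneg)
        next
          case 3
          have "R k * d * (y + 2 * h) \<le> R k * d * X k x" using 3 R0 d by (intro mult_left_mono) auto
          then have "exp (s * R k * X k x) \<le> exp (R k * (- (d * (y + 2 * h)))) * exp ((s + d) * R k * X k x)"
            unfolding exp_add[symmetric] by (simp add: algebra_simps)
          then show ?thesis by (smt (verit) exp_ge_zero indicator_pos_le mult_nonneg_nonneg)
        qed
      qed
      also have "\<dots> = exp (s * R k * (y + 2 * h)) * P k + exp (R k * (d * y)) * E (s - d) k +
          exp (R k * (- (d * (y + 2 * h)))) * E (s + d) k"
        unfolding P_int E_def by (simp add: Bochner_Integration.integral_add int)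
      also have "\<dots> \<le> exp (s * R k * (y + 2 * h)) * P k + E s k / 4 + E s k / 4"
        by (intro add_mono order_refl small[OF elim(1)] small[OF elim(2)])
      finally have "E s k / 2 \<le> exp (s * R k * (y + 2 * h)) * P k" by simp
      then have "exp (- (s * R k * (y + 2 * h))) * (E s k / 2) \<le>
          exp (- (s * R k * (y + 2 * h))) * (exp (s * R k * (y + 2 * h)) * P k)"
        by (intro mult_left_mono) auto
      then show ?case by (simp add: mult.assoc[symmetric] exp_add[symmetric])
    qed
  qed
  have "(\<lambda>k. ln (P k) / R k) \<longlonglongrightarrow> - (y\<^sup>2 / (2 * v))"
  proof (rule order_tendstoI)
    fix a assume a: "a < - (y\<^sup>2 / (2 * v))"
    have "((\<lambda>h. - ((y + h) / v * (y + 2 * h)) + ((y + h) / v)\<^sup>2 * v / 2) \<longlongrightarrow>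
       - ((y + 0) / v * (y + 2 * 0)) + ((y + 0) / v)\<^sup>2 * v / 2) (at_right 0)"
      using v by (intro tendsto_intros) auto
    moreover have "- ((y + 0) / v * (y + 2 * 0)) + ((y + 0) / v)\<^sup>2 * v / 2 = - (y\<^sup>2 / (2 * v))"
      using v by (simp add: power2_eq_square field_simps)
    ultimately have "\<forall>\<^sub>F h in at_right 0. a < - ((y + h) / v * (y + 2 * h)) + ((y + h) / v)\<^sup>2 * v / 2"
      using a by (auto intro: order_tendstoD)
    moreover have "\<forall>\<^sub>F h in at_right (0::real). 0 < h"
      by (auto simp: eventually_at_right_field intro!: exI[of _ 1])
    ultimately have "\<forall>\<^sub>F h in at_right 0. a < - ((y + h) / v * (y + 2 * h)) + ((y + h) / v)\<^sup>2 * v / 2 \<and> 0 < h"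
      by eventually_elim simp
    then obtain h where h: "a < - ((y + h) / v * (y + 2 * h)) + ((y + h) / v)\<^sup>2 * v / 2" "0 < h"
      using eventually_happens'[OF trivial_limit_at_right_real] by blast
    define s where "s = (y + h) / v"
    have s: "0 \<le> s" using y h v by (simp add: s_def)
    have "(\<lambda>k. - (s * (y + 2 * h)) + L s k - ln 2 / R k) \<longlonglongrightarrow> - (s * (y + 2 * h)) + s\<^sup>2 * v / 2 - 0"
      by (intro tendsto_intros L s real_tendsto_divide_at_top[OF tendsto_const R])
    then have "\<forall>\<^sub>F k in sequentially. a < - (s * (y + 2 * h)) + L s k - ln 2 / R k"
      by (rule order_tendstoD) (use h in \<open>simp add: s_def\<close>)
    with lower[OF h(2) s_def] ev_R
    show "\<forall>\<^sub>F k in sequentially. a < ln (P k) / R k"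
    proof eventually_elim
      case (elim k)
      have pos: "0 < exp (- (s * R k * (y + 2 * h))) * E s k / 2" using E0 by simp
      then have "ln (exp (- (s * R k * (y + 2 * h))) * E s k / 2) \<le> ln (P k)"
        using elim by (intro ln_mono) auto
      then have "- (s * R k * (y + 2 * h)) + R k * L s k - ln 2 \<le> ln (P k)"
        using E0[of s k] elim by (simp add: ln_mult ln_div L_def)
      then have "(- (s * R k * (y + 2 * h)) + R k * L s k - ln 2) / R k \<le> ln (P k) / R k"
        using elim by (intro divide_right_mono) auto
      then show ?case using elim by (simp add: diff_divide_distrib add_divide_distrib)
    qed
  next
    fix a assume a: "- (y\<^sup>2 / (2 * v)) < a"
    define s where "s = y / v"
    have s: "0 \<le> s" using y v by (simp add: s_def)
    have "(\<lambda>k. - (s * y) + L s k) \<longlonglongrightarrow> - (s * y) + s\<^sup>2 * v / 2"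
      by (intro tendsto_intros L s)
    moreover have "- (s * y) + s\<^sup>2 * v / 2 = - (y\<^sup>2 / (2 * v))"
      unfolding s_def using v by (simp add: power2_eq_square field_simps)
    ultimately have "\<forall>\<^sub>F k in sequentially. - (s * y) + L s k < a"
      using a by (auto intro: order_tendstoD)
    \<comment> \<open>The instance h = 1 serves to show that P is positive: \<open>ln 0\<close> is
      0, so the monotonicity of \<open>ln\<close> could not be used at probability 0.\<close>
    with lower[OF zero_less_one refl] ev_R
    show "\<forall>\<^sub>F k in sequentially. ln (P k) / R k < a"
    proof eventually_elim
      case (elim k)
      have "0 < exp (- ((y + 1) / v * R k * (y + 2 * 1))) * E ((y + 1) / v) k / 2" using E0 by simp
      then have P0: "0 < P k" using elim by linarith
      have "ln (P k) \<le> ln (exp (- (s * R k * y)) * E s k)"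
        using P0 upper[of k s] s elim by (intro ln_mono) auto
      also have "\<dots> = - (s * R k * y) + R k * L s k"
        using E0[of s k] elim by (simp add: ln_mult L_def)
      finally have "ln (P k) / R k \<le> (- (s * R k * y) + R k * L s k) / R k"
        using elim by (intro divide_right_mono) auto
      also have "\<dots> = - (s * y) + L s k" using elim by (simp add: field_simps)
      finally show ?case using elim by simp
    qed
  qed
  then show ?thesis unfolding P_def .
qed

theorem theorem7:
  fixes \<mu> \<alpha> y :: real and m n :: "nat \<Rightarrow> nat"
  assumes "0 < \<mu>" "\<mu> < 1"
    and "\<And>k. 1 \<le> m k" "\<And>k. n k \<le> m k"
    and "filterlim m at_top sequentially"
    and "(\<lambda>k. real (n k) / real (m k)) \<longlonglongrightarrow> \<mu>"
    and "1 / 2 < \<alpha>" "\<alpha> < 1"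
    and "0 \<le> y"
  shows "(\<lambda>k. 1 / real (m k - n k) powr (2 * \<alpha> - 1) *
            ln (measure_pmf.prob (addresses (m k) (n k))
              {hs. real (total_displacement (m k) hs) - expected_displacement (m k) (n k)
                     \<le> - (real (m k - n k) powr \<alpha> * y)}))
         \<longlonglongrightarrow> - (y\<^sup>2 / (2 * sigma2 \<mu>))"
proof -
  interpret sparse_regime \<mu> \<alpha> m n
    using assms by unfold_locales auto
  \<comment> \<open>The sign is reversed, so that the lower tail of the displacement is an upper
    tail of X and nonnegative s correspond to q at most 1.\<close>
  define X where "X k hs = (expected_displacement (m k) (n k) - real (total_displacement (m k) hs)) / real (N k) powr \<alpha>" for k hs
  have sigma: "0 < sigma2 \<mu>"
  proof -
    have "0 < 6 * \<mu>\<^sup>2 * (1 - \<mu>) + 3 * \<mu> ^ 4 + \<mu> ^ 4 * (1 - \<mu>)"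
      using assms(1,2) by (intro add_pos_pos mult_pos_pos) auto
    also have "\<dots> = 6 * \<mu>^2 - 6 * \<mu>^3 + 4 * \<mu>^4 - \<mu>^5"
      by (simp add: eval_nat_numeral algebra_simps)
    finally show ?thesis unfolding sigma2_def using assms(1,2) by simp
  qed
  have "(\<lambda>k. ln (measure_pmf.prob (addresses (m k) (n k)) {hs. y \<le> X k hs}) / R k) \<longlonglongrightarrow> - (y\<^sup>2 / (2 * sigma2 \<mu>))"
  proof (rule gartner_ellis_upper_tail[OF _ R_lim sigma assms(9)])
    show "finite (set_pmf (addresses (m k) (n k)))" for k
      using assms(3)[of k] by (simp add: addresses_eq hash_lists_nonempty)
    show "(\<lambda>k. ln (measure_pmf.expectation (addresses (m k) (n k)) (\<lambda>hs. exp (s * R k * X k hs))) / R k)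
        \<longlonglongrightarrow> s\<^sup>2 * sigma2 \<mu> / 2" if "0 \<le> s" for s
    proof (rule Lim_transform_eventually[OF mgf_lim[OF that]])
      show "\<forall>\<^sub>F k in sequentially. log_mgf s k / R k =
          ln (measure_pmf.expectation (addresses (m k) (n k)) (\<lambda>hs. exp (s * R k * X k hs))) / R k"
        using ev_basic
      proof eventually_elim
        case (elim k)
        have "ln (measure_pmf.expectation (addresses (m k) (n k)) (\<lambda>hs. exp (s * R k * X k hs))) = log_mgf s k"
          unfolding X_def by (rule log_mgf_expectation[OF that]) (use elim in auto)
        then show ?case by (simp only:)
      qed
    qed
  qed
  then show ?thesis
  proof (rule Lim_transform_eventually)
    show "\<forall>\<^sub>F k in sequentially. ln (measure_pmf.prob (addresses (m k) (n k)) {hs. y \<le> X k hs}) / R k =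
      1 / real (m k - n k) powr (2 * \<alpha> - 1) *
            ln (measure_pmf.prob (addresses (m k) (n k))
              {hs. real (total_displacement (m k) hs) - expected_displacement (m k) (n k)
                     \<le> - (real (m k - n k) powr \<alpha> * y)})"
      using ev_basic
    proof eventually_elim
      case (elim k)
      have "0 < real (N k) powr \<alpha>" using elim by simp
      then have "{hs. y \<le> X k hs} = {hs. real (total_displacement (m k) hs) - expected_displacement (m k) (n k)
                     \<le> - (real (N k) powr \<alpha> * y)}"
        by (auto simp: X_def pos_le_divide_eq mult.commute)
      then show ?case by (simp add: R_def N_def)
    qed
  qed
qed

end
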